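(* Let $\mathcal H_1=\{(S,\mathcal F,\delta_0),(p,\lambda),(A,\mathcal A,\varrho),(m,\tau)\}$ be a regular HMM such that $A$ is a denumerable set, and such that $S$ is partitioned into sets $S_a\in\mathcal F$, $a\in A$, with $\lambda(S_a)>0$ for each $a\in A$, $\bigcup_{a}S_a=S$, and $$m(s,t,a)=p(s,t)\,I_{S_a}(t),\qquad s,t\in S,\ a\in A .$$ Let $\mathbf P$ denote the induced filter kernel. Suppose that a) the hidden Markov chain determined by the Markov kernel $P$ is strongly ergodic with stationary measure $\pi$; b) there exist an element $a_0\in A$ and two positive numbers $d_0\le D_0$ such that $\pi(S_{a_0})>0$ and $$d_0\le p(s,t)\le D_0\qquad\text{for all }(s,t)\in S_{a_0}\times S_{a_0}.$$ Then the filter kernel $\mathbf P$ is weakly ergodic.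
   Context: Every metric space carries its Borel $\sigma$-algebra. $\mathcal P(X,\mathcal X)$ and $\mathcal Q(X,\mathcal X)$ denote the probability measures and the finite nonnegative measures on $(X,\mathcal X)$. For $\mu,\nu\in\mathcal Q(X,\mathcal X)$, $\delta_{TV}(\mu,\nu)=\|\mu-\nu\|=\sup_F(\mu(F)-\nu(F))+\sup_F(\nu(F)-\mu(F))$, and $\|\nu\|=\nu(X)$. For a $\sigma$-finite measure $\lambda$, $\mathcal Q_\lambda$ and $\mathcal P_\lambda$ denote the measures in $\mathcal Q$, $\mathcal P$ having a density with respect to $\lambda$. For a Markov kernel $Q$ on $(X,\mathcal X)$: $Q^1=Q$, $Q^{n+1}(x,F)=\int Q(x,dx')Q^n(x',F)$; $\langle u,\mu\rangle=\int u\,d\mu$. $I_F$ is the indicator function of $F$. Denumerable means finite or countably infinite. HMM with densities: $(S,\delta_0)$ (state space) and $(A,\varrho)$ (observation space) are complete separable metric spaces with Borel $\sigma$-algebras $\mathcal F,\mathcal A$; $\lambda$, $\tau$ are positive $\sigma$-finite measures on $S$, $A$; $m:S\times S\times A\to[0,\infty)$ is measurable with $\int_S\int_A m(s,t,a)\tau(da)\lambda(dt)=1$ for all $s$; $p(s,t)=\int_A m(s,t,a)\tau(da)$; the Markov kernel is $P(s,F)=\int_F p(s,t)\lambda(dt)$. When $S$ (resp. $A$) is denumerable, the metric is the discrete metric and $\lambda$ (resp. $\tau$) is counting measure; so here $\tau$ is counting measure on $A$. For $a\in A$, $x\in\mathcal Q_\lambda(S,\mathcal F)$, let $(xM_a)(F)=\int_S\int_F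 m(s,t,a)\lambda(dt)x(ds)$. The HMM is regular if $(x,a)\mapsto xM_a$ is a continuous map $\mathcal Q_\lambda(S,\mathcal F)\times A\to\mathcal Q_\lambda(S,\mathcal F)$ (total variation topology on $\mathcal Q_\lambda$, product topology on the domain). $K=\mathcal P_\lambda(S,\mathcal F)$ with metric $\delta_{TV}$ and Borel $\sigma$-algebra $\mathcal E$. The filter kernel on $(K,\mathcal E)$ is $\mathbf P(x,E)=\int_{A_x^+} I_E\big(xM_a/\|xM_a\|\big)\|xM_a\|\,\tau(da)$, where $A_x^+=\{a\in A:\|xM_a\|>0\}$. $P$ is strongly ergodic with limit (stationary) measure $\pi\in\mathcal P(S,\mathcal F)$ if $\lim_n\delta_{TV}(P^n(s,\cdot),\pi)=0$ for all $s\in S$. For a Markov kernel $Q$ on a metric space $X$ with metric $\phi$: $\mathrm{Lip}_1[X]$ is the set of bounded real functions with $|u(x)-u(y)|\le\phi(x,y)$; $C[X]$ the bounded continuous real functions. $Q$ is weakly contracting if $\lim_n\sup\{\langle u,Q^n(x,\cdot)\rangle-\langle u,Q^n(y,\cdot)\rangle:u\in\mathrm{Lip}_1[X]\}=0$ for all $x,y\in X$. $Q$ is weakly ergodic if it is weakly contracting and there is a probability measure $\nu$ on $X$ with $\lim_n\langle u,Q^n(x,\cdot)\rangle=\langle u,\nu\rangle$ for all $u\in C[X]$ and all $x\in X$. *)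

theory Defs
  imports "HOL-Probability.Probability"
begin

section \<open>Measures with the total variation metric\<close>

definition finite_borel_measures :: "'s::topological_space measure set" where
  "finite_borel_measures = {x. sets x = sets borel \<and> finite_measure x}"

definition tv_dist :: "'s::topological_space measure \<Rightarrow> 's measure \<Rightarrow> real" where
  "tv_dist x y =
     (SUP F \<in> sets borel. measure x F - measure y F) +
     (SUP F \<in> sets borel. measure y F - measure x F)"

text \<open>A metric in the sense of the library is required to be symmetric and nonnegative on the whole
  type, whereas the suprema above are meaningless for infinite measures; hence the case
  distinction.\<close>

definition finite_borel_metric :: "'s::topological_space measure metric" where
  "finite_borel_metric =
     metric (finite_borel_measures,
       \<lambda>x y. if x \<in> finite_borel_measures \<and> y \<in> finite_borel_measures then tv_dist x y else 0)"

definition density_measures :: "'s::topological_space measure \<Rightarrow> 's measure set" where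
  "density_measures lam =
     {x \<in> finite_borel_measures. \<exists>f \<in> borel_measurable lam. x = density lam f}"

definition density_probs :: "'s::topological_space measure \<Rightarrow> 's measure set" where
  "density_probs lam = {x \<in> density_measures lam. prob_space x}"

definition density_measures_metric :: "'s::topological_space measure \<Rightarrow> 's measure metric" where
  "density_measures_metric lam = submetric finite_borel_metric (density_measures lam)"

definition density_probs_metric :: "'s::topological_space measure \<Rightarrow> 's measure metric" where
  "density_probs_metric lam = submetric finite_borel_metric (density_probs lam)"

lemma tv_bdd_above:
  assumes "x \<in> finite_borel_measures"
  shows "bdd_above ((\<lambda>F. measure x F - measure y F) ` sets borel)"
proof -
  interpret finite_measure x using assms by (simp add: finite_borel_measures_def)
  have "measure x F - measure y F \<le> measure x (space x)" for F
    using bounded_measure[of F] measure_nonneg[of y F] by linarith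
  then show ?thesis by (auto intro!: bdd_aboveI2)
qed

lemma tv_upper:
  assumes "x \<in> finite_borel_measures" "F \<in> sets borel"
  shows "measure x F - measure y F \<le> (SUP F \<in> sets borel. measure x F - measure y F)"
  using assms tv_bdd_above by (intro cSUP_upper) auto

lemma tv_half_nonneg:
  assumes "x \<in> finite_borel_measures"
  shows "0 \<le> (SUP F \<in> sets borel. measure x F - measure y F)"
  using tv_upper[OF assms, of "{}" y] by simp

lemma tv_dist_nonneg:
  assumes "x \<in> finite_borel_measures" "y \<in> finite_borel_measures"
  shows "0 \<le> tv_dist x y"
  using tv_half_nonneg[OF assms(1), of y] tv_half_nonneg[OF assms(2), of x]
  by (simp add: tv_dist_def)

lemma tv_dist_eq_0_iff:
  assumes x: "x \<in> finite_borel_measures" and y: "y \<in> finite_borel_measures"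
  shows "tv_dist x y = 0 \<longleftrightarrow> x = y"
proof
  assume 0: "tv_dist x y = 0"
  have le: "measure x F \<le> measure y F" "measure y F \<le> measure x F" if "F \<in> sets borel" for F
    using 0 tv_half_nonneg[OF x, of y] tv_half_nonneg[OF y, of x]
      tv_upper[OF x that, of y] tv_upper[OF y that, of x]
    by (auto simp: tv_dist_def)
  interpret x: finite_measure x using x by (simp add: finite_borel_measures_def)
  interpret y: finite_measure y using y by (simp add: finite_borel_measures_def)
  show "x = y"
  proof (rule measure_eqI)
    show "sets x = sets y" using x y by (simp add: finite_borel_measures_def)
    fix F assume "F \<in> sets x"
    then have "F \<in> sets borel" using x by (simp add: finite_borel_measures_def)
    from le[OF this] show "emeasure x F = emeasure y F"
      by (simp add: x.emeasure_eq_measure y.emeasure_eq_measure)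
  qed
next
  assume "x = y"
  moreover have "sets (borel :: 'a measure) \<noteq> {}" by auto
  ultimately show "tv_dist x y = 0" by (simp add: tv_dist_def)
qed

lemma tv_half_triangle:
  assumes x: "x \<in> finite_borel_measures" and y: "y \<in> finite_borel_measures"
  shows "(SUP F \<in> sets borel. measure x F - measure z F) \<le>
     (SUP F \<in> sets borel. measure x F - measure y F) +
     (SUP F \<in> sets borel. measure y F - measure z F)"
proof (rule cSUP_least)
  fix F :: "'a set" assume F: "F \<in> sets borel"
  show "measure x F - measure z F \<le>
     (SUP F \<in> sets borel. measure x F - measure y F) +
     (SUP F \<in> sets borel. measure y F - measure z F)"
    using tv_upper[OF x F, of y] tv_upper[OF y F, of z] by linarith
qed auto

lemma Metric_space_tv_dist:
  "Metric_space finite_borel_measures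
     (\<lambda>x y. if x \<in> finite_borel_measures \<and> y \<in> finite_borel_measures then tv_dist x y else 0)"
proof
  fix x y z :: "'a measure"
  assume "x \<in> finite_borel_measures" "y \<in> finite_borel_measures" "z \<in> finite_borel_measures"
  then show "(if x \<in> finite_borel_measures \<and> z \<in> finite_borel_measures then tv_dist x z else 0) \<le>
     (if x \<in> finite_borel_measures \<and> y \<in> finite_borel_measures then tv_dist x y else 0) +
     (if y \<in> finite_borel_measures \<and> z \<in> finite_borel_measures then tv_dist y z else 0)"
    using tv_half_triangle[of x y z] tv_half_triangle[of z y x]
    by (simp add: tv_dist_def)
qed (auto simp: tv_dist_nonneg tv_dist_eq_0_iff, auto simp: tv_dist_def)

lemma mspace_finite_borel_metric [simp]: "mspace finite_borel_metric = finite_borel_measures"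
  by (simp add: finite_borel_metric_def Metric_space.mspace_metric[OF Metric_space_tv_dist])

lemma mdist_finite_borel_metric:
  assumes "x \<in> finite_borel_measures" "y \<in> finite_borel_measures"
  shows "mdist finite_borel_metric x y = tv_dist x y"
  using assms
  by (simp add: finite_borel_metric_def Metric_space.mdist_metric[OF Metric_space_tv_dist])

lemma mspace_density_measures_metric [simp]:
  "mspace (density_measures_metric lam) = density_measures lam"
  by (auto simp: density_measures_metric_def density_measures_def)

lemma mspace_density_probs_metric [simp]:
  "mspace (density_probs_metric lam) = density_probs lam"
  by (auto simp: density_probs_metric_def density_probs_def density_measures_def)

lemma mdist_density_probs_metric:
  assumes "x \<in> density_probs lam" "y \<in> density_probs lam"
  shows "mdist (density_probs_metric lam) x y = tv_dist x y"
  using assms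
  by (simp add: density_probs_metric_def density_probs_def density_measures_def
      mdist_finite_borel_metric)


section \<open>Markov kernels on metric spaces\<close>

definition borel_of_metric :: "'x metric \<Rightarrow> 'x measure" where
  "borel_of_metric X = sigma (mspace X) {U. openin (mtopology_of X) U}"

lemma sets_borel_of_metric:
  "sets (borel_of_metric X) = sigma_sets (mspace X) {U. openin (mtopology_of X) U}"
  unfolding borel_of_metric_def by (rule sets_measure_of) (auto dest!: openin_subset)

lemma space_borel_of_metric: "space (borel_of_metric X) = mspace X"
  unfolding borel_of_metric_def by (rule space_measure_of) (auto dest!: openin_subset)

text \<open>A Markov kernel on a measurable space \<open>N\<close> is an element of \<open>N \<rightarrow>\<^sub>M prob_algebra N\<close>.\<close>

primrec kernel_pow :: "'x measure \<Rightarrow> ('x \<Rightarrow> 'x measure) \<Rightarrow> nat \<Rightarrow> 'x \<Rightarrow> 'x measure" where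
  "kernel_pow N Q 0 = return N"
| "kernel_pow N Q (Suc n) = (\<lambda>x. Q x \<bind> kernel_pow N Q n)"

lemma kernel_pow_in_prob_algebra:
  assumes Q: "Q \<in> N \<rightarrow>\<^sub>M prob_algebra N"
  shows "kernel_pow N Q n \<in> N \<rightarrow>\<^sub>M prob_algebra N"
proof (induction n)
  case 0
  then show ?case by (simp add: measurable_return_prob_space)
next
  case (Suc n)
  then show ?case
    using Q by (simp add: measurable_bind_prob_space)
qed

lemma kernel_pow_1:
  assumes "Q \<in> N \<rightarrow>\<^sub>M prob_algebra N" "x \<in> space N"
  shows "kernel_pow N Q (Suc 0) x = Q x"
proof -
  have "Q x \<in> space (prob_algebra N)" using assms by (rule measurable_space)
  then have "sets (Q x) = sets N" by (simp add: space_prob_algebra)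
  then show ?thesis by (simp add: bind_return'')
qed

lemma emeasure_kernel_pow_Suc:
  assumes Q: "Q \<in> N \<rightarrow>\<^sub>M prob_algebra N" and x: "x \<in> space N" and F: "F \<in> sets N"
  shows "emeasure (kernel_pow N Q (Suc n) x) F = (\<integral>\<^sup>+ y. emeasure (kernel_pow N Q n y) F \<partial>Q x)"
  using emeasure_bind_prob_algebra[OF measurable_space[OF Q x] kernel_pow_in_prob_algebra[OF Q] F]
  by simp

definition Lip1 :: "'x metric \<Rightarrow> ('x \<Rightarrow> real) set" where
  "Lip1 X = {u. bounded (u ` mspace X) \<and>
     (\<forall>x \<in> mspace X. \<forall>y \<in> mspace X. \<bar>u x - u y\<bar> \<le> mdist X x y)}"

definition bounded_cont :: "'x metric \<Rightarrow> ('x \<Rightarrow> real) set" where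
  "bounded_cont X =
     {u. bounded (u ` mspace X) \<and> continuous_map (mtopology_of X) euclideanreal u}"

text \<open>The supremum is taken in the extended reals since it can be infinite for an unbounded
  space.\<close>

definition weakly_contracting :: "'x metric \<Rightarrow> ('x \<Rightarrow> 'x measure) \<Rightarrow> bool" where
  "weakly_contracting X Q \<longleftrightarrow>
     (\<forall>x \<in> mspace X. \<forall>y \<in> mspace X.
        (\<lambda>n. SUP u \<in> Lip1 X.
           ereal ((\<integral>z. u z \<partial>kernel_pow (borel_of_metric X) Q n x) -
                  (\<integral>z. u z \<partial>kernel_pow (borel_of_metric X) Q n y))) \<longlonglongrightarrow> 0)"

definition weakly_ergodic :: "'x metric \<Rightarrow> ('x \<Rightarrow> 'x measure) \<Rightarrow> bool" where
  "weakly_ergodic X Q \<longleftrightarrow>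
     weakly_contracting X Q \<and>
     (\<exists>nu. prob_space nu \<and> sets nu = sets (borel_of_metric X) \<and>
        (\<forall>u \<in> bounded_cont X. \<forall>x \<in> mspace X.
           (\<lambda>n. \<integral>z. u z \<partial>kernel_pow (borel_of_metric X) Q n x) \<longlonglongrightarrow> (\<integral>z. u z \<partial>nu)))"

definition strongly_ergodic ::
  "('s::topological_space \<Rightarrow> 's measure) \<Rightarrow> 's measure \<Rightarrow> bool" where
  "strongly_ergodic P mu \<longleftrightarrow>
     prob_space mu \<and> sets mu = sets borel \<and>
     (\<forall>s. (\<lambda>n. tv_dist (kernel_pow borel P n s) mu) \<longlonglongrightarrow> 0)"


section \<open>Hidden Markov models with densities\<close>

text \<open>State and observation space are the types \<open>'s\<close> and \<open>'a\<close>. The last two assumptions are the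
  convention that a denumerable space carries the discrete metric and counting measure.\<close>

locale hmm =
  fixes lam :: "'s::polish_space measure"
    and tau :: "'a::polish_space measure"
    and m :: "'s \<Rightarrow> 's \<Rightarrow> 'a \<Rightarrow> real"
  assumes sets_lam: "sets lam = sets borel"
    and sets_tau: "sets tau = sets borel"
    and sigma_finite_lam: "sigma_finite_measure lam"
    and sigma_finite_tau: "sigma_finite_measure tau"
    and m_nonneg: "\<And>s t a. 0 \<le> m s t a"
    and m_measurable: "(\<lambda>(s, t, a). m s t a) \<in> borel_measurable (borel \<Otimes>\<^sub>M borel \<Otimes>\<^sub>M borel)"
    and m_stochastic: "\<And>s. (\<integral>\<^sup>+ t. (\<integral>\<^sup>+ a. ennreal (m s t a) \<partial>tau) \<partial>lam) = 1"
    and denumerable_state: "countable (UNIV :: 's set) \<Longrightarrow>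
      (\<forall>s t :: 's. dist s t = (if s = t then 0 else 1)) \<and> lam = count_space UNIV"
    and denumerable_obs: "countable (UNIV :: 'a set) \<Longrightarrow>
      (\<forall>a b :: 'a. dist a b = (if a = b then 0 else 1)) \<and> tau = count_space UNIV"

text \<open>The transition density may be infinite on a null set, so it takes values in \<^typ>\<open>ennreal\<close>.\<close>

definition trans_density ::
  "'a measure \<Rightarrow> ('s \<Rightarrow> 's \<Rightarrow> 'a \<Rightarrow> real) \<Rightarrow> 's \<Rightarrow> 's \<Rightarrow> ennreal" where
  "trans_density tau m s t = (\<integral>\<^sup>+ a. ennreal (m s t a) \<partial>tau)"

definition hidden_kernel ::
  "'s measure \<Rightarrow> 'a measure \<Rightarrow> ('s \<Rightarrow> 's \<Rightarrow> 'a \<Rightarrow> real) \<Rightarrow> 's \<Rightarrow> 's measure" where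
  "hidden_kernel lam tau m s = density lam (trans_density tau m s)"

text \<open>The measure \<open>x M\<^sub>a\<close>.\<close>

definition obs_step ::
  "'s::topological_space measure \<Rightarrow> ('s \<Rightarrow> 's \<Rightarrow> 'a \<Rightarrow> real) \<Rightarrow> 's measure \<Rightarrow> 'a \<Rightarrow> 's measure" where
  "obs_step lam m x a =
     measure_of UNIV (sets borel)
       (\<lambda>F. \<integral>\<^sup>+ s. (\<integral>\<^sup>+ t \<in> F. ennreal (m s t a) \<partial>lam) \<partial>x)"

locale regular_hmm = hmm +
  assumes regular:
    "continuous_map
       (prod_topology (mtopology_of (density_measures_metric lam)) euclidean)
       (mtopology_of (density_measures_metric lam))
       (\<lambda>(x, a). obs_step lam m x a)"

definition normalize_measure :: "'s measure \<Rightarrow> 's measure" where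
  "normalize_measure x = scale_measure (inverse (emeasure x (space x))) x"

definition filter_kernel ::
  "'s::topological_space measure \<Rightarrow> 'a measure \<Rightarrow> ('s \<Rightarrow> 's \<Rightarrow> 'a \<Rightarrow> real) \<Rightarrow>
     's measure \<Rightarrow> 's measure measure" where
  "filter_kernel lam tau m x =
     measure_of (density_probs lam) (sets (borel_of_metric (density_probs_metric lam)))
       (\<lambda>E. \<integral>\<^sup>+ a \<in> {a. 0 < emeasure (obs_step lam m x a) UNIV}.
          indicator E (normalize_measure (obs_step lam m x a)) *
          emeasure (obs_step lam m x a) UNIV \<partial>tau)"

text \<open>The set functions used in \<^const>\<open>obs_step\<close> and, for a denumerable observation space,
  \<^const>\<open>filter_kernel\<close> are countably additive, so \<^const>\<open>measure_of\<close> does not collapse them to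
  the null measure.\<close>

context hmm
begin

lemma space_lam: "space lam = UNIV"
  using sets_eq_imp_space_eq[OF sets_lam] by simp

lemma measurable_m_section:
  "(\<lambda>(s, t). ennreal (m s t a)) \<in> borel_measurable (borel \<Otimes>\<^sub>M lam)"
proof -
  have "(\<lambda>z :: 's \<times> 's. (fst z, snd z, a)) \<in> borel \<Otimes>\<^sub>M borel \<rightarrow>\<^sub>M borel \<Otimes>\<^sub>M borel \<Otimes>\<^sub>M borel"
    by measurable
  from measurable_compose[OF this m_measurable]
  have "(\<lambda>z. m (fst z) (snd z) a) \<in> borel_measurable (borel \<Otimes>\<^sub>M borel)" by simp
  then have "(\<lambda>z. ennreal (m (fst z) (snd z) a)) \<in> borel_measurable (borel \<Otimes>\<^sub>M lam)"
    by (simp add: measurable_cong_sets[OF sets_pair_measure_cong[OF refl sets_lam] refl])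
  then show ?thesis by (simp add: case_prod_beta')
qed

lemma measurable_obs_step_aux:
  assumes F: "F \<in> sets borel"
  shows "(\<lambda>s. \<integral>\<^sup>+ t \<in> F. ennreal (m s t a) \<partial>lam) \<in> borel_measurable borel"
proof -
  interpret lam: sigma_finite_measure lam by (rule sigma_finite_lam)
  have [measurable]: "F \<in> sets lam" using F by (simp add: sets_lam)
  note measurable_m_section[measurable]
  have "(\<lambda>(s, t). ennreal (m s t a) * indicator F t) \<in> borel_measurable (borel \<Otimes>\<^sub>M lam)"
    using measurable_m_section[of a] by (simp add: case_prod_beta')
  then show ?thesis by (rule lam.borel_measurable_nn_integral)
qed

lemma emeasure_obs_step:
  assumes x: "sets x = sets borel" and F: "F \<in> sets borel"
  shows "emeasure (obs_step lam m x a) F = (\<integral>\<^sup>+ s. (\<integral>\<^sup>+ t \<in> F. ennreal (m s t a) \<partial>lam) \<partial>x)"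
  unfolding obs_step_def
proof (rule emeasure_measure_of_sigma)
  show "sigma_algebra UNIV (sets (borel :: 's measure))"
    using sets.sigma_algebra_axioms[of "borel :: 's measure"] by simp
  show "positive (sets borel) (\<lambda>F. \<integral>\<^sup>+ s. (\<integral>\<^sup>+ t \<in> F. ennreal (m s t a) \<partial>lam) \<partial>x)"
    by (simp add: positive_def)
  show "countably_additive (sets borel) (\<lambda>F. \<integral>\<^sup>+ s. (\<integral>\<^sup>+ t \<in> F. ennreal (m s t a) \<partial>lam) \<partial>x)"
  proof (rule countably_additiveI)
    fix A :: "nat \<Rightarrow> 's set"
    assume A: "range A \<subseteq> sets borel" and disj: "disjoint_family A"
    have Ai: "A i \<in> sets borel" for i using A by auto
    have m_t: "(\<lambda>t. ennreal (m s t a)) \<in> borel_measurable lam" for s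
      using measurable_compose[OF measurable_Pair1' measurable_m_section, of s a] by simp
    have inner: "(\<integral>\<^sup>+ t \<in> (\<Union>i. A i). ennreal (m s t a) \<partial>lam) =
        (\<Sum>i. \<integral>\<^sup>+ t \<in> A i. ennreal (m s t a) \<partial>lam)" for s
    proof -
      have "(\<integral>\<^sup>+ t \<in> (\<Union>i. A i). ennreal (m s t a) \<partial>lam) =
          emeasure (density lam (\<lambda>t. ennreal (m s t a))) (\<Union>i. A i)"
        using Ai by (subst emeasure_density) (auto simp: m_t sets_lam)
      also have "\<dots> = (\<Sum>i. emeasure (density lam (\<lambda>t. ennreal (m s t a))) (A i))"
        using A disj by (intro suminf_emeasure[symmetric]) (auto simp: sets_lam)
      also have "\<dots> = (\<Sum>i. \<integral>\<^sup>+ t \<in> A i. ennreal (m s t a) \<partial>lam)"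
        using Ai by (subst emeasure_density) (auto simp: m_t sets_lam)
      finally show ?thesis .
    qed
    show "(\<Sum>i. \<integral>\<^sup>+ s. (\<integral>\<^sup>+ t \<in> A i. ennreal (m s t a) \<partial>lam) \<partial>x) =
        (\<integral>\<^sup>+ s. (\<integral>\<^sup>+ t \<in> (\<Union>i. A i). ennreal (m s t a) \<partial>lam) \<partial>x)"
      unfolding inner using measurable_obs_step_aux[OF Ai]
      by (subst nn_integral_suminf) (auto simp: measurable_cong_sets[OF x refl])
  qed
  show "F \<in> sets borel" by (rule F)
qed

lemma emeasure_filter_kernel:
  assumes A: "countable (UNIV :: 'a set)"
    and E: "E \<in> sets (borel_of_metric (density_probs_metric lam))"
  shows "emeasure (filter_kernel lam tau m x) E =
    (\<integral>\<^sup>+ a \<in> {a. 0 < emeasure (obs_step lam m x a) UNIV}.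
       indicator E (normalize_measure (obs_step lam m x a)) *
       emeasure (obs_step lam m x a) UNIV \<partial>tau)"
  unfolding filter_kernel_def
proof (rule emeasure_measure_of_sigma[OF _ _ _ E])
  let ?B = "borel_of_metric (density_probs_metric lam)"
  let ?f = "\<lambda>E a. indicator E (normalize_measure (obs_step lam m x a)) *
       emeasure (obs_step lam m x a) UNIV *
       indicator {a. 0 < emeasure (obs_step lam m x a) UNIV} a :: ennreal"
  show "sigma_algebra (density_probs lam) (sets ?B)"
    using sets.sigma_algebra_axioms[of ?B] by (simp add: space_borel_of_metric)
  show "positive (sets ?B) (\<lambda>E. \<integral>\<^sup>+ a. ?f E a \<partial>tau)"
    by (simp add: positive_def)
  have tau: "tau = count_space UNIV" using denumerable_obs[OF A] by simp
  show "countably_additive (sets ?B) (\<lambda>E. \<integral>\<^sup>+ a. ?f E a \<partial>tau)"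
  proof (rule countably_additiveI)
    fix C :: "nat \<Rightarrow> 's measure set"
    assume "disjoint_family C"
    then have "(\<Sum>i. ?f (C i) a) = ?f (\<Union>i. C i) a" for a
      by (simp add: suminf_indicator)
    then show "(\<Sum>i. \<integral>\<^sup>+ a. ?f (C i) a \<partial>tau) = (\<integral>\<^sup>+ a. ?f (\<Union>i. C i) a \<partial>tau)"
      by (subst nn_integral_suminf[symmetric]) (simp_all add: tau)
  qed
qed

end

end

theory Submission
  imports Defs
begin

text \<open>
  Let \<open>x M\<^sub>w\<close> be the law \<open>x\<close> propagated along the observations \<open>w\<close>. Its total mass is the
  probability of observing \<open>w\<close>, and its normalisation \<open>filt x w\<close> is the filter. The \<open>n\<close>-th power
  of the filter kernel at \<open>x\<close> is therefore the image of the law of the first \<open>n\<close> observations under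
  \<open>filt x\<close> (\<open>filter_pow_eq_distr\<close>), and the theorem becomes a statement about random words. It
  combines two ways of forgetting the initial law.

  The filter forgets. When \<open>a\<^sub>0\<close> is observed twice in a row, the hidden chain has made a transition
  inside \<open>S a\<^sub>0\<close>, where its density lies between \<open>d\<^sub>0\<close> and \<open>D\<^sub>0\<close>. Also after conditioning on all
  later observations, such a transition dominates \<open>d\<^sub>0 / D\<^sub>0\<close> times a law that does not depend on its
  starting point. Each occurrence of \<open>a\<^sub>0 a\<^sub>0\<close> in \<open>w\<close> thus reduces the influence of the initial law
  by the factor \<open>1 - d\<^sub>0 / D\<^sub>0\<close>. With \<open>forget w\<close> for the product of these factors, two filters
  that see the same word \<open>w\<close> differ by at most \<open>2 * forget w\<close> in total variation
  (\<open>tv_dist_filt_le\<close>). The stationary chain observes \<open>a\<^sub>0 a\<^sub>0\<close> again and again, so the expectation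
  of \<open>forget\<close> tends to zero (\<open>memory_mu_tendsto_0\<close>).

  The observations forget. By strong ergodicity the hidden state at a late time \<open>N\<close> has nearly the
  law \<open>mu\<close>, so the last \<open>j\<close> of \<open>N + j\<close> observations are distributed nearly as in the stationary
  chain (\<open>tv_dist_push_mu\<close>).

  Together, the filter at time \<open>N + j\<close> started anywhere is compared with the filter at time \<open>j\<close>
  started in \<open>mu\<close> (\<open>integral_filter_pow_near_mu\<close>), uniformly over \<open>Lip1\<close>, and weak contraction
  follows. For the limit measure, the stationary observations are extended to an infinite past
  (\<open>ex_past_measure\<close>). Filters that see longer and longer pieces of one past form a Cauchy sequence
  (\<open>past_filter_limit\<close>); the law of their limit is the measure sought, and the same comparison shows
  convergence to it for every bounded continuous function.
\<close>

section \<open>Total variation\<close>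

lemma finite_borel_measuresD:
  assumes "x \<in> finite_borel_measures"
  shows "sets x = sets borel" "space x = UNIV" "finite_measure x"
  using assms sets_eq_imp_space_eq[of x borel] by (auto simp: finite_borel_measures_def)

lemma finite_borel_measuresI:
  assumes "sets x = sets borel" "finite_measure x"
  shows "x \<in> finite_borel_measures"
  using assms by (simp add: finite_borel_measures_def)

lemma density_probsD:
  assumes "x \<in> density_probs lam"
  shows "x \<in> finite_borel_measures" "prob_space x" "sets x = sets borel" "space x = UNIV"
  using assms finite_borel_measuresD[of x] by (auto simp: density_probs_def density_measures_def)

lemma tv_dist_commute: "tv_dist x y = tv_dist y x"
  by (simp add: tv_dist_def)

lemma measure_diff_le_tv_dist:
  assumes x: "x \<in> finite_borel_measures" and y: "y \<in> finite_borel_measures"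
    and F: "F \<in> sets borel"
  shows "measure x F - measure y F \<le> tv_dist x y"
  using tv_upper[OF x F, of y] tv_half_nonneg[OF y, of x] by (simp add: tv_dist_def)

lemma tv_dist_leI:
  assumes "\<And>F. F \<in> sets borel \<Longrightarrow> measure x F - measure y F \<le> c"
    and "\<And>F. F \<in> sets borel \<Longrightarrow> measure y F - measure x F \<le> c"
  shows "tv_dist x y \<le> 2 * c"
proof -
  have "(SUP F \<in> sets borel. measure x F - measure y F) \<le> c"
    by (rule cSUP_least) (use assms in auto)
  moreover have "(SUP F \<in> sets borel. measure y F - measure x F) \<le> c"
    by (rule cSUP_least) (use assms in auto)
  ultimately show ?thesis by (simp add: tv_dist_def)
qed

lemma tv_dist_triangle:
  assumes "x \<in> finite_borel_measures" "y \<in> finite_borel_measures" "z \<in> finite_borel_measures"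
  shows "tv_dist x z \<le> tv_dist x y + tv_dist y z"
  using tv_half_triangle[of x y z] tv_half_triangle[of z y x] assms by (simp add: tv_dist_def)

text \<open>A function with values in the unit interval is the average over \<open>t \<in> [0, 1]\<close> of the
  indicators of its superlevel sets \<open>{k > t}\<close>, so a bound valid for all events is valid for
  its integral.\<close>

lemma nn_integral_le_add_tv_dist:
  fixes x y :: "'s::topological_space measure"
  assumes x: "x \<in> finite_borel_measures" and y: "y \<in> finite_borel_measures"
    and k[measurable]: "k \<in> borel_measurable borel" and k1: "\<And>s. k s \<le> 1"
  shows "(\<integral>\<^sup>+ s. k s \<partial>x) \<le> (\<integral>\<^sup>+ s. k s \<partial>y) + ennreal (tv_dist x y)"
proof -
  have layer: "(\<integral>\<^sup>+ s. k s \<partial>z) = (\<integral>\<^sup>+ t \<in> {0..1}. emeasure z {s. ennreal t < k s} \<partial>lborel)"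
    if z: "z \<in> finite_borel_measures" for z
  proof -
    interpret z: finite_measure z using finite_borel_measuresD[OF z] by simp
    interpret pair_sigma_finite z lborel ..
    have [measurable_cong]: "sets z = sets borel" using finite_borel_measuresD[OF z] by simp
    have eq: "k s = (\<integral>\<^sup>+ t. indicator {t. ennreal t < k s} t * indicator {0..1} t \<partial>lborel)" for s
    proof -
      have fin: "k s < \<top>" using k1[of s] by (simp add: le_less_trans)
      have "(\<lambda>t. indicator {t. ennreal t < k s} t * indicator {0..1} t :: ennreal) =
        indicator {0..<enn2real (k s)}"
      proof
        fix t :: real
        have "enn2real (k s) \<le> 1" using k1[of s] fin by (simp add: enn2real_leI)
        moreover have "ennreal t < k s \<longleftrightarrow> t < enn2real (k s)" if "0 \<le> t"
          using that fin by (metis ennreal_enn2real ennreal_less_iff)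
        ultimately show "indicator {t. ennreal t < k s} t * indicator {0..1} t =
            (indicator {0..<enn2real (k s)} t :: ennreal)"
          by (auto simp: indicator_def)
      qed
      then show ?thesis using fin by simp
    qed
    have "(\<integral>\<^sup>+ s. k s \<partial>z) =
        (\<integral>\<^sup>+ s. (\<integral>\<^sup>+ t. indicator {t. ennreal t < k s} t * indicator {0..1} t \<partial>lborel) \<partial>z)"
      using eq by simp
    also have "\<dots> = (\<integral>\<^sup>+ t. (\<integral>\<^sup>+ s. indicator {t. ennreal t < k s} t * indicator {0..1} t \<partial>z) \<partial>lborel)"
      by (rule Fubini'[symmetric]) measurable
    also have "\<dots> = (\<integral>\<^sup>+ t \<in> {0..1}. emeasure z {s. ennreal t < k s} \<partial>lborel)"
    proof (rule nn_integral_cong)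
      fix t :: real
      have [measurable]: "{s. ennreal t < k s} \<in> sets z"
        using finite_borel_measuresD[OF z] by measurable
      have "(\<integral>\<^sup>+ s. indicator {t. ennreal t < k s} t * indicator {0..1} t \<partial>z) =
          (\<integral>\<^sup>+ s. indicator {s. ennreal t < k s} s * indicator {0..1} t \<partial>z)"
        by (intro nn_integral_cong) (auto simp: indicator_def)
      also have "\<dots> = emeasure z {s. ennreal t < k s} * indicator {0..1} t"
        by (subst nn_integral_multc) auto
      finally show "(\<integral>\<^sup>+ s. indicator {t. ennreal t < k s} t * indicator {0..1} t \<partial>z) =
        emeasure z {s. ennreal t < k s} * indicator {0..1} t" .
    qed
    finally show ?thesis .
  qed
  interpret fx: finite_measure x using finite_borel_measuresD[OF x] by simp
  interpret fy: finite_measure y using finite_borel_measuresD[OF y] by simp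
  have [measurable_cong]: "sets y = sets borel" using finite_borel_measuresD[OF y] by simp
  have le: "emeasure x F \<le> emeasure y F + ennreal (tv_dist x y)" if F: "F \<in> sets borel" for F
    using measure_diff_le_tv_dist[OF x y F] tv_dist_nonneg[OF x y]
    by (simp add: fx.emeasure_eq_measure fy.emeasure_eq_measure flip: ennreal_plus)
  have sg: "{s. ennreal t < k s} \<in> sets borel" for t by measurable
  have [measurable]: "(\<lambda>t. emeasure y {s. ennreal t < k s}) \<in> borel_measurable borel"
  proof (rule fy.measurable_emeasure)
    show "{t \<in> space (borel \<Otimes>\<^sub>M y). snd t \<in> {s. ennreal (fst t) < k s}} \<in> sets (borel \<Otimes>\<^sub>M y)"
      by simp
  qed (use finite_borel_measuresD[OF y] in auto)
  have "(\<integral>\<^sup>+ s. k s \<partial>x) \<le>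
      (\<integral>\<^sup>+ t. emeasure y {s. ennreal t < k s} * indicator {0..1} t +
        ennreal (tv_dist x y) * indicator {0..1} t \<partial>lborel)"
    unfolding layer[OF x]
    by (intro nn_integral_mono) (auto simp: indicator_def le[OF sg])
  also have "\<dots> = (\<integral>\<^sup>+ s. k s \<partial>y) + ennreal (tv_dist x y)"
    unfolding layer[OF y]
    by (subst nn_integral_add) (auto simp: nn_integral_cmult_indicator)
  finally show ?thesis .
qed

text \<open>Completeness of the space of densities. The measures converge uniformly over all events, and this
  makes the setwise limit continuous at the empty set, hence countably additive. Null sets of
  \<open>lam\<close> remain null, so the limit has a density again.\<close>

lemma density_probs_Cauchy_limit:
  fixes z :: "nat \<Rightarrow> 's::topological_space measure"
  assumes lam: "sigma_finite_measure lam" "sets lam = sets borel"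
    and z: "\<And>n. z n \<in> density_probs lam"
    and Cauchy: "\<And>e. 0 < e \<Longrightarrow> \<exists>N. \<forall>i \<ge> N. \<forall>j \<ge> N. tv_dist (z i) (z j) \<le> e"
  shows "\<exists>y \<in> density_probs lam. (\<lambda>n. tv_dist (z n) y) \<longlonglongrightarrow> 0"
proof -
  interpret lam: sigma_finite_measure lam by fact
  note zf = density_probsD(1)[OF z]
  interpret z: prob_space "z n" for n using density_probsD[OF z] by simp
  have sz: "sets (z n) = sets borel" for n using density_probsD[OF z] by simp
  define L where "L F = lim (\<lambda>n. measure (z n) F)" for F
  have diff: "\<bar>measure (z i) F - measure (z j) F\<bar> \<le> tv_dist (z i) (z j)" if "F \<in> sets borel" for i j F
    using measure_diff_le_tv_dist[OF zf zf that, of i j] measure_diff_le_tv_dist[OF zf zf that, of j i]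
      tv_dist_commute[of "z i" "z j"] by auto
  have L: "(\<lambda>n. measure (z n) F) \<longlonglongrightarrow> L F" if F: "F \<in> sets borel" for F
  proof -
    have "Cauchy (\<lambda>n. measure (z n) F)"
    proof (rule metric_CauchyI)
      fix e :: real assume "0 < e"
      then obtain N where "\<forall>i \<ge> N. \<forall>j \<ge> N. tv_dist (z i) (z j) \<le> e / 2"
        using Cauchy[of "e / 2"] by auto
      then show "\<exists>M. \<forall>i \<ge> M. \<forall>j \<ge> M. dist (measure (z i) F) (measure (z j) F) < e"
        using diff[OF F] \<open>0 < e\<close> unfolding dist_real_def
        by (metis field_sum_of_halves less_add_same_cancel1 half_gt_zero order_le_less_trans)
    qed
    then show ?thesis unfolding L_def by (simp add: Cauchy_convergent_iff convergent_LIMSEQ_iff)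
  qed
  have unif: "\<exists>N. \<forall>i \<ge> N. \<forall>F \<in> sets borel. \<bar>measure (z i) F - L F\<bar> \<le> e" if e: "0 < e" for e
  proof -
    obtain N where N: "\<forall>i \<ge> N. \<forall>j \<ge> N. tv_dist (z i) (z j) \<le> e" using Cauchy[OF e] by auto
    have "\<bar>measure (z i) F - L F\<bar> \<le> e" if "i \<ge> N" "F \<in> sets borel" for i F
    proof (rule LIMSEQ_le_const2)
      show "(\<lambda>j. \<bar>measure (z i) F - measure (z j) F\<bar>) \<longlonglongrightarrow> \<bar>measure (z i) F - L F\<bar>"
        using L[OF that(2)] by (intro tendsto_intros)
      show "\<exists>N. \<forall>j \<ge> N. \<bar>measure (z i) F - measure (z j) F\<bar> \<le> e"
        using N that diff[OF that(2), of i] by (intro exI[of _ N]) (meson order_trans)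
    qed
    then show ?thesis by auto
  qed
  have L0: "0 \<le> L F" if "F \<in> sets borel" for F
    using L[OF that] by (rule LIMSEQ_le_const) auto
  define y where "y = measure_of UNIV (sets (borel :: 's measure)) (\<lambda>F. ennreal (L F))"
  have sa: "sigma_algebra UNIV (sets (borel :: 's measure))"
    using sets.sigma_algebra_axioms[of "borel :: 's measure"] by simp
  interpret sa: sigma_algebra UNIV "sets (borel :: 's measure)" by (rule sa)
  have pos: "positive (sets borel) (\<lambda>F. ennreal (L F))"
    by (simp add: positive_def L_def)
  have add: "additive (sets borel) (\<lambda>F. ennreal (L F))"
    unfolding additive_def
  proof (intro ballI impI)
    fix A B :: "'s set" assume AB: "A \<in> sets borel" "B \<in> sets borel" "A \<inter> B = {}"
    have "(\<lambda>n. measure (z n) A + measure (z n) B) \<longlonglongrightarrow> L A + L B"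
      by (intro tendsto_intros L AB)
    then have "(\<lambda>n. measure (z n) (A \<union> B)) \<longlonglongrightarrow> L A + L B"
      using AB by (simp add: z.finite_measure_Union sz)
    then have "L (A \<union> B) = L A + L B"
      using L[of "A \<union> B"] AB by (auto intro: LIMSEQ_unique)
    then show "ennreal (L (A \<union> B)) = ennreal (L A) + ennreal (L B)"
      using L0 AB by simp
  qed
  have "countably_additive (sets borel) (\<lambda>F. ennreal (L F))"
  proof (rule sa.empty_continuous_imp_countably_additive[OF pos add])
    fix A :: "nat \<Rightarrow> 's set"
    assume A: "range A \<subseteq> sets borel" "decseq A" "(\<Inter>i. A i) = {}"
    have "(\<lambda>k. L (A k)) \<longlonglongrightarrow> 0"
    proof (rule LIMSEQ_I)
      fix e :: real assume e: "0 < e"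
      obtain N where N: "\<forall>F \<in> sets borel. \<bar>measure (z N) F - L F\<bar> \<le> e / 2"
        using unif[of "e / 2"] e by auto
      have "(\<lambda>k. measure (z N) (A k)) \<longlonglongrightarrow> measure (z N) (\<Inter>i. A i)"
        by (rule z.finite_Lim_measure_decseq) (use A sz in auto)
      then have "(\<lambda>k. measure (z N) (A k)) \<longlonglongrightarrow> 0" using A by simp
      from LIMSEQ_D[OF this, of "e / 2"] e obtain M
        where M: "\<forall>k \<ge> M. measure (z N) (A k) < e / 2" by auto
      have "norm (L (A k) - 0) < e" if "k \<ge> M" for k
      proof -
        have Ak: "A k \<in> sets borel" using A by auto
        have "measure (z N) (A k) < e / 2" "\<bar>measure (z N) (A k) - L (A k)\<bar> \<le> e / 2"
          using M N that Ak by auto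
        then have "L (A k) < e" by linarith
        then show ?thesis using L0[OF Ak] by simp
      qed
      then show "\<exists>M. \<forall>k \<ge> M. norm (L (A k) - 0) < e" by auto
    qed
    then show "(\<lambda>i. ennreal (L (A i))) \<longlonglongrightarrow> 0"
      using tendsto_ennrealI by fastforce
  qed simp
  then have em: "emeasure y F = ennreal (L F)" if "F \<in> sets borel" for F
    unfolding y_def using emeasure_measure_of_sigma[OF sa pos _ that] by simp
  have sy: "sets y = sets borel" unfolding y_def by simp
  then have spy: "space y = UNIV" using sets_eq_imp_space_eq by fastforce
  have my: "measure y F = L F" if "F \<in> sets borel" for F
    using em[OF that] L0[OF that] by (simp add: measure_def)
  have "L UNIV = 1"
    using L[of UNIV] z.prob_space density_probsD(4)[OF z] by (simp add: LIMSEQ_const_iff)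
  then have py: "prob_space y" by (intro prob_spaceI) (simp add: spy em)
  then have yf: "y \<in> finite_borel_measures"
    using sy by (auto simp: finite_borel_measures_def intro: prob_space.finite_measure)
  have "absolutely_continuous lam y"
    unfolding absolutely_continuous_def
  proof
    fix F assume F: "F \<in> null_sets lam"
    have "measure (z n) F = 0" for n
    proof -
      obtain f where f: "f \<in> borel_measurable lam" "z n = density lam f"
        using z[of n] by (auto simp: density_probs_def density_measures_def)
      have "F \<in> null_sets (density lam f)"
        using absolutely_continuousI_density[OF f(1)] F by (auto simp: absolutely_continuous_def)
      then show ?thesis using f(2) by (auto simp: null_sets_def measure_def)
    qed
    moreover have Fb: "F \<in> sets borel" using F lam(2) by auto
    ultimately have "L F = 0" using L[OF Fb] by (simp add: LIMSEQ_const_iff)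
    then show "F \<in> null_sets y" using em[OF Fb] Fb by (auto simp: null_sets_def sy)
  qed
  then have "\<exists>f \<in> borel_measurable lam. density lam f = y"
    by (rule lam.Radon_Nikodym) (simp add: sy lam)
  then have yK: "y \<in> density_probs lam"
    using py yf by (auto simp: density_probs_def density_measures_def)
  have "(\<lambda>n. tv_dist (z n) y) \<longlonglongrightarrow> 0"
  proof (rule LIMSEQ_I)
    fix e :: real assume e: "0 < e"
    obtain N where N: "\<forall>i \<ge> N. \<forall>F \<in> sets borel. \<bar>measure (z i) F - L F\<bar> \<le> e / 3"
      using unif[of "e / 3"] e by auto
    have "tv_dist (z i) y \<le> 2 * (e / 3)" if "i \<ge> N" for i
    proof (rule tv_dist_leI)
      fix F :: "'s set" assume F: "F \<in> sets borel"
      then have "\<bar>measure (z i) F - L F\<bar> \<le> e / 3" using N that by auto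
      then show "measure (z i) F - measure y F \<le> e / 3" "measure y F - measure (z i) F \<le> e / 3"
        unfolding my[OF F] by linarith+
    qed
    moreover have "2 * (e / 3) < e" using e by simp
    ultimately have "norm (tv_dist (z i) y - 0) < e" if "i \<ge> N" for i
      unfolding diff_0_right real_norm_def abs_of_nonneg[OF tv_dist_nonneg[OF zf yf]]
      using that by (meson order_le_less_trans)
    then show "\<exists>N. \<forall>i \<ge> N. norm (tv_dist (z i) y - 0) < e" by auto
  qed
  then show ?thesis using yK by auto
qed

section \<open>Words of a given length\<close>

abbreviation words :: "nat \<Rightarrow> 'a list set" where
  "words n \<equiv> {w. length w = n}"

lemma countable_words:
  assumes "countable (UNIV :: 'a set)"
  shows "countable (words n :: 'a list set)"
proof -
  have "countable (lists (UNIV :: 'a set))" using assms by (rule countable_lists)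
  then show ?thesis by (rule countable_subset[rotated]) auto
qed

lemma borel_measurable_nn_integral_countable:
  fixes f :: "'i \<Rightarrow> 'b \<Rightarrow> ennreal"
  assumes A: "countable A" and f: "\<And>i. i \<in> A \<Longrightarrow> f i \<in> borel_measurable M"
  shows "(\<lambda>x. \<integral>\<^sup>+ i. f i x \<partial>count_space A) \<in> borel_measurable M"
proof -
  interpret c: sigma_finite_measure "count_space A"
    using A by (rule sigma_finite_measure_count_space_countable)
  have "(\<lambda>p. f (fst p) (snd p)) \<in> borel_measurable (count_space A \<Otimes>\<^sub>M M)"
    by (rule measurable_pair_measure_countable1[OF A]) (simp add: f)
  then have "(\<lambda>p. f (snd p) (fst p)) \<in> borel_measurable (M \<Otimes>\<^sub>M count_space A)"
    by (subst measurable_pair_swap_iff) (simp add: case_prod_beta')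
  then show ?thesis by (intro c.borel_measurable_nn_integral) (simp add: case_prod_beta')
qed

lemma nn_integral_words_append:
  "(\<integral>\<^sup>+ w. f w \<partial>count_space (words (n + k))) =
     (\<integral>\<^sup>+ v. (\<integral>\<^sup>+ w. f (v @ w) \<partial>count_space (words k)) \<partial>count_space (words n))"
proof -
  have bij: "bij_betw (\<lambda>(v, w). v @ w) (words n \<times> words k) (words (n + k))"
    by (rule bij_betw_byWitness[where f' = "\<lambda>u. (take n u, drop n u)"]) auto
  have "(\<integral>\<^sup>+ w. f w \<partial>count_space (words (n + k))) =
      (\<integral>\<^sup>+ p. f (fst p @ snd p) \<partial>count_space (words n \<times> words k))"
    using nn_integral_bij_count_space[OF bij, of f] by (simp add: case_prod_beta')
  also have "\<dots> = (\<integral>\<^sup>+ p. f (fst p @ snd p) * indicator (words n \<times> words k) p \<partial>count_space UNIV)"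
    by (rule nn_integral_count_space_indicator) simp
  also have "\<dots> = (\<integral>\<^sup>+ v. (\<integral>\<^sup>+ w. f (v @ w) * indicator (words n \<times> words k) (v, w)
      \<partial>count_space UNIV) \<partial>count_space UNIV)"
    by (subst nn_integral_fst_count_space[symmetric]) simp
  also have "\<dots> = (\<integral>\<^sup>+ v. (\<integral>\<^sup>+ w. f (v @ w) * indicator (words k) w
      \<partial>count_space UNIV) * indicator (words n) v \<partial>count_space UNIV)"
    by (intro nn_integral_cong, subst nn_integral_multc[symmetric])
       (auto intro!: nn_integral_cong simp: indicator_def)
  also have "\<dots> = (\<integral>\<^sup>+ v. (\<integral>\<^sup>+ w. f (v @ w) \<partial>count_space (words k)) \<partial>count_space (words n))"
    by (simp add: nn_integral_count_space_indicator)
  finally show ?thesis .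
qed

lemma nn_integral_words_0: "(\<integral>\<^sup>+ w. f w \<partial>count_space (words 0)) = f []"
  by (simp add: nn_integral_count_space_finite)

lemma nn_integral_words_1:
  "(\<integral>\<^sup>+ w. f w \<partial>count_space (words (Suc 0))) = (\<integral>\<^sup>+ a. f [a] \<partial>count_space UNIV)"
proof -
  have "bij_betw (\<lambda>a. [a]) UNIV (words (Suc 0))"
    by (rule bij_betw_byWitness[where f' = hd]) (auto simp: length_Suc_conv)
  then show ?thesis by (rule nn_integral_bij_count_space[symmetric])
qed

lemma nn_integral_words_Suc:
  "(\<integral>\<^sup>+ w. f w \<partial>count_space (words (Suc n))) =
     (\<integral>\<^sup>+ a. (\<integral>\<^sup>+ w. f (a # w) \<partial>count_space (words n)) \<partial>count_space UNIV)"
  using nn_integral_words_append[where f = f and n = "Suc 0" and k = n] by (simp add: nn_integral_words_1)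

section \<open>Observations of the hidden chain\<close>

locale denumerable_obs_hmm = hmm lam tau m
  for lam :: "'s::polish_space measure"
    and tau :: "'a::polish_space measure"
    and m :: "'s \<Rightarrow> 's \<Rightarrow> 'a \<Rightarrow> real" +
  assumes countable_obs: "countable (UNIV :: 'a set)"
begin

lemma tau_eq: "tau = count_space UNIV"
  using denumerable_obs[OF countable_obs] by simp

declare sets_lam [measurable_cong]

sublocale lam: sigma_finite_measure lam
  by (rule sigma_finite_lam)

abbreviation steps :: "'s measure \<Rightarrow> 'a list \<Rightarrow> 's measure" where
  "steps \<equiv> foldl (obs_step lam m)"

abbreviation transition :: "'s \<Rightarrow> 's measure" where
  "transition \<equiv> hidden_kernel lam tau m"

lemma measurable_m [measurable]: "(\<lambda>p. m (fst p) (snd p) a) \<in> borel_measurable (borel \<Otimes>\<^sub>M borel)"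
proof -
  have "(\<lambda>z :: 's \<times> 's. (fst z, snd z, a)) \<in> borel \<Otimes>\<^sub>M borel \<rightarrow>\<^sub>M borel \<Otimes>\<^sub>M borel \<Otimes>\<^sub>M borel"
    by measurable
  from measurable_compose[OF this m_measurable] show ?thesis by simp
qed

lemma measurable_m' [measurable (raw)]:
  assumes [measurable]: "f \<in> M \<rightarrow>\<^sub>M borel" "g \<in> M \<rightarrow>\<^sub>M borel"
  shows "(\<lambda>z. m (f z) (g z) a) \<in> borel_measurable M"
  using measurable_compose[OF measurable_Pair[OF assms] measurable_m, of a] by simp

lemma sets_obs_step [simp]: "sets (obs_step lam m x a) = sets borel"
  unfolding obs_step_def
  using sets.sigma_sets_eq[of "borel :: 's measure"] by (subst sets_measure_of) auto

lemma obs_step_eq_density: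
  assumes x: "x \<in> finite_borel_measures"
  shows "obs_step lam m x a = density lam (\<lambda>t. \<integral>\<^sup>+ s. ennreal (m s t a) \<partial>x)"
proof (rule measure_eqI)
  interpret x: finite_measure x using finite_borel_measuresD[OF x] by simp
  have [measurable_cong]: "sets x = sets borel" using finite_borel_measuresD[OF x] by simp
  interpret pair_sigma_finite x lam ..
  show "sets (obs_step lam m x a) = sets (density lam (\<lambda>t. \<integral>\<^sup>+ s. ennreal (m s t a) \<partial>x))"
    by (simp add: sets_lam)
  fix F assume "F \<in> sets (obs_step lam m x a)"
  then have [measurable]: "F \<in> sets borel" by simp
  have "emeasure (obs_step lam m x a) F =
      (\<integral>\<^sup>+ s. (\<integral>\<^sup>+ t. ennreal (m s t a) * indicator F t \<partial>lam) \<partial>x)"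
    by (rule emeasure_obs_step) (use finite_borel_measuresD[OF x] in auto)
  also have "\<dots> = (\<integral>\<^sup>+ t. (\<integral>\<^sup>+ s. ennreal (m s t a) * indicator F t \<partial>x) \<partial>lam)"
    by (rule Fubini'[symmetric]) measurable
  also have "\<dots> = (\<integral>\<^sup>+ t. (\<integral>\<^sup>+ s. ennreal (m s t a) \<partial>x) * indicator F t \<partial>lam)"
    by (intro nn_integral_cong nn_integral_multc) measurable
  also have "\<dots> = emeasure (density lam (\<lambda>t. \<integral>\<^sup>+ s. ennreal (m s t a) \<partial>x)) F"
    by (subst emeasure_density) auto
  finally show "emeasure (obs_step lam m x a) F = \<dots>" .
qed

lemma nn_integral_obs_step:
  assumes x: "x \<in> finite_borel_measures" and g[measurable]: "g \<in> borel_measurable borel"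
  shows "(\<integral>\<^sup>+ t. g t \<partial>obs_step lam m x a) = (\<integral>\<^sup>+ s. (\<integral>\<^sup>+ t. ennreal (m s t a) * g t \<partial>lam) \<partial>x)"
proof -
  interpret x: finite_measure x using finite_borel_measuresD[OF x] by simp
  have [measurable_cong]: "sets x = sets borel" using finite_borel_measuresD[OF x] by simp
  interpret pair_sigma_finite x lam ..
  have "(\<integral>\<^sup>+ t. g t \<partial>obs_step lam m x a) = (\<integral>\<^sup>+ t. (\<integral>\<^sup>+ s. ennreal (m s t a) \<partial>x) * g t \<partial>lam)"
    unfolding obs_step_eq_density[OF x] by (rule nn_integral_density) auto
  also have "\<dots> = (\<integral>\<^sup>+ t. (\<integral>\<^sup>+ s. ennreal (m s t a) * g t \<partial>x) \<partial>lam)"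
    by (intro nn_integral_cong nn_integral_multc[symmetric]) measurable
  also have "\<dots> = (\<integral>\<^sup>+ s. (\<integral>\<^sup>+ t. ennreal (m s t a) * g t \<partial>lam) \<partial>x)"
    by (rule Fubini') measurable
  finally show ?thesis .
qed

lemma trans_density_eq: "trans_density tau m s t = (\<integral>\<^sup>+ a. ennreal (m s t a) \<partial>count_space UNIV)"
  by (simp add: trans_density_def tau_eq)

lemma measurable_trans_density [measurable (raw)]:
  assumes [measurable]: "f \<in> M \<rightarrow>\<^sub>M borel" "g \<in> M \<rightarrow>\<^sub>M borel"
  shows "(\<lambda>z. trans_density tau m (f z) (g z)) \<in> borel_measurable M"
  unfolding trans_density_eq
  by (rule borel_measurable_nn_integral_countable[OF countable_obs]) simp

lemma nn_integral_transition:
  assumes [measurable]: "g \<in> borel_measurable borel"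
  shows "(\<integral>\<^sup>+ t. g t \<partial>transition s) = (\<integral>\<^sup>+ a. (\<integral>\<^sup>+ t. ennreal (m s t a) * g t \<partial>lam) \<partial>count_space UNIV)"
proof -
  have "(\<integral>\<^sup>+ t. g t \<partial>transition s) = (\<integral>\<^sup>+ t. trans_density tau m s t * g t \<partial>lam)"
    unfolding hidden_kernel_def by (rule nn_integral_density) auto
  also have "\<dots> = (\<integral>\<^sup>+ t. (\<integral>\<^sup>+ a. ennreal (m s t a) * g t \<partial>count_space UNIV) \<partial>lam)"
    by (intro nn_integral_cong) (simp add: trans_density_eq nn_integral_multc)
  also have "\<dots> = (\<integral>\<^sup>+ a. (\<integral>\<^sup>+ t. ennreal (m s t a) * g t \<partial>lam) \<partial>count_space UNIV)"
    by (rule nn_integral_count_space_nn_integral[OF countable_obs]) measurable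
  finally show ?thesis .
qed

lemma prob_space_transition: "prob_space (transition s)"
proof (rule prob_spaceI)
  have "emeasure (transition s) (space (transition s)) = (\<integral>\<^sup>+ t. trans_density tau m s t \<partial>lam)"
    unfolding hidden_kernel_def
    by (subst emeasure_density) (auto intro!: nn_integral_cong simp: space_lam)
  then show "emeasure (transition s) (space (transition s)) = 1"
    using m_stochastic[of s] by (simp add: trans_density_def)
qed

lemma sets_transition [simp, measurable_cong]: "sets (transition s) = sets borel"
  by (simp add: hidden_kernel_def sets_lam)

lemma space_transition [simp]: "space (transition s) = UNIV"
  by (simp add: hidden_kernel_def space_lam)

lemma measurable_transition: "transition \<in> borel \<rightarrow>\<^sub>M prob_algebra borel"
proof (rule measurable_prob_algebraI)
  show "transition \<in> borel \<rightarrow>\<^sub>M subprob_algebra borel"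
  proof (rule measurable_subprob_algebra)
    fix F :: "'s set" assume [measurable]: "F \<in> sets borel"
    have "emeasure (transition s) F = (\<integral>\<^sup>+ t. trans_density tau m s t * indicator F t \<partial>lam)" for s
      unfolding hidden_kernel_def by (rule emeasure_density) auto
    then show "(\<lambda>s. emeasure (transition s) F) \<in> borel_measurable borel" by simp
  qed (simp_all add: prob_space_imp_subprob_space prob_space_transition)
qed (rule prob_space_transition)

abbreviation transition_pow :: "nat \<Rightarrow> 's \<Rightarrow> 's measure" where
  "transition_pow \<equiv> kernel_pow borel transition"

lemma measurable_transition_pow: "transition_pow n \<in> borel \<rightarrow>\<^sub>M prob_algebra borel"
  by (rule kernel_pow_in_prob_algebra[OF measurable_transition])

lemma measurable_transition_pow_subprob [measurable]:
  "transition_pow n \<in> borel \<rightarrow>\<^sub>M subprob_algebra borel"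
  by (rule measurable_prob_algebraD[OF measurable_transition_pow])

lemma transition_pow_props:
  "prob_space (transition_pow n s)" "sets (transition_pow n s) = sets borel"
  "space (transition_pow n s) = UNIV" "transition_pow n s \<in> finite_borel_measures"
proof -
  have "transition_pow n s \<in> space (prob_algebra borel)"
    using measurable_space[OF measurable_transition_pow] by auto
  then show *: "prob_space (transition_pow n s)" "sets (transition_pow n s) = sets borel"
    by (simp_all add: space_prob_algebra)
  show "space (transition_pow n s) = UNIV" using sets_eq_imp_space_eq[OF *(2)] by simp
  show "transition_pow n s \<in> finite_borel_measures"
    using * by (auto intro!: finite_borel_measuresI prob_space.finite_measure)
qed

lemma mass_obs_kernel_le_1: "(\<integral>\<^sup>+ t. ennreal (m s t a) \<partial>lam) \<le> 1"
proof -
  have "(\<integral>\<^sup>+ t. ennreal (m s t a) \<partial>lam) \<le> (\<integral>\<^sup>+ b. (\<integral>\<^sup>+ t. ennreal (m s t b) \<partial>lam) \<partial>count_space UNIV)"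
    by (rule nn_integral_ge_point[where p = "\<lambda>b. \<integral>\<^sup>+ t. ennreal (m s t b) \<partial>lam"]) simp
  also have "\<dots> = 1"
    using nn_integral_transition[of "\<lambda>_. 1" s] prob_space.emeasure_space_1[OF prob_space_transition[of s]]
    by simp
  finally show ?thesis .
qed

lemma obs_step_in_finite_borel:
  assumes x: "x \<in> finite_borel_measures"
  shows "obs_step lam m x a \<in> finite_borel_measures"
proof (rule finite_borel_measuresI)
  interpret x: finite_measure x using finite_borel_measuresD[OF x] by simp
  show "sets (obs_step lam m x a) = sets borel" by simp
  then have sp: "space (obs_step lam m x a) = UNIV" using sets_eq_imp_space_eq by fastforce
  have "emeasure (obs_step lam m x a) UNIV = (\<integral>\<^sup>+ s. (\<integral>\<^sup>+ t. ennreal (m s t a) \<partial>lam) \<partial>x)"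
    using nn_integral_obs_step[OF x, of "\<lambda>_. 1" a] by (simp add: sp)
  also have "\<dots> \<le> (\<integral>\<^sup>+ s. 1 \<partial>x)" by (intro nn_integral_mono mass_obs_kernel_le_1)
  also have "\<dots> < \<top>" using x.emeasure_finite[of "space x"] by (simp add: less_top[symmetric])
  finally show "finite_measure (obs_step lam m x a)" by (intro finite_measureI) (simp add: sp)
qed

lemma steps_in_finite_borel:
  "x \<in> finite_borel_measures \<Longrightarrow> steps x w \<in> finite_borel_measures"
  by (induction w arbitrary: x) (auto simp: obs_step_in_finite_borel)

text \<open>This is the probability that the chain started at \<open>s\<close> produces the observations \<open>w\<close> and then
  is in \<open>F\<close>. It is a function of the starting point, so that everything about an initial law
  \<open>x\<close> becomes an integral over \<open>x\<close>.\<close>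

primrec word_kernel :: "'a list \<Rightarrow> 's set \<Rightarrow> 's \<Rightarrow> ennreal" where
  "word_kernel [] F = indicator F"
| "word_kernel (a # w) F = (\<lambda>s. \<integral>\<^sup>+ t. ennreal (m s t a) * word_kernel w F t \<partial>lam)"

lemma measurable_word_kernel [measurable]:
  "F \<in> sets borel \<Longrightarrow> word_kernel w F \<in> borel_measurable borel"
proof (induction w)
  case (Cons a w)
  note Cons.IH[OF Cons.prems, measurable]
  show ?case by simp
qed simp

lemma emeasure_steps:
  assumes "x \<in> finite_borel_measures" "F \<in> sets borel"
  shows "emeasure (steps x w) F = (\<integral>\<^sup>+ s. word_kernel w F s \<partial>x)"
  using assms
proof (induction w arbitrary: x)
  case Nil
  then show ?case using finite_borel_measuresD[of x] by simp
next
  case (Cons a w)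
  then show ?case by (simp add: obs_step_in_finite_borel nn_integral_obs_step)
qed

lemma word_kernel_le_1: "word_kernel w F s \<le> 1"
proof (induction w arbitrary: s)
  case (Cons a w)
  have "(\<integral>\<^sup>+ t. ennreal (m s t a) * word_kernel w F t \<partial>lam) \<le> (\<integral>\<^sup>+ t. ennreal (m s t a) * 1 \<partial>lam)"
    by (intro nn_integral_mono mult_left_mono Cons) auto
  then show ?case using mass_obs_kernel_le_1[of s a] by simp
qed (simp add: indicator_def)

lemma word_kernel_add_Compl:
  assumes "F \<in> sets borel"
  shows "word_kernel w F s + word_kernel w (- F) s = word_kernel w UNIV s"
proof (induction w arbitrary: s)
  case (Cons a w)
  have [measurable]: "F \<in> sets borel" "- F \<in> sets borel" using assms by auto
  have "word_kernel (a # w) UNIV s =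
      (\<integral>\<^sup>+ t. ennreal (m s t a) * word_kernel w F t + ennreal (m s t a) * word_kernel w (- F) t \<partial>lam)"
    unfolding word_kernel.simps Cons.IH[symmetric] by (simp add: distrib_left)
  also have "\<dots> = word_kernel (a # w) F s + word_kernel (a # w) (- F) s"
    unfolding word_kernel.simps by (rule nn_integral_add) measurable
  finally show ?case by simp
qed (auto simp: indicator_def)

text \<open>The densities \<open>m s t a\<close> add up over \<open>a\<close> to the transition density, so summing over all words
  of length \<open>n\<close> leaves \<open>n\<close> steps of the hidden chain.\<close>

lemma sum_words_nn_integral_steps:
  assumes "x \<in> finite_borel_measures" and g[measurable]: "g \<in> borel_measurable borel"
  shows "(\<integral>\<^sup>+ w. (\<integral>\<^sup>+ t. g t \<partial>steps x w) \<partial>count_space (words n)) =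
    (\<integral>\<^sup>+ s. (\<integral>\<^sup>+ t. g t \<partial>transition_pow n s) \<partial>x)"
  using assms(1)
proof (induction n arbitrary: x)
  case 0
  have "(\<integral>\<^sup>+ s. (\<integral>\<^sup>+ t. g t \<partial>return borel s) \<partial>x) = (\<integral>\<^sup>+ s. g s \<partial>x)"
    by (intro nn_integral_cong) (simp add: nn_integral_return)
  then show ?case by (simp add: nn_integral_words_0 del: length_0_conv)
next
  case (Suc n)
  let ?G = "\<lambda>s. \<integral>\<^sup>+ t. g t \<partial>transition_pow n s"
  have [measurable]: "?G \<in> borel_measurable borel"
    by (rule measurable_compose[OF measurable_transition_pow_subprob
          nn_integral_measurable_subprob_algebra[OF g]])
  have [measurable_cong]: "sets x = sets borel" using finite_borel_measuresD[OF Suc.prems] by simp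
  have "(\<integral>\<^sup>+ w. (\<integral>\<^sup>+ t. g t \<partial>steps x w) \<partial>count_space (words (Suc n))) =
      (\<integral>\<^sup>+ a. (\<integral>\<^sup>+ s. ?G s \<partial>obs_step lam m x a) \<partial>count_space UNIV)"
    by (simp add: nn_integral_words_Suc Suc.IH obs_step_in_finite_borel Suc.prems)
  also have "\<dots> = (\<integral>\<^sup>+ a. (\<integral>\<^sup>+ s. (\<integral>\<^sup>+ t. ennreal (m s t a) * ?G t \<partial>lam) \<partial>x) \<partial>count_space UNIV)"
    by (intro nn_integral_cong nn_integral_obs_step Suc.prems) measurable
  also have "\<dots> = (\<integral>\<^sup>+ s. (\<integral>\<^sup>+ a. (\<integral>\<^sup>+ t. ennreal (m s t a) * ?G t \<partial>lam) \<partial>count_space UNIV) \<partial>x)"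
    by (rule nn_integral_count_space_nn_integral[OF countable_obs, symmetric]) measurable
  also have "\<dots> = (\<integral>\<^sup>+ s. (\<integral>\<^sup>+ t. ?G t \<partial>transition s) \<partial>x)"
    by (simp add: nn_integral_transition)
  also have "\<dots> = (\<integral>\<^sup>+ s. (\<integral>\<^sup>+ t. g t \<partial>transition_pow (Suc n) s) \<partial>x)"
  proof (rule nn_integral_cong)
    fix s
    have "transition_pow n \<in> transition s \<rightarrow>\<^sub>M subprob_algebra borel" by measurable
    then show "(\<integral>\<^sup>+ t. ?G t \<partial>transition s) = (\<integral>\<^sup>+ t. g t \<partial>transition_pow (Suc n) s)"
      unfolding kernel_pow.simps by (rule nn_integral_bind[OF g, symmetric])
  qed
  finally show ?case .
qed

text \<open>The law of the hidden state after \<open>n\<close> steps, when it starts with the law \<open>x\<close>.\<close>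

definition push :: "nat \<Rightarrow> 's measure \<Rightarrow> 's measure" where
  "push n x = x \<bind> transition_pow n"

context
  fixes x :: "'s measure"
  assumes x: "x \<in> finite_borel_measures" "prob_space x"
begin

lemma in_prob_algebra_borel: "x \<in> space (prob_algebra borel)"
  using x finite_borel_measuresD[of x] by (simp add: space_prob_algebra)

lemma push_props: "prob_space (push n x)" "push n x \<in> finite_borel_measures"
proof -
  show *: "prob_space (push n x)"
    unfolding push_def
    by (rule prob_space_bind'[OF in_prob_algebra_borel measurable_transition_pow])
  have "sets (push n x) = sets borel"
    unfolding push_def
    by (rule sets_bind'[OF in_prob_algebra_borel measurable_transition_pow])
  then show "push n x \<in> finite_borel_measures"
    using * by (auto intro: finite_borel_measuresI prob_space.finite_measure)
qed

lemma nn_integral_push: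
  assumes g: "g \<in> borel_measurable borel"
  shows "(\<integral>\<^sup>+ t. g t \<partial>push n x) = (\<integral>\<^sup>+ s. (\<integral>\<^sup>+ t. g t \<partial>transition_pow n s) \<partial>x)"
proof -
  have [measurable_cong]: "sets x = sets borel" using finite_borel_measuresD[OF x(1)] by simp
  have "transition_pow n \<in> x \<rightarrow>\<^sub>M subprob_algebra borel" by measurable
  then show ?thesis unfolding push_def by (rule nn_integral_bind[OF g])
qed

lemma sum_words_steps_append:
  assumes [measurable]: "F \<in> sets borel"
  shows "(\<integral>\<^sup>+ v. emeasure (steps x (v @ w)) F \<partial>count_space (words n)) = emeasure (steps (push n x) w) F"
proof -
  have "(\<integral>\<^sup>+ v. emeasure (steps x (v @ w)) F \<partial>count_space (words n)) =
      (\<integral>\<^sup>+ v. (\<integral>\<^sup>+ s. word_kernel w F s \<partial>steps x v) \<partial>count_space (words n))"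
    by (simp add: emeasure_steps steps_in_finite_borel x)
  also have "\<dots> = (\<integral>\<^sup>+ s. word_kernel w F s \<partial>push n x)"
    by (simp add: sum_words_nn_integral_steps nn_integral_push x)
  finally show ?thesis by (simp add: emeasure_steps push_props)
qed

lemma sum_words_mass: "(\<integral>\<^sup>+ w. emeasure (steps x w) UNIV \<partial>count_space (words n)) = 1"
proof -
  have "space (push n x) = UNIV" using finite_borel_measuresD[OF push_props(2)] by simp
  then show ?thesis
    using sum_words_steps_append[where F = UNIV and w = "[]" and n = n] prob_space.emeasure_space_1[OF push_props(1)[of n]]
    by simp
qed

end

end

section \<open>The filter along a word\<close>

context denumerable_obs_hmm
begin

abbreviation weight :: "'s measure \<Rightarrow> 'a list \<Rightarrow> ennreal" where
  "weight x w \<equiv> emeasure (steps x w) UNIV"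

text \<open>The conditional law of the hidden state given the observations \<open>w\<close>. For words of probability zero
  the value \<open>x\<close> is chosen so that \<open>filt x\<close> is a function into the space of densities, along which
  laws of words can be pushed forward.\<close>

definition filt :: "'s measure \<Rightarrow> 'a list \<Rightarrow> 's measure" where
  "filt x w = (if 0 < weight x w then normalize_measure (steps x w) else x)"

lemma weight_finite:
  assumes "x \<in> finite_borel_measures"
  shows "weight x w < \<top>"
proof -
  interpret finite_measure "steps x w"
    using finite_borel_measuresD[OF steps_in_finite_borel[OF assms]] by simp
  show ?thesis using emeasure_finite[of UNIV] by (simp add: less_top[symmetric])
qed

lemma emeasure_filt:
  assumes "x \<in> finite_borel_measures" "0 < weight x w"
  shows "emeasure (filt x w) F = emeasure (steps x w) F / weight x w"
  using assms finite_borel_measuresD[OF steps_in_finite_borel[OF assms(1)], of w]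
  by (simp add: filt_def normalize_measure_def divide_ennreal_def mult.commute)

lemma steps_in_density_measures:
  assumes "x \<in> density_measures lam"
  shows "steps x w \<in> density_measures lam"
  using assms
proof (induction w arbitrary: x)
  case (Cons a w)
  then have x: "x \<in> finite_borel_measures" by (simp add: density_measures_def)
  then have [measurable_cong]: "sets x = sets borel" and "finite_measure x"
    using finite_borel_measuresD by auto
  interpret finite_measure x by fact
  have "(\<lambda>t. \<integral>\<^sup>+ s. ennreal (m s t a) \<partial>x) \<in> borel_measurable lam" by measurable
  then have "obs_step lam m x a \<in> density_measures lam"
    using obs_step_in_finite_borel[OF x, of a] obs_step_eq_density[OF x, of a]
    by (auto simp: density_measures_def)
  then show ?case using Cons.IH by simp
qed simp

lemma filt_in_density_probs:
  assumes x: "x \<in> density_probs lam"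
  shows "filt x w \<in> density_probs lam"
proof (cases "0 < weight x w")
  case True
  note xf = density_probsD(1)[OF x]
  have fin: "weight x w < \<top>" by (rule weight_finite[OF xf])
  have sf: "sets (steps x w) = sets borel"
    using finite_borel_measuresD[OF steps_in_finite_borel[OF xf]] by simp
  then have s: "sets (filt x w) = sets borel"
    using True by (simp add: filt_def normalize_measure_def)
  then have sp: "space (filt x w) = UNIV" using sets_eq_imp_space_eq by fastforce
  have p: "prob_space (filt x w)"
    using emeasure_filt[OF xf True, of UNIV] True fin
    by (intro prob_spaceI) (simp add: sp ennreal_divide_self)
  obtain f where f: "f \<in> borel_measurable lam" "steps x w = density lam f"
    using steps_in_density_measures[of x w] x by (auto simp: density_measures_def density_probs_def)
  have "filt x w = density lam (\<lambda>t. f t / weight x w)"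
  proof (rule measure_eqI)
    show "sets (filt x w) = sets (density lam (\<lambda>t. f t / weight x w))"
      by (simp add: s sets_lam)
    fix F assume "F \<in> sets (filt x w)"
    then have F: "F \<in> sets lam" by (simp add: s sets_lam)
    have "emeasure (filt x w) F = (\<integral>\<^sup>+ t. f t * indicator F t \<partial>lam) / weight x w"
      using f F by (simp add: emeasure_filt[OF xf True] emeasure_density)
    also have "\<dots> = (\<integral>\<^sup>+ t. f t / weight x w * indicator F t \<partial>lam)"
      using f F
      by (subst nn_integral_divide[symmetric]) (auto intro!: nn_integral_cong simp: indicator_def)
    also have "\<dots> = emeasure (density lam (\<lambda>t. f t / weight x w)) F"
      using f F by (subst emeasure_density) auto
    finally show "emeasure (filt x w) F = \<dots>" .
  qed
  moreover have "(\<lambda>t. f t / weight x w) \<in> borel_measurable lam" using f by simp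
  ultimately show ?thesis
    using p s prob_space.finite_measure[OF p]
    by (auto simp: density_probs_def density_measures_def finite_borel_measures_def)
qed (simp add: filt_def x)

end

section \<open>Forgetting of the initial law\<close>

locale partition_hmm = denumerable_obs_hmm lam tau m
  for lam :: "'s::polish_space measure"
    and tau :: "'a::polish_space measure"
    and m :: "'s \<Rightarrow> 's \<Rightarrow> 'a \<Rightarrow> real" +
  fixes S :: "'a \<Rightarrow> 's set" and a0 :: 'a and d D :: real
  assumes S_sets [measurable]: "\<And>a. S a \<in> sets borel"
    and m_eq: "\<And>s t a. ennreal (m s t a) = trans_density tau m s t * indicator (S a) t"
    and S_a0_pos: "0 < emeasure lam (S a0)"
    and d_pos: "0 < d" and d_le_D: "d \<le> D"
    and p_bounds: "\<And>s t. s \<in> S a0 \<Longrightarrow> t \<in> S a0 \<Longrightarrow>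
       ennreal d \<le> trans_density tau m s t \<and> trans_density tau m s t \<le> ennreal D"
begin

text \<open>Two successive observations \<open>a0\<close> show that the hidden chain made a transition inside \<open>S a0\<close>. The
  factor \<open>1 - d / D\<close> is the part of the dependence on the past that survives such a transition.\<close>

fun forget :: "'a list \<Rightarrow> real" where
  "forget [] = 1"
| "forget [a] = 1"
| "forget (a # b # w) = (if a = a0 \<and> b = a0 then 1 - d / D else 1) * forget (b # w)"

lemma ratio_bounds: "0 \<le> 1 - d / D" "1 - d / D < 1"
  using d_pos d_le_D by auto

lemma forget_bounds: "0 \<le> forget w \<and> forget w \<le> 1"
proof (induction w rule: forget.induct)
  case (3 a b w)
  then show ?case using ratio_bounds by (auto intro!: mult_nonneg_nonneg mult_le_one)
qed auto

text \<open>Equality can fail: a pair \<open>a0 a0\<close> made of the last letter of \<open>v\<close> and the first of \<open>w\<close> counts only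
  on the left.\<close>

lemma forget_append_le: "forget (v @ w) \<le> forget v * forget w"
proof (induction v rule: forget.induct)
  case (2 a)
  show ?case
    using forget_bounds[of w] ratio_bounds
    by (cases w) (auto simp: mult_left_le_one_le)
next
  case (3 a b v)
  then show ?case using ratio_bounds by (auto simp: mult.assoc intro!: mult_left_mono)
qed simp

lemma forget_append_le_right: "forget (v @ w) \<le> forget w"
  using forget_append_le[of v w] forget_bounds[of v] forget_bounds[of w]
  by (meson mult_left_le_one_le order_trans)

lemma m_outside: "t \<notin> S a \<Longrightarrow> m s t a = 0"
  using m_eq[of s t a] m_nonneg[of s t a] by (simp add: ennreal_eq_0_iff)

lemma m_between:
  assumes "s \<in> S a0" "t \<in> S a0"
  shows "d \<le> m s t a0" "m s t a0 \<le> D"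
  using m_eq[of s t a0] p_bounds[OF assms] d_pos d_le_D m_nonneg[of s t a0] assms
  by (auto simp flip: ennreal_le_iff)

lemma lam_S_a0_finite: "emeasure lam (S a0) < \<top>"
proof -
  obtain s where s: "s \<in> S a0" using S_a0_pos by (metis emeasure_empty ex_in_conv less_irrefl)
  have "ennreal d * emeasure lam (S a0) = (\<integral>\<^sup>+ t. ennreal d * indicator (S a0) t \<partial>lam)"
    by (simp add: nn_integral_cmult_indicator sets_lam)
  also have "\<dots> \<le> (\<integral>\<^sup>+ t. ennreal (m s t a0) \<partial>lam)"
    using m_between[OF s] by (intro nn_integral_mono) (auto simp: indicator_def intro!: ennreal_leI)
  also have "\<dots> < \<top>" using mass_obs_kernel_le_1[of s a0] by (simp add: le_less_trans)
  finally show ?thesis using d_pos by (auto simp: ennreal_mult_less_top)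
qed

text \<open>A lower bound \<open>al\<close> for the ratio of \<open>f\<close> to \<open>h\<close> improves under one transition inside \<open>S a0\<close>:
  of the excess \<open>e\<close> the transition density passes on at least \<open>d\<close> times the integral, from any
  starting point, while of \<open>h\<close> it passes on at most \<open>D\<close> times the integral. So the new ratio
  contains the fixed fraction \<open>d / D\<close> of the mean excess.\<close>

lemma mixing_step_lower_bound:
  fixes al :: ennreal
  assumes [measurable]: "h \<in> borel_measurable borel" "e \<in> borel_measurable borel"
    and s: "s \<in> S a0"
    and f: "\<And>t. t \<in> S a0 \<Longrightarrow> f t = al * h t + e t"
    and h0: "h0 = (\<integral>\<^sup>+ t \<in> S a0. h t \<partial>lam)" "h0 \<noteq> 0" "h0 < \<top>"
  shows "(al + ennreal (d / D) * ((\<integral>\<^sup>+ t \<in> S a0. e t \<partial>lam) / h0)) * (\<integral>\<^sup>+ t. ennreal (m s t a0) * h t \<partial>lam)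
    \<le> (\<integral>\<^sup>+ t. ennreal (m s t a0) * f t \<partial>lam)"
proof -
  let ?q = "\<lambda>t. ennreal (m s t a0)"
  let ?e0 = "\<integral>\<^sup>+ t \<in> S a0. e t \<partial>lam"
  have "?q t * h t \<le> ennreal D * (h t * indicator (S a0) t)" for t
    using m_between[OF s, of t] m_outside[of t a0 s]
    by (cases "t \<in> S a0") (auto intro!: mult_right_mono ennreal_leI)
  then have qh: "(\<integral>\<^sup>+ t. ?q t * h t \<partial>lam) \<le> ennreal D * h0"
    unfolding h0 by (subst nn_integral_cmult[symmetric]) (auto intro!: nn_integral_mono)
  have "ennreal d * (e t * indicator (S a0) t) \<le> ?q t * e t" for t
    using m_between[OF s, of t]
    by (cases "t \<in> S a0") (auto intro!: mult_right_mono ennreal_leI)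
  then have qe: "ennreal d * ?e0 \<le> (\<integral>\<^sup>+ t. ?q t * e t \<partial>lam)"
    by (subst nn_integral_cmult[symmetric]) (auto intro!: nn_integral_mono)
  have "ennreal (d / D) * (?e0 / h0) * (\<integral>\<^sup>+ t. ?q t * h t \<partial>lam)
      \<le> ennreal (d / D) * (?e0 / h0) * (ennreal D * h0)"
    by (rule mult_left_mono[OF qh]) simp
  also have "\<dots> = (ennreal (d / D) * ennreal D) * (?e0 / h0 * h0)"
    by (simp add: ac_simps)
  also have "?e0 / h0 * h0 = ?e0"
    using h0 by (simp add: ennreal_divide_times ennreal_mult_divide_eq)
  also have "ennreal (d / D) * ennreal D = ennreal d"
    using d_pos d_le_D by (simp add: ennreal_mult[symmetric])
  finally have "ennreal (d / D) * (?e0 / h0) * (\<integral>\<^sup>+ t. ?q t * h t \<partial>lam) \<le> (\<integral>\<^sup>+ t. ?q t * e t \<partial>lam)"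
    using qe by simp
  then have "(al + ennreal (d / D) * (?e0 / h0)) * (\<integral>\<^sup>+ t. ?q t * h t \<partial>lam)
      \<le> al * (\<integral>\<^sup>+ t. ?q t * h t \<partial>lam) + (\<integral>\<^sup>+ t. ?q t * e t \<partial>lam)"
    by (simp add: distrib_right add_left_mono)
  also have "\<dots> = (\<integral>\<^sup>+ t. al * (?q t * h t) + ?q t * e t \<partial>lam)"
    by (subst nn_integral_add) (auto simp: nn_integral_cmult)
  also have "\<dots> = (\<integral>\<^sup>+ t. ?q t * f t \<partial>lam)"
  proof (rule nn_integral_cong)
    fix t
    show "al * (?q t * h t) + ?q t * e t = ?q t * f t"
      using f[of t] m_outside[of t a0 s]
      by (cases "t \<in> S a0") (auto simp: distrib_left ac_simps)
  qed
  finally show ?thesis .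
qed

lemma word_kernel_Cons_lower_bound:
  assumes [measurable]: "G \<in> sets borel"
    and c: "\<And>t. t \<in> S b \<Longrightarrow> c * word_kernel w UNIV t \<le> word_kernel w G t"
  shows "c * word_kernel (b # w) UNIV s \<le> word_kernel (b # w) G s"
proof -
  have "c * word_kernel (b # w) UNIV s = (\<integral>\<^sup>+ t. c * (ennreal (m s t b) * word_kernel w UNIV t) \<partial>lam)"
    by (simp add: nn_integral_cmult)
  also have "\<dots> \<le> (\<integral>\<^sup>+ t. ennreal (m s t b) * word_kernel w G t \<partial>lam)"
  proof (rule nn_integral_mono)
    fix t
    show "c * (ennreal (m s t b) * word_kernel w UNIV t) \<le> ennreal (m s t b) * word_kernel w G t"
      using c[of t] m_outside[of t b s]
      by (cases "t \<in> S b") (auto simp: mult.left_commute[of c] intro!: mult_left_mono)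
  qed
  finally show ?thesis by simp
qed

lemma forget_nonneg: "0 \<le> forget w"
  using forget_bounds by simp

text \<open>For a state \<open>s\<close> just observed as \<open>a\<close>, the ratio of \<open>word_kernel w F s\<close> to \<open>word_kernel w UNIV s\<close>
  is the conditional probability of \<open>F\<close> given the next observations \<open>w\<close>. It lies in the interval from
  \<open>al\<close> to \<open>1 - be\<close>, of length \<open>forget (a # w)\<close>, for all these \<open>s\<close> at once. Bounding the ratios
  for \<open>F\<close> and for its complement from below, instead of one of them from both sides, makes the two
  endpoints symmetric. In the induction a step from \<open>S a\<close> to \<open>S b\<close> averages the ratios and so
  preserves every bound, and a step from \<open>S a0\<close> to itself improves both bounds by
  \<open>mixing_step_lower_bound\<close>.\<close>

lemma word_kernel_ratio_on_class:
  assumes F[measurable]: "F \<in> sets borel"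
  shows "\<exists>al be. al + be + ennreal (forget (a # w)) = 1 \<and>
    (\<forall>s \<in> S a. al * word_kernel w UNIV s \<le> word_kernel w F s \<and>
       be * word_kernel w UNIV s \<le> word_kernel w (- F) s)"
proof (induction w arbitrary: a)
  case Nil
  show ?case by (intro exI[of _ 0]) simp
next
  case (Cons b w)
  have [measurable]: "- F \<in> sets borel" using F by auto
  obtain al be where sum: "al + be + ennreal (forget (b # w)) = 1"
    and lower: "\<And>s. s \<in> S b \<Longrightarrow> al * word_kernel w UNIV s \<le> word_kernel w F s"
      "\<And>s. s \<in> S b \<Longrightarrow> be * word_kernel w UNIV s \<le> word_kernel w (- F) s"
    using Cons.IH[of b] by blast
  show ?case
  proof (cases "a = a0 \<and> b = a0")
    case False
    then have "forget (a # b # w) = forget (b # w)"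
      by (simp only: forget.simps False if_False mult_1)
    then show ?thesis
      using sum word_kernel_Cons_lower_bound[OF F lower(1)]
        word_kernel_Cons_lower_bound[OF \<open>- F \<in> sets borel\<close> lower(2)] by metis
  next
    case True
    define h f f' where "h = word_kernel w UNIV" and "f = word_kernel w F" and "f' = word_kernel w (- F)"
    define h0 where "h0 = (\<integral>\<^sup>+ t \<in> S a0. h t \<partial>lam)"
    have [measurable]: "h \<in> borel_measurable borel" "f \<in> borel_measurable borel" "f' \<in> borel_measurable borel"
      unfolding h_def f_def f'_def by measurable
    have "h0 \<le> (\<integral>\<^sup>+ t \<in> S a0. 1 \<partial>lam)"
      unfolding h0_def h_def by (intro nn_integral_mono mult_right_mono word_kernel_le_1) simp
    then have h0_fin: "h0 < \<top>"
      using lam_S_a0_finite by (simp add: sets_lam le_less_trans)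
    have ratio: "forget (a # b # w) = (1 - d / D) * forget (b # w)" using True by simp
    show ?thesis
    \<comment> \<open>If \<open>h0 = 0\<close>, the word \<open>b # w\<close> has probability zero from every state in \<open>S a0\<close>, and any
            bounds will do.\<close>
    proof (cases "h0 = 0")
      case True0: True
      have z: "word_kernel (b # w) UNIV s = 0" if "s \<in> S a" for s
      proof -
        have "ennreal (m s t a0) * h t \<le> ennreal D * (h t * indicator (S a0) t)" for t
          using m_between[of s t] that True m_outside[of t a0 s]
          by (cases "t \<in> S a0") (auto intro!: mult_right_mono ennreal_leI)
        then have "(\<integral>\<^sup>+ t. ennreal (m s t a0) * h t \<partial>lam) \<le> ennreal D * h0"
          unfolding h0_def by (subst nn_integral_cmult[symmetric]) (auto intro!: nn_integral_mono)
        then show ?thesis using True True0 by (simp add: h_def)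
      qed
      have "1 - ennreal (forget (a # b # w)) + 0 + ennreal (forget (a # b # w)) = 1"
        using forget_bounds[of "a # b # w"] by (simp add: diff_add_cancel_ennreal del: forget.simps)
      then show ?thesis using z by (metis mult_zero_right zero_le)
    next
      case False
      \<comment> \<open>On \<open>S a0\<close> the excesses add up to \<open>forget (b # w)\<close> times \<open>h\<close>.\<close>
      define e e' where "e t = f t - al * h t" and "e' t = f' t - be * h t" for t
      have [measurable]: "e \<in> borel_measurable borel" "e' \<in> borel_measurable borel"
        unfolding e_def e'_def by measurable
      have fe: "f t = al * h t + e t" "f' t = be * h t + e' t" if "t \<in> S a0" for t
        unfolding e_def e'_def using lower[of t] True that
        by (auto simp: h_def f_def f'_def add_diff_inverse_ennreal)
      let ?e0 = "\<integral>\<^sup>+ t \<in> S a0. e t \<partial>lam" and ?e0' = "\<integral>\<^sup>+ t \<in> S a0. e' t \<partial>lam"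
      have le1: "al \<le> 1" "be \<le> 1"
        using sum by (metis add.assoc add.commute le_iff_add)+
      have "(\<integral>\<^sup>+ t \<in> S a0. h t \<partial>lam) =
          (\<integral>\<^sup>+ t. (al + be) * (h t * indicator (S a0) t) + (e t * indicator (S a0) t + e' t * indicator (S a0) t) \<partial>lam)"
      proof (rule nn_integral_cong)
        fix t
        show "h t * indicator (S a0) t =
            (al + be) * (h t * indicator (S a0) t) + (e t * indicator (S a0) t + e' t * indicator (S a0) t)"
          using word_kernel_add_Compl[OF F, of w t] fe[of t]
          by (cases "t \<in> S a0") (auto simp: h_def f_def f'_def distrib_right ac_simps)
      qed
      also have "\<dots> = (al + be) * h0 + (?e0 + ?e0')"
        by (simp add: h0_def nn_integral_add nn_integral_cmult)
      finally have "(al + be) * h0 + (?e0 + ?e0') = h0" by (simp add: h0_def)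
      also have "h0 = (al + be) * h0 + ennreal (forget (b # w)) * h0"
        using sum by (metis distrib_right mult_1)
      finally have "(al + be) * h0 + (?e0 + ?e0') = (al + be) * h0 + ennreal (forget (b # w)) * h0" .
      moreover have "al \<noteq> \<top>" "be \<noteq> \<top>"
        using le1 by (auto simp: top_unique)
      ultimately have "?e0 + ?e0' = ennreal (forget (b # w)) * h0"
        using h0_fin by (auto simp: ennreal_add_left_cancel ennreal_mult_eq_top_iff)
      then have "(?e0 + ?e0') / h0 = ennreal (forget (b # w))"
        using False h0_fin by (simp add: ennreal_mult_divide_eq)
      then have e_sum: "?e0 / h0 + ?e0' / h0 = ennreal (forget (b # w))"
        by (simp add: add_divide_distrib_ennreal)
      let ?al = "al + ennreal (d / D) * (?e0 / h0)" and ?be = "be + ennreal (d / D) * (?e0' / h0)"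
      have "?al + ?be + ennreal (forget (a # b # w)) =
          al + be + (ennreal (d / D) * (?e0 / h0 + ?e0' / h0) + ennreal (forget (a # b # w)))"
        by (simp add: distrib_left ac_simps del: forget.simps)
      also have "ennreal (d / D) * (?e0 / h0 + ?e0' / h0) + ennreal (forget (a # b # w)) =
          ennreal (forget (b # w))"
      proof -
        have "ennreal (d / D) + ennreal (1 - d / D) = 1"
          using ratio_bounds d_pos d_le_D by (simp flip: ennreal_plus)
        then show ?thesis
          unfolding e_sum ratio ennreal_mult''[OF forget_nonneg]
          by (simp flip: distrib_right)
      qed
      finally have new_sum: "?al + ?be + ennreal (forget (a # b # w)) = 1" using sum by simp
      have "?al * word_kernel (b # w) UNIV s \<le> word_kernel (b # w) F s \<and>
          ?be * word_kernel (b # w) UNIV s \<le> word_kernel (b # w) (- F) s" if "s \<in> S a" for s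
        using mixing_step_lower_bound[of h e s f al h0] mixing_step_lower_bound[of h e' s f' be h0]
          that True False h0_fin h0_def fe
        by (simp add: h_def f_def f'_def)
      then show ?thesis using new_sum by blast
    qed
  qed
qed

text \<open>Bounds on ratios that hold for every starting point hold for the ratio of the integrals with
  respect to any initial law. Hence the filters for \<open>x\<close> and \<open>y\<close> give every event probabilities in
  one common interval of length \<open>forget w\<close>.\<close>

lemma tv_dist_filt_le:
  assumes x: "x \<in> density_probs lam" "0 < weight x w"
    and y: "y \<in> density_probs lam" "0 < weight y w"
  shows "tv_dist (filt x w) (filt y w) \<le> 2 * forget w"
proof (rule tv_dist_leI)
  note fx = density_probsD[OF filt_in_density_probs[OF x(1)]]
    and fy = density_probsD[OF filt_in_density_probs[OF y(1)]]
  interpret fx: prob_space "filt x w" by (rule fx)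
  interpret fy: prob_space "filt y w" by (rule fy)
  fix F :: "'s set" assume F: "F \<in> sets borel"
  then have F': "- F \<in> sets borel" by auto
  have "\<exists>al be. al + be + ennreal (forget w) = 1 \<and>
    (\<forall>s. al * word_kernel w UNIV s \<le> word_kernel w F s \<and>
       be * word_kernel w UNIV s \<le> word_kernel w (- F) s)"
  proof (cases w)
    case Nil
    then show ?thesis by (intro exI[of _ 0]) simp
  next
    case (Cons a w')
    then show ?thesis
      using word_kernel_ratio_on_class[OF F, of a w'] word_kernel_Cons_lower_bound[OF F, of a _ w']
        word_kernel_Cons_lower_bound[OF F', of a _ w'] by (metis (no_types, lifting))
  qed
  then obtain al be where sum: "al + be + ennreal (forget w) = 1"
    and al: "\<And>s. al * word_kernel w UNIV s \<le> word_kernel w F s"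
    and be: "\<And>s. be * word_kernel w UNIV s \<le> word_kernel w (- F) s" by blast
  have bound: "c \<le> emeasure (filt z w) G"
    if z: "z \<in> density_probs lam" "0 < weight z w" and G: "G \<in> sets borel"
      and c: "\<And>s. c * word_kernel w UNIV s \<le> word_kernel w G s" for c z G
  proof -
    note zf = density_probsD(1)[OF z(1)]
    have UNIV_sets: "UNIV \<in> sets (borel :: 's measure)" by simp
    have [measurable_cong]: "sets z = sets borel" using density_probsD[OF z(1)] by simp
    have "c * weight z w \<le> emeasure (steps z w) G"
      unfolding emeasure_steps[OF zf G] emeasure_steps[OF zf UNIV_sets]
      by (subst nn_integral_cmult[symmetric]) (auto intro!: nn_integral_mono c)
    then have "c * weight z w / weight z w \<le> emeasure (filt z w) G"
      unfolding emeasure_filt[OF zf z(2)] by (rule divide_right_mono_ennreal)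
    then show ?thesis
      using z(2) weight_finite[OF zf, of w] by (simp add: ennreal_mult_divide_eq)
  qed
  have fin: "al \<noteq> \<top>" "be \<noteq> \<top>" using sum by auto
  define al' be' where "al' = enn2real al" and "be' = enn2real be"
  have eq: "al = ennreal al'" "be = ennreal be'" and nn: "0 \<le> al'" "0 \<le> be'"
    using fin by (auto simp: al'_def be'_def less_top)
  have "ennreal (al' + be' + forget w) = ennreal 1"
    using sum nn forget_nonneg[of w] unfolding eq by (simp add: ennreal_plus)
  then have s': "al' + be' + forget w = 1"
    using nn forget_nonneg[of w] by (subst (asm) ennreal_inj) auto
  have "ennreal al' \<le> ennreal (measure (filt x w) F)" "ennreal al' \<le> ennreal (measure (filt y w) F)"
    "ennreal be' \<le> ennreal (measure (filt x w) (- F))" "ennreal be' \<le> ennreal (measure (filt y w) (- F))"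
    using bound[OF x F al] bound[OF y F al] bound[OF x F' be] bound[OF y F' be]
    by (simp_all add: eq fx.emeasure_eq_measure fy.emeasure_eq_measure)
  then have "al' \<le> measure (filt x w) F" "al' \<le> measure (filt y w) F"
    "be' \<le> measure (filt x w) (- F)" "be' \<le> measure (filt y w) (- F)"
    by (simp_all add: ennreal_le_iff)
  moreover have "measure (filt x w) (- F) = 1 - measure (filt x w) F"
    "measure (filt y w) (- F) = 1 - measure (filt y w) F"
    using fx.prob_compl[of F] fy.prob_compl[of F] F fx fy by (simp_all add: Compl_eq_Diff_UNIV)
  ultimately show "measure (filt x w) F - measure (filt y w) F \<le> forget w"
    "measure (filt y w) F - measure (filt x w) F \<le> forget w" using s' by linarith+
qed

end

section \<open>Convergence of the hidden chain\<close>

context denumerable_obs_hmm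
begin

text \<open>Once the first \<open>n\<close> observations are summed out, they matter to the later ones only through the law
  of the hidden state at time \<open>n\<close>.\<close>

lemma sum_words_drop:
  assumes x: "x \<in> finite_borel_measures" "prob_space x"
  shows "(\<integral>\<^sup>+ u. f (drop n u) * weight x u \<partial>count_space (words (n + k))) =
    (\<integral>\<^sup>+ w. f w * weight (push n x) w \<partial>count_space (words k))"
proof -
  have "(\<integral>\<^sup>+ u. f (drop n u) * weight x u \<partial>count_space (words (n + k))) =
      (\<integral>\<^sup>+ v. (\<integral>\<^sup>+ w. f w * weight x (v @ w) \<partial>count_space (words k)) \<partial>count_space (words n))"
    unfolding nn_integral_words_append by (intro nn_integral_cong) simp
  also have "\<dots> = (\<integral>\<^sup>+ w. (\<integral>\<^sup>+ v. f w * weight x (v @ w) \<partial>count_space (words n)) \<partial>count_space (words k))"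
    by (rule nn_integral_count_space_nn_integral[symmetric]) (auto intro: countable_words countable_obs)
  also have "\<dots> = (\<integral>\<^sup>+ w. f w * weight (push n x) w \<partial>count_space (words k))"
    by (simp add: nn_integral_cmult sum_words_steps_append[OF x, unfolded foldl_append])
  finally show ?thesis .
qed

text \<open>An expectation over the observations is an integral of a function of the initial state that is
  again bounded by one.\<close>

lemma sum_words_le_add_tv_dist:
  assumes x: "x \<in> finite_borel_measures" and y: "y \<in> finite_borel_measures"
    and f: "\<And>w. f w \<le> 1"
  shows "(\<integral>\<^sup>+ w. f w * weight x w \<partial>count_space (words n)) \<le>
    (\<integral>\<^sup>+ w. f w * weight y w \<partial>count_space (words n)) + ennreal (tv_dist x y)"
proof -
  let ?k = "\<lambda>s. \<integral>\<^sup>+ w. f w * word_kernel w UNIV s \<partial>count_space (words n)"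
  have eq: "(\<integral>\<^sup>+ w. f w * weight z w \<partial>count_space (words n)) = (\<integral>\<^sup>+ s. ?k s \<partial>z)"
    if z: "z \<in> finite_borel_measures" for z
  proof -
    have [measurable_cong]: "sets z = sets borel" using finite_borel_measuresD[OF z] by simp
    have "(\<integral>\<^sup>+ w. f w * weight z w \<partial>count_space (words n)) =
        (\<integral>\<^sup>+ w. (\<integral>\<^sup>+ s. f w * word_kernel w UNIV s \<partial>z) \<partial>count_space (words n))"
      by (intro nn_integral_cong) (simp add: emeasure_steps[OF z] nn_integral_cmult)
    also have "\<dots> = (\<integral>\<^sup>+ s. ?k s \<partial>z)"
      by (rule nn_integral_count_space_nn_integral[symmetric]) (auto intro: countable_words countable_obs)
    finally show ?thesis .
  qed
  have "?k \<in> borel_measurable borel"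
    by (rule borel_measurable_nn_integral_countable) (auto intro: countable_words countable_obs)
  moreover have "?k s \<le> 1" for s
  proof -
    have r: "return borel s \<in> finite_borel_measures" "prob_space (return borel s)"
      using prob_space_return[of s borel]
      by (auto intro!: finite_borel_measuresI prob_space.finite_measure)
    have "?k s \<le> (\<integral>\<^sup>+ w. 1 * word_kernel w UNIV s \<partial>count_space (words n))"
      by (intro nn_integral_mono mult_right_mono f) simp
    also have "\<dots> = (\<integral>\<^sup>+ w. weight (return borel s) w \<partial>count_space (words n))"
      by (intro nn_integral_cong) (simp add: emeasure_steps[OF r(1)] nn_integral_return)
    finally show ?thesis using sum_words_mass[OF r] by simp
  qed
  ultimately show ?thesis
    unfolding eq[OF x] eq[OF y] by (rule nn_integral_le_add_tv_dist[OF x y])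
qed

lemma emeasure_steps_filt:
  assumes x: "x \<in> density_probs lam" "0 < weight x v" and F: "F \<in> sets borel"
  shows "weight x v * emeasure (steps (filt x v) w) F = emeasure (steps x (v @ w)) F"
proof -
  note xf = density_probsD(1)[OF x(1)]
  have fin: "weight x v < \<top>" by (rule weight_finite[OF xf])
  have sx: "steps x v \<in> finite_borel_measures" by (rule steps_in_finite_borel[OF xf])
  have ff: "filt x v \<in> finite_borel_measures"
    by (rule density_probsD[OF filt_in_density_probs[OF x(1)]])
  note [measurable_cong] = finite_borel_measuresD(1)[OF sx]
  have "emeasure (steps (filt x v) w) F =
      inverse (weight x v) * (\<integral>\<^sup>+ s. word_kernel w F s \<partial>steps x v)"
    unfolding emeasure_steps[OF ff F] using x(2) F finite_borel_measuresD(2)[OF sx]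
    by (simp add: filt_def normalize_measure_def nn_integral_scale_measure)
  also have "(\<integral>\<^sup>+ s. word_kernel w F s \<partial>steps x v) = emeasure (steps x (v @ w)) F"
    by (simp add: emeasure_steps[OF sx F])
  finally have "weight x v * emeasure (steps (filt x v) w) F =
      (weight x v * inverse (weight x v)) * emeasure (steps x (v @ w)) F"
    by (simp add: mult.assoc)
  also have "weight x v * inverse (weight x v) = 1"
    using x(2) fin by (simp add: divide_ennreal_def[symmetric] ennreal_divide_self)
  finally show ?thesis by simp
qed

lemma transition_pow_bind_transition:
  "transition_pow n s \<bind> transition = transition s \<bind> transition_pow n"
proof (induction n arbitrary: s)
  case 0
  have "transition \<in> borel \<rightarrow>\<^sub>M subprob_algebra borel"
    by (rule measurable_prob_algebraD[OF measurable_transition])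
  then show ?case by (simp add: bind_return bind_return'')
next
  case (Suc n)
  have tr: "transition \<in> borel \<rightarrow>\<^sub>M subprob_algebra borel"
    by (rule measurable_prob_algebraD[OF measurable_transition])
  have "transition_pow (Suc n) s \<bind> transition =
      transition s \<bind> (\<lambda>t. transition_pow n t \<bind> transition)"
    unfolding kernel_pow.simps by (rule bind_assoc[OF _ tr]) measurable
  then show ?case by (simp add: Suc.IH)
qed

end

locale ergodic_obs_hmm = denumerable_obs_hmm lam tau m
  for lam :: "'s::polish_space measure"
    and tau :: "'a::polish_space measure"
    and m :: "'s \<Rightarrow> 's \<Rightarrow> 'a \<Rightarrow> real" +
  fixes mu :: "'s measure"
  assumes strongly_ergodic: "strongly_ergodic transition mu"
begin

lemma prob_space_mu: "prob_space mu"
  and sets_mu [measurable_cong]: "sets mu = sets borel"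
  and tv_dist_transition_pow: "(\<lambda>n. tv_dist (transition_pow n s) mu) \<longlonglongrightarrow> 0"
  using strongly_ergodic by (auto simp: strongly_ergodic_def)

sublocale mu: prob_space mu
  by (rule prob_space_mu)

lemma mu_finite_borel: "mu \<in> finite_borel_measures"
  by (intro finite_borel_measuresI sets_mu mu.finite_measure_axioms)

lemma space_mu: "space mu = UNIV"
  using finite_borel_measuresD[OF mu_finite_borel] by simp

text \<open>Both \<open>mu\<close> and its image under one further transition are limits in total variation of
  \<open>transition_pow n s\<close>.\<close>

lemma mu_stationary: "mu \<bind> transition = mu"
proof (rule measure_eqI)
  have tr: "transition \<in> borel \<rightarrow>\<^sub>M subprob_algebra borel"
    by (rule measurable_prob_algebraD[OF measurable_transition])
  then have tr_mu: "transition \<in> mu \<rightarrow>\<^sub>M subprob_algebra borel" by measurable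
  show "sets (mu \<bind> transition) = sets mu"
    using sets_bind[of mu transition borel] by (simp add: space_mu sets_mu)
  fix F assume "F \<in> sets (mu \<bind> transition)"
  then have F[measurable]: "F \<in> sets borel"
    using sets_bind[of mu transition borel] by (simp add: space_mu)
  let ?k = "\<lambda>t. emeasure (transition t) F"
  have k[measurable]: "?k \<in> borel_measurable borel"
    by (rule measurable_compose[OF tr measurable_emeasure_subprob_algebra[OF F]])
  have k1: "?k t \<le> 1" for t by (rule prob_space.measure_le_1[OF prob_space_transition])
  fix s :: 's
  define e where "e n = ennreal (tv_dist (transition_pow n s) mu)" for n
  have e: "e \<longlonglongrightarrow> 0"
    unfolding e_def using tendsto_ennrealI[OF tv_dist_transition_pow[of s]] by simp
  have bind_F: "emeasure (z \<bind> transition) F = (\<integral>\<^sup>+ t. ?k t \<partial>z)" if z: "z \<in> finite_borel_measures" for z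
  proof -
    have [measurable_cong]: "sets z = sets borel" using finite_borel_measuresD[OF z] by simp
    have "transition \<in> z \<rightarrow>\<^sub>M subprob_algebra borel" using tr by measurable
    then show ?thesis
      using emeasure_bind[of z transition borel F] F finite_borel_measuresD[OF z] by simp
  qed
  have p: "transition_pow n s \<bind> transition = transition_pow (Suc n) s" for n
    by (simp add: transition_pow_bind_transition)
  note tp = transition_pow_props(4)
  have ind: "indicator F t \<le> (1 :: ennreal)" for t by (simp add: indicator_def)
  have 1: "emeasure (mu \<bind> transition) F \<le> emeasure mu F + (e n + e (Suc n))" for n
  proof -
    have "emeasure (mu \<bind> transition) F \<le> (\<integral>\<^sup>+ t. ?k t \<partial>transition_pow n s) + e n"
      unfolding bind_F[OF mu_finite_borel] e_def
      using nn_integral_le_add_tv_dist[OF mu_finite_borel tp k k1] by (simp add: tv_dist_commute)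
    also have "(\<integral>\<^sup>+ t. ?k t \<partial>transition_pow n s) = (\<integral>\<^sup>+ t. indicator F t \<partial>transition_pow (Suc n) s)"
      using bind_F[OF tp, of n s] p[of n] transition_pow_props(2)[of "Suc n" s] F
      by (simp del: kernel_pow.simps)
    also have "\<dots> \<le> (\<integral>\<^sup>+ t. indicator F t \<partial>mu) + e (Suc n)"
      unfolding e_def
      by (rule nn_integral_le_add_tv_dist[OF tp mu_finite_borel _ ind]) simp
    finally show ?thesis by (simp add: sets_mu add_right_mono ac_simps)
  qed
  have 2: "emeasure mu F \<le> emeasure (mu \<bind> transition) F + (e n + e (Suc n))" for n
  proof -
    have "emeasure mu F \<le> (\<integral>\<^sup>+ t. indicator F t \<partial>transition_pow (Suc n) s) + e (Suc n)"
      using nn_integral_le_add_tv_dist[OF mu_finite_borel tp[of "Suc n" s], of "indicator F"] ind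
      by (simp add: sets_mu e_def tv_dist_commute del: kernel_pow.simps)
    also have "(\<integral>\<^sup>+ t. indicator F t \<partial>transition_pow (Suc n) s) = (\<integral>\<^sup>+ t. ?k t \<partial>transition_pow n s)"
      using bind_F[OF tp, of n s] p[of n] transition_pow_props(2)[of "Suc n" s] F
      by (simp del: kernel_pow.simps)
    also have "\<dots> \<le> emeasure (mu \<bind> transition) F + e n"
      unfolding bind_F[OF mu_finite_borel] e_def
      by (rule nn_integral_le_add_tv_dist[OF tp mu_finite_borel k k1])
    finally show ?thesis by (simp add: add_right_mono ac_simps)
  qed
  have lim: "(\<lambda>n. c + (e n + e (Suc n))) \<longlonglongrightarrow> c" for c
    using tendsto_add[OF tendsto_const[of c] tendsto_add[OF e LIMSEQ_Suc[OF e]]] by simp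
  show "emeasure (mu \<bind> transition) F = emeasure mu F"
  proof (rule antisym)
    show "emeasure (mu \<bind> transition) F \<le> emeasure mu F"
      by (rule LIMSEQ_le_const[OF lim]) (use 1 in auto)
    show "emeasure mu F \<le> emeasure (mu \<bind> transition) F"
      by (rule LIMSEQ_le_const[OF lim]) (use 2 in auto)
  qed
qed

lemma push_mu [simp]: "push n mu = mu"
proof (induction n)
  case 0
  show ?case by (simp add: push_def bind_return'' sets_mu)
next
  case (Suc n)
  have tr: "transition \<in> mu \<rightarrow>\<^sub>M subprob_algebra borel"
    using measurable_prob_algebraD[OF measurable_transition] by measurable
  have "push (Suc n) mu = (mu \<bind> transition) \<bind> transition_pow n"
    unfolding push_def kernel_pow.simps
    by (rule bind_assoc[OF tr, symmetric]) measurable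
  then show ?case using Suc by (simp add: mu_stationary push_def)
qed

text \<open>By stationarity \<open>mu\<close> is a mixture of the laws \<open>transition s\<close>, all of which vanish on null sets of
  \<open>lam\<close>.\<close>

lemma mu_in_density_probs: "mu \<in> density_probs lam"
proof -
  have "absolutely_continuous lam mu"
    unfolding absolutely_continuous_def
  proof
    fix F assume F: "F \<in> null_sets lam"
    then have [measurable]: "F \<in> sets borel" by (auto simp: sets_lam)
    have tr: "transition \<in> mu \<rightarrow>\<^sub>M subprob_algebra borel"
      using measurable_prob_algebraD[OF measurable_transition] by measurable
    have z: "emeasure (transition s) F = 0" for s
    proof -
      have "F \<in> null_sets (transition s)"
        using absolutely_continuousI_density[of "trans_density tau m s" lam] F
        by (auto simp: absolutely_continuous_def hidden_kernel_def)
      then show ?thesis by auto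
    qed
    have "emeasure mu F = emeasure (mu \<bind> transition) F" by (simp add: mu_stationary)
    also have "\<dots> = (\<integral>\<^sup>+ s. emeasure (transition s) F \<partial>mu)"
      by (rule emeasure_bind[OF _ tr]) (auto simp: space_mu)
    finally show "F \<in> null_sets mu" by (simp add: z null_sets_def sets_mu)
  qed
  then have "\<exists>f \<in> borel_measurable lam. density lam f = mu"
    by (rule lam.Radon_Nikodym) (simp add: sets_mu sets_lam)
  then show ?thesis
    using mu_finite_borel prob_space_mu by (auto simp: density_probs_def density_measures_def)
qed

text \<open>Pointwise convergence in total variation carries over to mixtures of starting points: evaluated
  along nearly optimal sets, the difference of the measures is an integral of differences that
  tend to zero pointwise.\<close>

lemma tv_dist_push_mu:
  assumes x: "x \<in> finite_borel_measures" "prob_space x"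
  shows "(\<lambda>n. tv_dist (push n x) mu) \<longlonglongrightarrow> 0"
proof -
  interpret x: prob_space x by fact
  interpret push: prob_space "push n x" for n by (rule push_props[OF x])
  have [measurable_cong]: "sets x = sets borel" using finite_borel_measuresD[OF x(1)] by simp
  have conv: "(\<lambda>n. measure (push n x) (F n) - measure mu (F n)) \<longlonglongrightarrow> 0"
    if F[measurable]: "\<And>n. F n \<in> sets borel" for F
  proof -
    have kmeas[measurable]: "(\<lambda>s. measure (transition_pow n s) (F n)) \<in> borel_measurable borel" for n
      by (rule measurable_compose[OF measurable_transition_pow_subprob
            measurable_measure_subprob_algebra[OF F]])
    have le1: "measure (transition_pow n s) (F n) \<le> 1" for n s
      by (rule prob_space.prob_le_1[OF transition_pow_props(1)])
    have int: "integrable x (\<lambda>s. measure (transition_pow n s) (F n))" for n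
      by (rule x.integrable_const_bound[of _ 1]) (auto simp: le1)
    have eq: "measure (push n x) (F n) = (\<integral> s. measure (transition_pow n s) (F n) \<partial>x)" for n
    proof -
      have "emeasure (push n x) (F n) = (\<integral>\<^sup>+ s. emeasure (transition_pow n s) (F n) \<partial>x)"
        using nn_integral_push[OF x, of "indicator (F n)" n]
          transition_pow_props(2) finite_borel_measuresD(1)[OF push_props(2)[OF x]] by simp
      also have "\<dots> = (\<integral>\<^sup>+ s. ennreal (measure (transition_pow n s) (F n)) \<partial>x)"
        by (intro nn_integral_cong finite_measure.emeasure_eq_measure prob_space.finite_measure
            transition_pow_props(1))
      also have "\<dots> = ennreal (\<integral> s. measure (transition_pow n s) (F n) \<partial>x)"
        by (rule nn_integral_eq_integral[OF int]) simp
      finally show ?thesis by (simp add: push.emeasure_eq_measure)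
    qed
    have "(\<lambda>n. \<integral> s. measure (transition_pow n s) (F n) - measure mu (F n) \<partial>x) \<longlonglongrightarrow> (\<integral> s. 0 \<partial>x)"
    proof (rule integral_dominated_convergence[where w = "\<lambda>_. 1"])
      show "AE s in x. (\<lambda>n. measure (transition_pow n s) (F n) - measure mu (F n)) \<longlonglongrightarrow> 0"
      proof (intro AE_I2 Lim_null_comparison[OF _ tv_dist_transition_pow] always_eventually allI)
        fix s n
        show "norm (measure (transition_pow n s) (F n) - measure mu (F n)) \<le> tv_dist (transition_pow n s) mu"
          using measure_diff_le_tv_dist[OF transition_pow_props(4)[of n s] mu_finite_borel F[of n]]
            measure_diff_le_tv_dist[OF mu_finite_borel transition_pow_props(4)[of n s] F[of n]]
          by (simp add: tv_dist_commute)
      qed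
      show "AE s in x. norm (measure (transition_pow n s) (F n) - measure mu (F n)) \<le> 1" for n
        using le1[of n] mu.prob_le_1[of "F n"]
        by (intro AE_I2) (smt (verit) measure_nonneg real_norm_def)
    qed auto
    then show ?thesis
      using int x.prob_space by (simp add: eq Bochner_Integration.integral_diff)
  qed
  have half: "\<exists>F. (\<forall>n. F n \<in> sets borel) \<and> (\<forall>n. (SUP G \<in> sets borel. measure (z n) G - measure (z' n) G)
      < measure (z n) (F n) - measure (z' n) (F n) + inverse (real (Suc n)))"
    if z: "\<And>n. z n \<in> finite_borel_measures" for z z' :: "nat \<Rightarrow> 's measure"
  proof -
    have "\<exists>G \<in> sets borel. (SUP G \<in> sets borel. measure (z n) G - measure (z' n) G) - inverse (real (Suc n))
        < measure (z n) G - measure (z' n) G" for n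
      by (rule less_cSUP_iff[THEN iffD1, OF _ tv_bdd_above[OF z]]) auto
    then have "\<exists>F. \<forall>n. F n \<in> sets borel \<and> (SUP G \<in> sets borel. measure (z n) G - measure (z' n) G)
        - inverse (real (Suc n)) < measure (z n) (F n) - measure (z' n) (F n)"
      by (intro choice allI) blast
    then show ?thesis by (simp add: diff_less_eq) blast
  qed
  have inv: "(\<lambda>n. inverse (real (Suc n))) \<longlonglongrightarrow> 0" by (rule LIMSEQ_inverse_real_of_nat)
  obtain F where F: "\<And>n. F n \<in> sets borel"
    "\<And>n. (SUP G \<in> sets borel. measure (push n x) G - measure mu G)
      < measure (push n x) (F n) - measure mu (F n) + inverse (real (Suc n))"
    using half[of "\<lambda>n. push n x" "\<lambda>_. mu"] push_props(2)[OF x] by blast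
  obtain F' where F': "\<And>n. F' n \<in> sets borel"
    "\<And>n. (SUP G \<in> sets borel. measure mu G - measure (push n x) G)
      < measure mu (F' n) - measure (push n x) (F' n) + inverse (real (Suc n))"
    using half[of "\<lambda>_. mu" "\<lambda>n. push n x"] mu_finite_borel by blast
  show ?thesis
  proof (rule tendsto_sandwich)
    show "\<forall>\<^sub>F n in sequentially. 0 \<le> tv_dist (push n x) mu"
      by (simp add: tv_dist_nonneg push_props[OF x] mu_finite_borel)
    show "\<forall>\<^sub>F n in sequentially. tv_dist (push n x) mu \<le>
        (measure (push n x) (F n) - measure mu (F n) + inverse (real (Suc n))) +
        (- (measure (push n x) (F' n) - measure mu (F' n)) + inverse (real (Suc n)))"
      using F(2) F'(2) unfolding tv_dist_def
      by (intro always_eventually allI) (smt (verit))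
    show "(\<lambda>n. (measure (push n x) (F n) - measure mu (F n) + inverse (real (Suc n))) +
        (- (measure (push n x) (F' n) - measure mu (F' n)) + inverse (real (Suc n)))) \<longlonglongrightarrow> 0"
      using tendsto_add[OF tendsto_add[OF conv[OF F(1)] inv]
          tendsto_add[OF tendsto_minus[OF conv[OF F'(1)]] inv]] by simp
  qed simp
qed

end

section \<open>Decay of the memory\<close>

locale ergodic_partition_hmm =
  partition_hmm lam tau m S a0 d D + ergodic_obs_hmm lam tau m mu
  for lam :: "'s::polish_space measure"
    and tau :: "'a::polish_space measure"
    and m :: "'s \<Rightarrow> 's \<Rightarrow> 'a \<Rightarrow> real"
    and S a0 d D mu +
  assumes mu_S_a0_pos: "0 < emeasure mu (S a0)"
begin

text \<open>The expected value of \<open>forget\<close> over the first \<open>n\<close> observations of the chain with initial law \<open>x\<close>.\<close>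

definition memory :: "nat \<Rightarrow> 's measure \<Rightarrow> ennreal" where
  "memory n x = (\<integral>\<^sup>+ w. ennreal (forget w) * weight x w \<partial>count_space (words n))"

lemma memory_le_1:
  assumes "x \<in> finite_borel_measures" "prob_space x"
  shows "memory n x \<le> 1"
proof -
  have "memory n x \<le> (\<integral>\<^sup>+ w. 1 * weight x w \<partial>count_space (words n))"
    unfolding memory_def
    by (intro nn_integral_mono mult_right_mono) (use forget_bounds in \<open>auto simp: ennreal_le_1\<close>)
  then show ?thesis using sum_words_mass[OF assms] by simp
qed

lemma memory_append_le:
  assumes "x \<in> finite_borel_measures" "prob_space x"
  shows "memory (n + k) x \<le> memory k (push n x)"
proof -
  have "memory (n + k) x \<le> (\<integral>\<^sup>+ u. ennreal (forget (drop n u)) * weight x u \<partial>count_space (words (n + k)))"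
    unfolding memory_def
  proof (intro nn_integral_mono mult_right_mono ennreal_leI)
    fix u :: "'a list"
    show "forget u \<le> forget (drop n u)"
      using forget_append_le_right[of "take n u" "drop n u"] by simp
  qed simp
  then show ?thesis
    using sum_words_drop[OF assms, where f = "\<lambda>w. ennreal (forget w)" and n = n and k = k]
    by (simp add: memory_def)
qed

text \<open>After many steps the chain with initial law \<open>x\<close> produces observations nearly like the stationary
  one, and what it produced before can only have decreased \<open>forget\<close>.\<close>

lemma limsup_memory_le:
  assumes x: "x \<in> finite_borel_measures" "prob_space x"
  shows "limsup (\<lambda>j. memory j x) \<le> (INF k. memory k mu)"
proof (rule INF_greatest)
  fix k
  have "limsup (\<lambda>j. memory j x) = limsup (\<lambda>n. memory (n + k) x)"
    using limsup_shift_k[of "\<lambda>j. memory j x" k] by simp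
  also have "\<dots> \<le> limsup (\<lambda>n. memory k mu + ennreal (tv_dist (push n x) mu))"
  proof (rule Limsup_mono[OF always_eventually], rule allI)
    fix n
    have "memory (n + k) x \<le> memory k (push n x)" by (rule memory_append_le[OF x])
    also have "\<dots> \<le> memory k mu + ennreal (tv_dist (push n x) mu)"
      unfolding memory_def
      by (rule sum_words_le_add_tv_dist[OF push_props(2)[OF x] mu_finite_borel])
         (simp add: forget_bounds ennreal_le_1)
    finally show "memory (n + k) x \<le> memory k mu + ennreal (tv_dist (push n x) mu)" .
  qed
  also have "\<dots> = memory k mu"
  proof (rule lim_imp_Limsup)
    show "(\<lambda>n. memory k mu + ennreal (tv_dist (push n x) mu)) \<longlonglongrightarrow> memory k mu"
      using tendsto_add[OF tendsto_const[of "memory k mu"] tendsto_ennrealI[OF tv_dist_push_mu[OF x]]]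
      by simp
  qed simp
  finally show "limsup (\<lambda>j. memory j x) \<le> memory k mu" .
qed

text \<open>The stationary chain is in \<open>S a0\<close> with positive probability, and from there it moves within
  \<open>S a0\<close> with probability at least \<open>d * emeasure lam (S a0)\<close>.\<close>

lemma weight_a0_a0_pos: "0 < weight mu [a0, a0]"
proof -
  let ?q = "ennreal d * emeasure lam (S a0)"
  have U: "UNIV \<in> sets (borel :: 's measure)" by simp
  have tr: "transition \<in> mu \<rightarrow>\<^sub>M subprob_algebra borel"
    using measurable_prob_algebraD[OF measurable_transition] by measurable
  have 1: "?q * indicator (S a0) s \<le> word_kernel [a0] UNIV s" for s
  proof (cases "s \<in> S a0")
    case True
    have "?q = (\<integral>\<^sup>+ t. ennreal d * indicator (S a0) t \<partial>lam)"
      by (simp add: nn_integral_cmult_indicator sets_lam)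
    also have "\<dots> \<le> (\<integral>\<^sup>+ t. ennreal (m s t a0) \<partial>lam)"
      using m_between[OF True] by (intro nn_integral_mono) (auto simp: indicator_def intro!: ennreal_leI)
    finally show ?thesis using True by simp
  qed simp
  have 2: "?q * emeasure (transition s) (S a0) \<le> word_kernel [a0, a0] UNIV s" for s
  proof -
    have "emeasure (transition s) (S a0) = (\<integral>\<^sup>+ t. ennreal (m s t a0) \<partial>lam)"
      unfolding hidden_kernel_def m_eq by (rule emeasure_density) (auto simp: sets_lam)
    also have "\<dots> = (\<integral>\<^sup>+ t. ennreal (m s t a0) * indicator (S a0) t \<partial>lam)"
      by (intro nn_integral_cong) (simp add: m_eq indicator_def)
    finally have "?q * emeasure (transition s) (S a0) =
        (\<integral>\<^sup>+ t. ?q * (ennreal (m s t a0) * indicator (S a0) t) \<partial>lam)"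
      by (simp add: nn_integral_cmult sets_lam)
    also have "\<dots> \<le> (\<integral>\<^sup>+ t. ennreal (m s t a0) * word_kernel [a0] UNIV t \<partial>lam)"
      using 1 by (intro nn_integral_mono) (simp add: mult.left_commute[of ?q] mult_left_mono del: word_kernel.simps)
    finally show ?thesis by (simp add: word_kernel.simps(2)[of a0 "[a0]"] del: word_kernel.simps)
  qed
  have "?q * emeasure mu (S a0) = ?q * (\<integral>\<^sup>+ s. emeasure (transition s) (S a0) \<partial>mu)"
    using emeasure_bind[OF _ tr, of "S a0"] by (simp add: mu_stationary space_mu)
  also have "\<dots> = (\<integral>\<^sup>+ s. ?q * emeasure (transition s) (S a0) \<partial>mu)"
    by (rule nn_integral_cmult[symmetric], rule measurable_compose[OF tr]) simp
  also have "\<dots> \<le> weight mu [a0, a0]"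
    unfolding emeasure_steps[OF mu_finite_borel U] by (intro nn_integral_mono 2)
  finally have "?q * emeasure mu (S a0) \<le> weight mu [a0, a0]" .
  moreover have "0 < ?q * emeasure mu (S a0)"
    using d_pos S_a0_pos mu_S_a0_pos by (simp add: ennreal_zero_less_mult_iff)
  ultimately show ?thesis by (rule order_less_le_trans[rotated])
qed

lemma memory_2_less_1: "memory 2 mu < 1"
proof -
  have "memory 2 mu + (\<integral>\<^sup>+ w. ennreal (1 - forget w) * weight mu w \<partial>count_space (words 2)) =
      (\<integral>\<^sup>+ w. ennreal (forget w) * weight mu w + ennreal (1 - forget w) * weight mu w \<partial>count_space (words 2))"
    unfolding memory_def by (rule nn_integral_add[symmetric]) auto
  also have "\<dots> = (\<integral>\<^sup>+ w. weight mu w \<partial>count_space (words 2))"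
    using forget_bounds by (intro nn_integral_cong) (simp flip: distrib_right ennreal_plus)
  finally have sum: "memory 2 mu + (\<integral>\<^sup>+ w. ennreal (1 - forget w) * weight mu w \<partial>count_space (words 2)) = 1"
    using sum_words_mass[OF mu_finite_borel prob_space_mu] by simp
  have "0 < ennreal (1 - forget [a0, a0]) * weight mu [a0, a0]"
    using weight_a0_a0_pos d_pos d_le_D by (simp add: ennreal_zero_less_mult_iff del: foldl.simps)
  also have "\<dots> \<le> (\<integral>\<^sup>+ w. ennreal (1 - forget w) * weight mu w \<partial>count_space (words 2))"
    by (rule nn_integral_ge_point) simp
  finally have pos: "0 < (\<integral>\<^sup>+ w. ennreal (1 - forget w) * weight mu w \<partial>count_space (words 2))" .
  show ?thesis
  proof (rule ccontr)
    assume "\<not> memory 2 mu < 1"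
    then have "memory 2 mu = 1"
      using memory_le_1[OF mu_finite_borel prob_space_mu, of 2] by (intro antisym) (auto simp: not_less)
    then have "1 + (\<integral>\<^sup>+ w. ennreal (1 - forget w) * weight mu w \<partial>count_space (words 2)) = 1 + (0 :: ennreal)"
      using sum by simp
    then show False using pos unfolding ennreal_add_left_cancel by simp
  qed
qed

text \<open>Let \<open>v\<close> be the limit. Given the first two observations \<open>u\<close>, the chain continues from the law
  \<open>filt mu u\<close>, whose memory is in the limit at most \<open>v\<close>, while \<open>u\<close> contributes a factor
  \<open>forget u\<close>. Averaging over \<open>u\<close> gives \<open>v \<le> memory 2 mu * v\<close> with \<open>memory 2 mu < 1\<close>.\<close>

lemma memory_mu_tendsto_0: "(\<lambda>n. memory n mu) \<longlonglongrightarrow> 0"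
proof -
  define v where "v = (INF k. memory k mu)"
  have "decseq (\<lambda>n. memory n mu)"
    using memory_append_le[OF mu_finite_borel prob_space_mu, of "Suc 0"] by (intro decseq_SucI) simp
  then have lim: "(\<lambda>n. memory n mu) \<longlonglongrightarrow> v"
    unfolding v_def by (rule LIMSEQ_INF)
  have v1: "v \<le> 1"
    unfolding v_def using memory_le_1[OF mu_finite_borel prob_space_mu] by (intro INF_lower2[of 0]) auto
  let ?M = "density (count_space (words 2)) (\<lambda>u. ennreal (forget u) * weight mu u)"
  have split: "memory (2 + j) mu \<le> (\<integral>\<^sup>+ u. memory j (filt mu u) \<partial>?M)" for j
  proof -
    have "memory (2 + j) mu = (\<integral>\<^sup>+ u. (\<integral>\<^sup>+ w. ennreal (forget (u @ w)) * weight mu (u @ w)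
        \<partial>count_space (words j)) \<partial>count_space (words 2))"
      unfolding memory_def by (rule nn_integral_words_append)
    also have "\<dots> \<le> (\<integral>\<^sup>+ u. (ennreal (forget u) * weight mu u) * memory j (filt mu u) \<partial>count_space (words 2))"
    proof (rule nn_integral_mono)
      fix u
      show "(\<integral>\<^sup>+ w. ennreal (forget (u @ w)) * weight mu (u @ w) \<partial>count_space (words j))
          \<le> (ennreal (forget u) * weight mu u) * memory j (filt mu u)"
      proof (cases "0 < weight mu u")
        case True
        have "(\<integral>\<^sup>+ w. ennreal (forget (u @ w)) * weight mu (u @ w) \<partial>count_space (words j))
          \<le> (\<integral>\<^sup>+ w. (ennreal (forget u) * weight mu u) * (ennreal (forget w) * weight (filt mu u) w)
              \<partial>count_space (words j))"
        proof (rule nn_integral_mono)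
          fix w
          have "ennreal (forget (u @ w)) * weight mu (u @ w) \<le>
              ennreal (forget u * forget w) * weight mu (u @ w)"
            by (intro mult_right_mono ennreal_leI forget_append_le) simp
          then show "ennreal (forget (u @ w)) * weight mu (u @ w) \<le>
              (ennreal (forget u) * weight mu u) * (ennreal (forget w) * weight (filt mu u) w)"
            using emeasure_steps_filt[OF mu_in_density_probs True, of UNIV w, symmetric] forget_nonneg
            by (simp add: ennreal_mult ac_simps del: foldl_append)
        qed
        then show ?thesis unfolding memory_def by (simp add: nn_integral_cmult)
      next
        case False
        have "weight mu (u @ w) = 0" for w
        proof -
          note su = steps_in_finite_borel[OF mu_finite_borel, of u]
          have "weight mu (u @ w) = (\<integral>\<^sup>+ s. word_kernel w UNIV s \<partial>steps mu u)"
            by (simp add: emeasure_steps[OF su])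
          also have "\<dots> \<le> (\<integral>\<^sup>+ s. 1 \<partial>steps mu u)"
            by (intro nn_integral_mono word_kernel_le_1)
          also have "\<dots> = 0" using False finite_borel_measuresD(2)[OF su] by simp
          finally show ?thesis by simp
        qed
        then show ?thesis by simp
      qed
    qed
    also have "\<dots> = (\<integral>\<^sup>+ u. memory j (filt mu u) \<partial>?M)"
      by (subst nn_integral_density) auto
    finally show ?thesis .
  qed
  have "v = limsup (\<lambda>j. memory j mu)"
    using lim_imp_Limsup[OF _ lim] by simp
  also have "\<dots> = limsup (\<lambda>j. memory (j + 2) mu)"
    using limsup_shift_k[of "\<lambda>j. memory j mu" 2] by simp
  also have "\<dots> \<le> limsup (\<lambda>j. (\<integral>\<^sup>+ u. memory j (filt mu u) \<partial>?M))"
    by (intro Limsup_mono always_eventually allI) (use split in \<open>simp add: add.commute\<close>)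
  also have "\<dots> \<le> (\<integral>\<^sup>+ u. limsup (\<lambda>j. memory j (filt mu u)) \<partial>?M)"
  proof (rule nn_integral_limsup[where w = "\<lambda>_. 1"])
    show "AE u in ?M. memory j (filt mu u) \<le> 1" for j
      using memory_le_1 density_probsD[OF filt_in_density_probs[OF mu_in_density_probs]] by auto
    have "(\<integral>\<^sup>+ u. 1 \<partial>?M) = memory 2 mu"
      unfolding memory_def by (subst nn_integral_density) auto
    then show "(\<integral>\<^sup>+ u. 1 \<partial>?M) < \<infinity>" using memory_2_less_1 by (simp add: less_trans[of _ 1])
  qed auto
  also have "\<dots> \<le> (\<integral>\<^sup>+ u. v \<partial>?M)"
    unfolding v_def
    by (intro nn_integral_mono limsup_memory_le)
       (use density_probsD[OF filt_in_density_probs[OF mu_in_density_probs]] in auto)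
  also have "\<dots> = memory 2 mu * v"
    unfolding memory_def by (subst nn_integral_density) (auto simp: nn_integral_multc)
  finally have "v \<le> memory 2 mu * v" .
  moreover have "v \<noteq> \<top>" using v1 by (auto simp: top_unique)
  then have "memory 2 mu * v < v" if "v \<noteq> 0"
    using ennreal_mult_strict_right_mono[OF memory_2_less_1, of v] that
    by (auto simp: less_top[symmetric] top_unique zero_less_iff_neq_zero)
  ultimately have "v = 0" by force
  then show ?thesis using lim by simp
qed

end

section \<open>The space of densities\<close>

lemma openin_density_probs_iff:
  "openin (mtopology_of (density_probs_metric lam)) U \<longleftrightarrow>
     U \<subseteq> density_probs lam \<and>
     (\<forall>x \<in> U. \<exists>r > 0. \<forall>y \<in> density_probs lam. tv_dist x y < r \<longrightarrow> y \<in> U)"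
proof -
  let ?X = "density_probs_metric lam"
  interpret Metric_space "mspace ?X" "mdist ?X" by (rule Metric_space_mspace_mdist)
  define B where "B x r = mball x r" for x r
  have B: "y \<in> B x r \<longleftrightarrow> y \<in> density_probs lam \<and> tv_dist x y < r"
    if "x \<in> density_probs lam" for x y r
    unfolding B_def mball_def using that by (auto simp: mdist_density_probs_metric)
  have "openin (mtopology_of ?X) U \<longleftrightarrow> U \<subseteq> density_probs lam \<and> (\<forall>x \<in> U. \<exists>r > 0. B x r \<subseteq> U)"
    unfolding mtopology_of_def openin_mtopology B_def by (auto simp: Ball_def)
  also have "\<dots> \<longleftrightarrow> U \<subseteq> density_probs lam \<and>
     (\<forall>x \<in> U. \<exists>r > 0. \<forall>y \<in> density_probs lam. tv_dist x y < r \<longrightarrow> y \<in> U)"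
    by (intro conj_cong refl ball_cong ex_cong) (auto simp: subset_iff B)
  finally show ?thesis .
qed

abbreviation density_borel :: "'s::topological_space measure \<Rightarrow> 's measure measure" where
  "density_borel lam \<equiv> borel_of_metric (density_probs_metric lam)"

lemma space_density_borel: "space (density_borel lam) = density_probs lam"
  by (simp add: space_borel_of_metric)

lemma openin_in_sets_density_borel:
  "openin (mtopology_of (density_probs_metric lam)) U \<Longrightarrow> U \<in> sets (density_borel lam)"
  by (auto simp: sets_borel_of_metric)

lemma borel_measurable_density_borelI:
  fixes u :: "'s::topological_space measure \<Rightarrow> real"
  assumes "\<And>x e. x \<in> density_probs lam \<Longrightarrow> 0 < e \<Longrightarrow>
    \<exists>r > 0. \<forall>y \<in> density_probs lam. tv_dist x y < r \<longrightarrow> \<bar>u y - u x\<bar> < e"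
  shows "u \<in> borel_measurable (density_borel lam)"
proof (rule borel_measurableI)
  fix G :: "real set" assume G: "open G"
  show "u -` G \<inter> space (density_borel lam) \<in> sets (density_borel lam)"
    unfolding space_density_borel
  proof (rule openin_in_sets_density_borel, unfold openin_density_probs_iff, intro conjI ballI)
    fix x assume x: "x \<in> u -` G \<inter> density_probs lam"
    then obtain e where e: "e > 0" "ball (u x) e \<subseteq> G" using G by (auto simp: open_contains_ball)
    obtain r where "r > 0" "\<forall>y \<in> density_probs lam. tv_dist x y < r \<longrightarrow> \<bar>u y - u x\<bar> < e"
      using assms[OF _ e(1), of x] x by auto
    then show "\<exists>r > 0. \<forall>y \<in> density_probs lam. tv_dist x y < r \<longrightarrow> y \<in> u -` G \<inter> density_probs lam"
      using e(2) by (intro exI[of _ r]) (auto simp: dist_real_def subset_iff abs_minus_commute)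
  qed auto
qed

lemma continuous_map_density_probsD:
  assumes u: "continuous_map (mtopology_of (density_probs_metric lam)) euclideanreal u"
    and x: "x \<in> density_probs lam" and e: "0 < (e :: real)"
  shows "\<exists>r > 0. \<forall>y \<in> density_probs lam. tv_dist x y < r \<longrightarrow> \<bar>u y - u x\<bar> < e"
proof -
  have "openin (mtopology_of (density_probs_metric lam))
      {y \<in> topspace (mtopology_of (density_probs_metric lam)). u y \<in> ball (u x) e}"
    by (rule openin_continuous_map_preimage[OF u]) simp
  then have "\<exists>r > 0. \<forall>y \<in> density_probs lam. tv_dist x y < r \<longrightarrow> u y \<in> ball (u x) e"
    using x e unfolding openin_density_probs_iff by auto
  then show ?thesis by (auto simp: dist_real_def abs_minus_commute)
qed

lemma borel_measurable_Lipschitz: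
  fixes u :: "'s::topological_space measure \<Rightarrow> real"
  assumes "\<And>x y. x \<in> density_probs lam \<Longrightarrow> y \<in> density_probs lam \<Longrightarrow> \<bar>u x - u y\<bar> \<le> tv_dist x y"
  shows "u \<in> borel_measurable (density_borel lam)"
proof (rule borel_measurable_density_borelI)
  fix x and e :: real assume x: "x \<in> density_probs lam" and e: "0 < e"
  have "\<bar>u y - u x\<bar> < e" if "y \<in> density_probs lam" "tv_dist x y < e" for y
    using assms[OF x that(1)] that(2) by linarith
  then show "\<exists>r > 0. \<forall>y \<in> density_probs lam. tv_dist x y < r \<longrightarrow> \<bar>u y - u x\<bar> < e"
    using e by blast
qed

lemma tv_dist_density_probs_le_2:
  assumes "x \<in> density_probs lam" "y \<in> density_probs lam"
  shows "tv_dist x y \<le> 2"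
proof -
  interpret x: prob_space x using density_probsD[OF assms(1)] by simp
  interpret y: prob_space y using density_probsD[OF assms(2)] by simp
  have "tv_dist x y \<le> 2 * 1"
    by (rule tv_dist_leI) (smt (verit) x.prob_le_1 y.prob_le_1 measure_nonneg)+
  then show ?thesis by simp
qed

lemma Lip1_densityD:
  assumes u: "u \<in> Lip1 (density_probs_metric lam)" and x: "x \<in> density_probs lam" "y \<in> density_probs lam"
  shows "\<bar>u x - u y\<bar> \<le> tv_dist x y"
  using assms by (auto simp: Lip1_def mdist_density_probs_metric[OF x, symmetric])

lemma Lip1_measurable:
  assumes "u \<in> Lip1 (density_probs_metric lam)"
  shows "u \<in> borel_measurable (density_borel lam)"
  by (rule borel_measurable_Lipschitz[OF Lip1_densityD[OF assms]])

section \<open>The powers of the filter kernel\<close>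

context denumerable_obs_hmm
begin

lemma weight_append_le:
  assumes "x \<in> finite_borel_measures"
  shows "weight x (v @ w) \<le> weight x v"
proof -
  note sv = steps_in_finite_borel[OF assms, of v]
  have "weight x (v @ w) = (\<integral>\<^sup>+ s. word_kernel w UNIV s \<partial>steps x v)"
    by (simp add: emeasure_steps[OF sv])
  also have "\<dots> \<le> (\<integral>\<^sup>+ s. 1 \<partial>steps x v)"
    by (intro nn_integral_mono word_kernel_le_1)
  finally show ?thesis using finite_borel_measuresD(2)[OF sv] by simp
qed

lemma weight_filt:
  assumes x: "x \<in> density_probs lam" "0 < weight x (v @ w)"
  shows "0 < weight x v" "0 < weight (filt x v) w"
proof -
  show v: "0 < weight x v"
    by (rule less_le_trans[OF x(2) weight_append_le[OF density_probsD(1)[OF x(1)]]])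
  show "0 < weight (filt x v) w"
    using emeasure_steps_filt[OF x(1) v, of UNIV w] x(2)
    by (auto simp: zero_less_iff_neq_zero simp del: foldl_append)
qed

lemma filt_append:
  assumes x: "x \<in> density_probs lam" "0 < weight x (v @ w)"
  shows "filt (filt x v) w = filt x (v @ w)"
proof (rule measure_eqI)
  note v = weight_filt[OF x]
  note fv = filt_in_density_probs[OF x(1), of v]
  show "sets (filt (filt x v) w) = sets (filt x (v @ w))"
    using density_probsD(3)[OF filt_in_density_probs[OF fv]]
      density_probsD(3)[OF filt_in_density_probs[OF x(1)]] by simp
  fix F assume "F \<in> sets (filt (filt x v) w)"
  then have F: "F \<in> sets borel" using density_probsD(3)[OF filt_in_density_probs[OF fv]] by simp
  have fin: "weight x v < \<top>" by (rule weight_finite[OF density_probsD(1)[OF x(1)]])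
  have "emeasure (filt x (v @ w)) F =
      (weight x v * emeasure (steps (filt x v) w) F) / (weight x v * weight (filt x v) w)"
    unfolding emeasure_filt[OF density_probsD(1)[OF x(1)] x(2)]
    using emeasure_steps_filt[OF x(1) v(1) F, of w] emeasure_steps_filt[OF x(1) v(1), of UNIV w] by simp
  also have "\<dots> = (weight x v * inverse (weight x v)) *
      (emeasure (steps (filt x v) w) F / weight (filt x v) w)"
    using fin weight_finite[OF density_probsD(1)[OF fv], of w]
    by (simp add: divide_ennreal_def ennreal_inverse_mult ac_simps)
  also have "weight x v * inverse (weight x v) = 1"
    using v(1) fin by (simp add: divide_ennreal_def[symmetric] ennreal_divide_self)
  finally show "emeasure (filt (filt x v) w) F = emeasure (filt x (v @ w)) F"
    by (simp add: emeasure_filt[OF density_probsD(1)[OF fv] v(2)] del: foldl_append)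
qed

lemma filt_Nil:
  assumes x: "x \<in> density_probs lam"
  shows "filt x [] = x"
proof (rule measure_eqI)
  interpret prob_space x using density_probsD[OF x] by simp
  have w: "weight x [] = 1" using emeasure_space_1 density_probsD[OF x] by simp
  show "sets (filt x []) = sets x"
    using density_probsD(3)[OF filt_in_density_probs[OF x]] density_probsD[OF x] by simp
  fix F
  show "emeasure (filt x []) F = emeasure x F"
    using emeasure_filt[OF density_probsD(1)[OF x], of "[]"] w
      ennreal_mult_divide_eq[of 1 "emeasure x F"] by simp
qed

lemma steps_Lipschitz:
  assumes x: "x \<in> finite_borel_measures" and y: "y \<in> finite_borel_measures" and F: "F \<in> sets borel"
  shows "\<bar>measure (steps x w) F - measure (steps y w) F\<bar> \<le> tv_dist x y"
proof -
  have le: "measure (steps z w) F \<le> measure (steps z' w) F + tv_dist z z'"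
    if z: "z \<in> finite_borel_measures" "z' \<in> finite_borel_measures" for z z'
  proof -
    interpret z: finite_measure "steps z w"
      using finite_borel_measuresD[OF steps_in_finite_borel[OF z(1)]] by simp
    interpret z': finite_measure "steps z' w"
      using finite_borel_measuresD[OF steps_in_finite_borel[OF z(2)]] by simp
    have "emeasure (steps z w) F \<le> emeasure (steps z' w) F + ennreal (tv_dist z z')"
      unfolding emeasure_steps[OF z(1) F] emeasure_steps[OF z(2) F]
      by (rule nn_integral_le_add_tv_dist[OF z measurable_word_kernel[OF F] word_kernel_le_1])
    then show ?thesis
      using tv_dist_nonneg[OF z]
      by (simp add: z.emeasure_eq_measure z'.emeasure_eq_measure flip: ennreal_plus)
  qed
  show ?thesis using le[OF x y] le[OF y x] tv_dist_commute[of x y] by linarith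
qed

lemma measurable_weight: "(\<lambda>x. weight x w) \<in> borel_measurable (density_borel lam)"
proof -
  have "(\<lambda>x. measure (steps x w) UNIV) \<in> borel_measurable (density_borel lam)"
    by (rule borel_measurable_Lipschitz) (intro steps_Lipschitz density_probsD(1), auto)
  then have "(\<lambda>x. ennreal (measure (steps x w) UNIV)) \<in> borel_measurable (density_borel lam)"
    by simp
  moreover have "weight x w = ennreal (measure (steps x w) UNIV)" if "x \<in> density_probs lam" for x
    using finite_measure.emeasure_eq_measure
      finite_borel_measuresD(3)[OF steps_in_finite_borel[OF density_probsD(1)[OF that]]] by blast
  ultimately show ?thesis
    by (subst measurable_cong[where g = "\<lambda>x. ennreal (measure (steps x w) UNIV)"])
       (auto simp: space_density_borel)
qed

lemma tv_dist_filt_Lipschitz: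
  assumes x: "x \<in> density_probs lam" "0 < weight x w" and y: "y \<in> density_probs lam" "0 < weight y w"
  shows "tv_dist (filt x w) (filt y w) \<le> 4 / measure (steps x w) UNIV * tv_dist x y"
proof -
  note xf = density_probsD(1)[OF x(1)] and yf = density_probsD(1)[OF y(1)]
  interpret x: finite_measure "steps x w"
    using finite_borel_measuresD[OF steps_in_finite_borel[OF xf]] by simp
  interpret y: finite_measure "steps y w"
    using finite_borel_measuresD[OF steps_in_finite_borel[OF yf]] by simp
  define b b' where "b = measure (steps x w) UNIV" and "b' = measure (steps y w) UNIV"
  have b: "0 < b" "0 < b'"
    using x(2) y(2) by (auto simp: b_def b'_def x.emeasure_eq_measure y.emeasure_eq_measure)
  have mf: "measure (filt x w) F = measure (steps x w) F / b" "measure (filt y w) F = measure (steps y w) F / b'" for F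
    unfolding measure_def[of "filt x w"] measure_def[of "filt y w"]
      emeasure_filt[OF xf x(2)] emeasure_filt[OF yf y(2)]
    using b by (simp_all add: x.emeasure_eq_measure y.emeasure_eq_measure b_def b'_def divide_ennreal)
  have main: "\<bar>measure (filt x w) F - measure (filt y w) F\<bar> \<le> 2 / b * tv_dist x y" if F: "F \<in> sets borel" for F
  proof -
    let ?a = "measure (steps x w) F" and ?a' = "measure (steps y w) F"
    have a': "0 \<le> ?a'" "?a' \<le> b'"
      using y.finite_measure_mono[of F UNIV] finite_borel_measuresD[OF steps_in_finite_borel[OF yf]]
      by (auto simp: b'_def)
    have "?a / b - ?a' / b' = (?a - ?a') / b + (?a' / b') * ((b' - b) / b)"
      using b by (simp add: field_simps)
    then have "\<bar>?a / b - ?a' / b'\<bar> \<le> \<bar>(?a - ?a') / b\<bar> + \<bar>(?a' / b') * ((b' - b) / b)\<bar>"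
      by (simp only: abs_triangle_ineq)
    also have "\<bar>(?a' / b') * ((b' - b) / b)\<bar> \<le> 1 * \<bar>(b' - b) / b\<bar>"
      unfolding abs_mult using a' b by (intro mult_right_mono) auto
    also have "\<bar>(?a - ?a') / b\<bar> + 1 * \<bar>(b' - b) / b\<bar> \<le> tv_dist x y / b + tv_dist x y / b"
      using steps_Lipschitz[OF xf yf F, of w] steps_Lipschitz[OF xf yf, of UNIV w] b
      by (intro add_mono) (auto simp: abs_divide b_def b'_def abs_minus_commute intro!: divide_right_mono)
    finally show ?thesis by (simp add: mf)
  qed
  have "tv_dist (filt x w) (filt y w) \<le> 2 * (2 / b * tv_dist x y)"
    by (rule tv_dist_leI) (use main in \<open>force simp: abs_le_iff\<close>)+
  then show ?thesis by (simp add: b_def)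
qed

text \<open>On the open set where the word has positive weight the filter is continuous by
  \<open>tv_dist_filt_Lipschitz\<close>; on its complement \<open>filt x w = x\<close>.\<close>

lemma measurable_filt: "(\<lambda>x. filt x w) \<in> density_borel lam \<rightarrow>\<^sub>M density_borel lam"
proof (rule measurable_sigma_sets[OF sets_borel_of_metric])
  show "{U. openin (mtopology_of (density_probs_metric lam)) U} \<subseteq> Pow (mspace (density_probs_metric lam))"
    by (auto dest!: openin_subset)
  show "(\<lambda>x. filt x w) \<in> space (density_borel lam) \<rightarrow> mspace (density_probs_metric lam)"
    by (auto simp: space_density_borel filt_in_density_probs)
  fix U assume "U \<in> {U. openin (mtopology_of (density_probs_metric lam)) U}"
  then have U: "openin (mtopology_of (density_probs_metric lam)) U" by simp
  have "openin (mtopology_of (density_probs_metric lam))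
      {x \<in> density_probs lam. 0 < weight x w \<and> filt x w \<in> U}"
    unfolding openin_density_probs_iff
  proof (intro conjI ballI)
    fix x assume "x \<in> {x \<in> density_probs lam. 0 < weight x w \<and> filt x w \<in> U}"
    then have x: "x \<in> density_probs lam" "0 < weight x w" "filt x w \<in> U" by auto
    note xf = density_probsD(1)[OF x(1)]
    interpret x: finite_measure "steps x w"
      using finite_borel_measuresD[OF steps_in_finite_borel[OF xf]] by simp
    obtain r where r: "r > 0" "\<forall>y \<in> density_probs lam. tv_dist (filt x w) y < r \<longrightarrow> y \<in> U"
      using U x(3) unfolding openin_density_probs_iff by auto
    define b where "b = measure (steps x w) UNIV"
    have b: "0 < b" using x(2) by (simp add: b_def x.emeasure_eq_measure)
    show "\<exists>r > 0. \<forall>y \<in> density_probs lam. tv_dist x y < r \<longrightarrow>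
        y \<in> {x \<in> density_probs lam. 0 < weight x w \<and> filt x w \<in> U}"
    proof (intro exI[of _ "min b (r * b / 4)"] conjI ballI impI)
      show "0 < min b (r * b / 4)" using b r by simp
      fix y assume y: "y \<in> density_probs lam" "tv_dist x y < min b (r * b / 4)"
      interpret y: finite_measure "steps y w"
        using finite_borel_measuresD[OF steps_in_finite_borel[OF density_probsD(1)[OF y(1)]]] by simp
      have "\<bar>b - measure (steps y w) UNIV\<bar> \<le> tv_dist x y"
        unfolding b_def by (rule steps_Lipschitz[OF xf density_probsD(1)[OF y(1)]]) simp
      then have "0 < measure (steps y w) UNIV" using y(2) by linarith
      then have wy: "0 < weight y w" by (simp add: y.emeasure_eq_measure)
      have "tv_dist (filt x w) (filt y w) \<le> 4 / b * tv_dist x y"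
        unfolding b_def by (rule tv_dist_filt_Lipschitz[OF x(1,2) y(1) wy])
      also have "\<dots> < r" using y(2) b by (simp add: field_simps)
      finally show "y \<in> {x \<in> density_probs lam. 0 < weight x w \<and> filt x w \<in> U}"
        using r(2) filt_in_density_probs[OF y(1)] y(1) wy by auto
    qed
  qed auto
  then have "{x \<in> density_probs lam. 0 < weight x w \<and> filt x w \<in> U} \<in> sets (density_borel lam)"
    by (rule openin_in_sets_density_borel)
  moreover have "{x \<in> space (density_borel lam). weight x w = 0} \<inter> U \<in> sets (density_borel lam)"
    using measurable_weight[of w] openin_in_sets_density_borel[OF U] by measurable
  moreover have "(\<lambda>x. filt x w) -` U \<inter> space (density_borel lam) =
      {x \<in> density_probs lam. 0 < weight x w \<and> filt x w \<in> U} \<union>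
      {x \<in> space (density_borel lam). weight x w = 0} \<inter> U"
    using openin_subset[OF U] by (auto simp: space_density_borel filt_def zero_less_iff_neq_zero)
  ultimately show "(\<lambda>x. filt x w) -` U \<inter> space (density_borel lam) \<in> sets (density_borel lam)"
    by auto
qed

text \<open>The law of the first \<open>n\<close> observations when the hidden state starts with the law \<open>x\<close>.\<close>

definition word_pmf :: "'s measure \<Rightarrow> nat \<Rightarrow> 'a list pmf" where
  "word_pmf x n = embed_pmf (\<lambda>w. if length w = n then measure (steps x w) UNIV else 0)"

context
  fixes x :: "'s measure"
  assumes x: "x \<in> finite_borel_measures" "prob_space x"
begin

lemma weight_eq_measure: "weight x w = ennreal (measure (steps x w) UNIV)"
  using finite_measure.emeasure_eq_measure
    finite_borel_measuresD(3)[OF steps_in_finite_borel[OF x(1)]] by blast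

lemma pmf_word_pmf: "pmf (word_pmf x n) w = (if length w = n then measure (steps x w) UNIV else 0)"
  unfolding word_pmf_def
proof (rule pmf_embed_pmf)
  have "(\<integral>\<^sup>+ w. ennreal (if length w = n then measure (steps x w) UNIV else 0) \<partial>count_space UNIV) =
      (\<integral>\<^sup>+ w. weight x w * indicator (words n) w \<partial>count_space UNIV)"
    by (intro nn_integral_cong) (simp add: weight_eq_measure indicator_def)
  also have "\<dots> = 1"
    using sum_words_mass[OF x, of n] by (simp add: nn_integral_count_space_indicator)
  finally show "(\<integral>\<^sup>+ w. ennreal (if length w = n then measure (steps x w) UNIV else 0) \<partial>count_space UNIV) = 1" .
qed simp

lemma nn_integral_word_pmf:
  "(\<integral>\<^sup>+ w. f w \<partial>measure_pmf (word_pmf x n)) = (\<integral>\<^sup>+ w. f w * weight x w \<partial>count_space (words n))"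
  unfolding nn_integral_measure_pmf pmf_word_pmf
  by (subst (2) nn_integral_count_space_indicator, simp)
     (auto intro!: nn_integral_cong simp: weight_eq_measure indicator_def mult.commute)

lemma set_word_pmf: "set_pmf (word_pmf x n) = {w. length w = n \<and> 0 < weight x w}"
  by (auto simp: set_pmf_iff pmf_word_pmf weight_eq_measure measure_nonneg order_less_le split: if_splits)

end

lemma map_drop_word_pmf:
  assumes x: "x \<in> finite_borel_measures" "prob_space x"
  shows "map_pmf (drop n) (word_pmf x (n + k)) = word_pmf (push n x) k"
proof (rule pmf_eqI)
  fix w
  let ?p = "map_pmf (drop n) (word_pmf x (n + k))"
  have "ennreal (pmf ?p w) = (\<integral>\<^sup>+ u. indicator {w} (drop n u) \<partial>measure_pmf (word_pmf x (n + k)))"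
    by (subst emeasure_pmf_single[symmetric], subst nn_integral_indicator[symmetric])
       (simp_all del: nn_integral_indicator)
  also have "\<dots> = (\<integral>\<^sup>+ v. indicator {w} v * weight (push n x) v \<partial>count_space (words k))"
    unfolding nn_integral_word_pmf[OF x] using sum_words_drop[OF x, where f = "indicator {w}"] by simp
  also have "\<dots> = (\<integral>\<^sup>+ v. indicator {w} v \<partial>measure_pmf (word_pmf (push n x) k))"
    by (rule nn_integral_word_pmf[OF push_props(2,1)[OF x], symmetric])
  also have "\<dots> = ennreal (pmf (word_pmf (push n x) k) w)"
    by (simp add: emeasure_pmf_single)
  finally show "pmf ?p w = pmf (word_pmf (push n x) k) w" by simp
qed


abbreviation filter_pow :: "nat \<Rightarrow> 's measure \<Rightarrow> 's measure measure" where
  "filter_pow \<equiv> kernel_pow (density_borel lam) (filter_kernel lam tau m)"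

lemma filt_word_pmf_measurable:
  assumes "x \<in> density_probs lam"
  shows "filt x \<in> measure_pmf p \<rightarrow>\<^sub>M density_borel lam"
  using filt_in_density_probs[OF assms] by (auto simp: measurable_def space_density_borel)

lemma emeasure_distr_filt:
  assumes x: "x \<in> density_probs lam" and E: "E \<in> sets (density_borel lam)"
  shows "emeasure (distr (measure_pmf p) (density_borel lam) (filt x)) E =
    (\<integral>\<^sup>+ w. indicator E (filt x w) \<partial>measure_pmf p)"
  using E by (subst emeasure_distr[OF filt_word_pmf_measurable[OF x]])
    (auto simp: nn_integral_indicator[symmetric] indicator_vimage[symmetric] simp del: nn_integral_indicator
      intro!: nn_integral_cong split: split_indicator)

text \<open>The observation probabilities \<open>weight x [a]\<close> vanish outside the domain of integration that
  \<^const>\<open>filter_kernel\<close> prescribes.\<close>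

lemma emeasure_filter_kernel_words:
  assumes x: "x \<in> density_probs lam" and E: "E \<in> sets (density_borel lam)"
  shows "emeasure (filter_kernel lam tau m x) E =
    (\<integral>\<^sup>+ a. indicator E (filt x [a]) * weight x [a] \<partial>count_space UNIV)"
  by (subst emeasure_filter_kernel[OF countable_obs E], subst tau_eq, rule nn_integral_cong)
     (auto simp: indicator_def filt_def zero_less_iff_neq_zero)

lemma sets_filter_kernel [simp]: "sets (filter_kernel lam tau m x) = sets (density_borel lam)"
  unfolding filter_kernel_def
  using sets.sigma_sets_eq[of "density_borel lam"] sets.sets_into_space[of _ "density_borel lam"]
  by (subst sets_measure_of) (auto simp: space_density_borel)

lemma filter_kernel_eq_distr:
  assumes x: "x \<in> density_probs lam"
  shows "filter_kernel lam tau m x = distr (measure_pmf (word_pmf x (Suc 0))) (density_borel lam) (filt x)"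
proof (rule measure_eqI)
  fix E assume "E \<in> sets (filter_kernel lam tau m x)"
  then have E: "E \<in> sets (density_borel lam)" by simp
  have "emeasure (distr (measure_pmf (word_pmf x (Suc 0))) (density_borel lam) (filt x)) E =
      (\<integral>\<^sup>+ w. indicator E (filt x w) \<partial>measure_pmf (word_pmf x (Suc 0)))"
    by (rule emeasure_distr_filt[OF x E])
  also have "\<dots> = (\<integral>\<^sup>+ a. indicator E (filt x [a]) * weight x [a] \<partial>count_space UNIV)"
    unfolding nn_integral_word_pmf[OF density_probsD(1,2)[OF x]] by (rule nn_integral_words_1)
  finally show "emeasure (filter_kernel lam tau m x) E =
      emeasure (distr (measure_pmf (word_pmf x (Suc 0))) (density_borel lam) (filt x)) E"
    by (simp add: emeasure_filter_kernel_words[OF x E])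
qed simp

lemma measurable_filter_kernel:
  "filter_kernel lam tau m \<in> density_borel lam \<rightarrow>\<^sub>M prob_algebra (density_borel lam)"
proof (rule measurable_prob_algebraI)
  show p: "prob_space (filter_kernel lam tau m x)" if "x \<in> space (density_borel lam)" for x
    using that filter_kernel_eq_distr[of x] filt_word_pmf_measurable[of x]
    by (auto simp: space_density_borel intro!: prob_space.prob_space_distr measure_pmf.prob_space_axioms)
  show "filter_kernel lam tau m \<in> density_borel lam \<rightarrow>\<^sub>M subprob_algebra (density_borel lam)"
  proof (rule measurable_subprob_algebra)
    fix E :: "'s measure set" assume E[measurable]: "E \<in> sets (density_borel lam)"
    note [measurable] = measurable_filt measurable_weight
    have "(\<lambda>x. \<integral>\<^sup>+ a. indicator E (filt x [a]) * weight x [a] \<partial>count_space UNIV)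
        \<in> borel_measurable (density_borel lam)"
      by (rule borel_measurable_nn_integral_countable[OF countable_obs]) measurable
    then show "(\<lambda>x. emeasure (filter_kernel lam tau m x) E) \<in> borel_measurable (density_borel lam)"
      by (subst measurable_cong) (simp_all add: emeasure_filter_kernel_words E space_density_borel)
  qed (simp_all add: p prob_space_imp_subprob_space)
qed

lemma emeasure_filter_pow:
  assumes "x \<in> density_probs lam" and E: "E \<in> sets (density_borel lam)"
  shows "emeasure (filter_pow n x) E = (\<integral>\<^sup>+ w. indicator E (filt x w) * weight x w \<partial>count_space (words n))"
  using assms(1)
proof (induction n arbitrary: x)
  case 0
  then show ?case
    using E density_probsD(4)[of x lam] prob_space.emeasure_space_1[of x] density_probsD(2)[of x lam]
    by (simp add: nn_integral_words_0 filt_Nil del: length_0_conv)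
next
  case (Suc n)
  note x = Suc.prems and xf = density_probsD(1)[OF Suc.prems]
  let ?g = "\<lambda>y. emeasure (filter_pow n y) E"
  have g: "?g \<in> borel_measurable (density_borel lam)"
    by (rule measurable_compose[OF measurable_prob_algebraD[OF kernel_pow_in_prob_algebra[OF
            measurable_filter_kernel]] measurable_emeasure_subprob_algebra[OF E]])
  have "emeasure (filter_pow (Suc n) x) E = (\<integral>\<^sup>+ y. ?g y \<partial>filter_kernel lam tau m x)"
    by (rule emeasure_kernel_pow_Suc[OF measurable_filter_kernel _ E]) (simp add: x space_density_borel)
  also have "\<dots> = (\<integral>\<^sup>+ w. ?g (filt x w) \<partial>measure_pmf (word_pmf x (Suc 0)))"
    unfolding filter_kernel_eq_distr[OF x]
    by (rule nn_integral_distr[OF filt_word_pmf_measurable[OF x]]) (simp add: g)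
  also have "\<dots> = (\<integral>\<^sup>+ a. ?g (filt x [a]) * weight x [a] \<partial>count_space UNIV)"
    unfolding nn_integral_word_pmf[OF density_probsD(1,2)[OF x]] by (rule nn_integral_words_1)
  also have "\<dots> = (\<integral>\<^sup>+ a. (\<integral>\<^sup>+ w. indicator E (filt x (a # w)) * weight x (a # w)
      \<partial>count_space (words n)) \<partial>count_space UNIV)"
  proof (rule nn_integral_cong)
    fix a
    have "?g (filt x [a]) * weight x [a] = (\<integral>\<^sup>+ w. indicator E (filt (filt x [a]) w) *
        weight (filt x [a]) w * weight x [a] \<partial>count_space (words n))"
      unfolding Suc.IH[OF filt_in_density_probs[OF x]] by (simp add: nn_integral_multc)
    also have "\<dots> = (\<integral>\<^sup>+ w. indicator E (filt x (a # w)) * weight x (a # w) \<partial>count_space (words n))"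
    proof (rule nn_integral_cong)
      fix w
      show "indicator E (filt (filt x [a]) w) * weight (filt x [a]) w * weight x [a] =
          indicator E (filt x (a # w)) * weight x (a # w)"
      proof (cases "0 < weight x [a]")
        case True
        have w: "weight x [a] * weight (filt x [a]) w = weight x (a # w)"
          using emeasure_steps_filt[OF x True, of UNIV w] by simp
        have "filt (filt x [a]) w = filt x (a # w)" if "weight x (a # w) \<noteq> 0"
          using filt_append[OF x, of "[a]" w] that by (simp add: zero_less_iff_neq_zero)
        then show ?thesis
          using w by (cases "weight x (a # w) = 0") (auto simp: ac_simps simp del: foldl_Cons)
      next
        case False
        then have "weight x [a] = 0" by (simp add: zero_less_iff_neq_zero)
        moreover from this have "weight x (a # w) = 0"
          using weight_append_le[OF xf, of "[a]" w] by simp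
        ultimately show ?thesis by (simp only: mult_zero_right)
      qed
    qed
    finally show "?g (filt x [a]) * weight x [a] = \<dots>" .
  qed
  also have "\<dots> = (\<integral>\<^sup>+ w. indicator E (filt x w) * weight x w \<partial>count_space (words (Suc n)))"
    by (rule nn_integral_words_Suc[symmetric])
  finally show ?case .
qed

text \<open>The filter process moves from \<open>x\<close> to \<open>filt x [a]\<close> with the probability of observing \<open>a\<close>, and
  \<open>filt (filt x v) w = filt x (v @ w)\<close>. So after \<open>n\<close> steps its position is a function of the
  observed word.\<close>

lemma filter_pow_eq_distr:
  assumes x: "x \<in> density_probs lam"
  shows "filter_pow n x = distr (measure_pmf (word_pmf x n)) (density_borel lam) (filt x)"
proof (rule measure_eqI)
  have "filter_pow n x \<in> space (prob_algebra (density_borel lam))"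
    using measurable_space[OF kernel_pow_in_prob_algebra[OF measurable_filter_kernel]] x
    by (auto simp: space_density_borel)
  then have s: "sets (filter_pow n x) = sets (density_borel lam)" by (simp add: space_prob_algebra)
  then show "sets (filter_pow n x) = sets (distr (measure_pmf (word_pmf x n)) (density_borel lam) (filt x))"
    by simp
  fix E assume "E \<in> sets (filter_pow n x)"
  then have E: "E \<in> sets (density_borel lam)" by (simp add: s)
  have "emeasure (distr (measure_pmf (word_pmf x n)) (density_borel lam) (filt x)) E =
      (\<integral>\<^sup>+ w. indicator E (filt x w) \<partial>measure_pmf (word_pmf x n))"
    by (rule emeasure_distr_filt[OF x E])
  then show "emeasure (filter_pow n x) E =
      emeasure (distr (measure_pmf (word_pmf x n)) (density_borel lam) (filt x)) E"
    unfolding emeasure_filter_pow[OF x E] nn_integral_word_pmf[OF density_probsD(1,2)[OF x]] by simp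
qed

lemma integral_filter_pow:
  fixes u :: "'s measure \<Rightarrow> real"
  assumes x: "x \<in> density_probs lam" and u: "u \<in> borel_measurable (density_borel lam)"
  shows "(\<integral> z. u z \<partial>filter_pow n x) = measure_pmf.expectation (word_pmf x n) (\<lambda>w. u (filt x w))"
  unfolding filter_pow_eq_distr[OF x] by (rule integral_distr[OF filt_word_pmf_measurable[OF x] u])

lemma expectation_word_pmf_diff_le:
  assumes x: "x \<in> finite_borel_measures" "prob_space x" and y: "y \<in> finite_borel_measures" "prob_space y"
    and C: "0 < C" and f: "\<And>w. \<bar>f w\<bar> \<le> C"
  shows "measure_pmf.expectation (word_pmf x n) f - measure_pmf.expectation (word_pmf y n) f
    \<le> 2 * C * tv_dist x y"
proof -
  have int: "integrable (measure_pmf p) f" for p :: "'a list pmf"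
    by (rule measure_pmf.integrable_const_bound[of _ C]) (use f in auto)
  \<comment> \<open>The bound for functions with values in the unit interval applies after rescaling.\<close>
  define g where "g w = (f w + C) / (2 * C)" for w
  have g: "0 \<le> g w" "g w \<le> 1" for w
    using f[of w] C by (auto simp: g_def abs_le_iff field_simps)
  have intg: "integrable (measure_pmf p) g" for p :: "'a list pmf"
    by (rule measure_pmf.integrable_const_bound[of _ 1]) (use g in auto)
  have nn: "(\<integral>\<^sup>+ w. ennreal (g w) \<partial>measure_pmf p) = ennreal (measure_pmf.expectation p g)" for p :: "'a list pmf"
    by (rule nn_integral_eq_integral[OF intg]) (simp add: g)
  have "ennreal (measure_pmf.expectation (word_pmf x n) g) \<le>
      ennreal (measure_pmf.expectation (word_pmf y n) g) + ennreal (tv_dist x y)"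
    unfolding nn[symmetric] nn_integral_word_pmf[OF x] nn_integral_word_pmf[OF y]
    by (rule sum_words_le_add_tv_dist[OF x(1) y(1)]) (simp add: g ennreal_le_1)
  also have "\<dots> = ennreal (measure_pmf.expectation (word_pmf y n) g + tv_dist x y)"
    using tv_dist_nonneg[OF x(1) y(1)] by (intro ennreal_plus[symmetric] integral_nonneg_AE) (auto simp: g)
  finally have le: "measure_pmf.expectation (word_pmf x n) g \<le> measure_pmf.expectation (word_pmf y n) g + tv_dist x y"
    using tv_dist_nonneg[OF x(1) y(1)]
    by (subst (asm) ennreal_le_iff) (auto intro!: add_nonneg_nonneg integral_nonneg_AE simp: g)
  have eq: "measure_pmf.expectation p g = (measure_pmf.expectation p f + C) / (2 * C)" for p :: "'a list pmf"
    unfolding g_def using int[of p] by (simp add: Bochner_Integration.integral_add)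
  have "2 * C * ((measure_pmf.expectation (word_pmf x n) f + C) / (2 * C)) \<le>
      2 * C * ((measure_pmf.expectation (word_pmf y n) f + C) / (2 * C) + tv_dist x y)"
    using le C unfolding eq by (intro mult_left_mono) auto
  moreover have "2 * C * (a / (2 * C)) = a" for a using C by simp
  ultimately show ?thesis unfolding distrib_left[of "2 * C"] by simp
qed

end

section \<open>Comparison with the stationary filter\<close>

context ergodic_partition_hmm
begin

abbreviation mu_words :: "nat \<Rightarrow> 'a list pmf" where
  "mu_words \<equiv> word_pmf mu"

text \<open>The comparison on which everything rests. Write a word of length \<open>N + j\<close> as \<open>v @ w\<close>. The filter
  started in \<open>x\<close> and the filter started in \<open>mu\<close> that sees only \<open>w\<close> are within \<open>2 * forget w\<close> of each
  other, which changes \<open>u\<close> by at most \<open>B w\<close>. The law of \<open>w\<close> is that of the first \<open>j\<close> observations of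
  a chain with initial law \<open>push N x\<close>, and replacing this law by \<open>mu\<close> costs a multiple of their total
  variation distance, both for \<open>u\<close> and for \<open>B\<close>. For words \<open>w\<close> of stationary probability zero the
  filter started in \<open>mu\<close> carries no information and \<open>B w\<close> has to bound every difference.\<close>

lemma integral_filter_pow_near_mu:
  fixes u :: "'s measure \<Rightarrow> real"
  assumes x: "x \<in> density_probs lam" and u: "u \<in> borel_measurable (density_borel lam)"
    and C: "0 < C" "\<And>y. y \<in> density_probs lam \<Longrightarrow> \<bar>u y\<bar> \<le> C"
    and B: "\<And>w. 0 \<le> B w" "\<And>w. B w \<le> 2 * C"
    and osc: "\<And>w y. y \<in> density_probs lam \<Longrightarrow>
      (0 < weight mu w \<Longrightarrow> tv_dist y (filt mu w) \<le> 2 * forget w) \<Longrightarrow> \<bar>u y - u (filt mu w)\<bar> \<le> B w"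
  shows "\<bar>(\<integral> z. u z \<partial>filter_pow (N + j) x) - (\<integral> z. u z \<partial>filter_pow j mu)\<bar> \<le>
    measure_pmf.expectation (mu_words j) B + 6 * C * tv_dist (push N x) mu"
proof -
  note xp = density_probsD(1,2)[OF x] and mup = mu_finite_borel prob_space_mu
  note px = push_props(2,1)[OF xp, of N]
  let ?p = "word_pmf x (N + j)" and ?q = "word_pmf (push N x) j"
  define g where "g w = u (filt mu w)" for w
  have gC: "\<bar>g w\<bar> \<le> C" for w
    unfolding g_def by (rule C(2)[OF filt_in_density_probs[OF mu_in_density_probs]])
  have fC: "\<bar>u (filt x w)\<bar> \<le> C" for w by (rule C(2)[OF filt_in_density_probs[OF x]])
  have BC: "\<bar>B w\<bar> \<le> 2 * C" for w using B[of w] by simp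
  have int: "integrable (measure_pmf p) f" if "\<And>w. \<bar>f w\<bar> \<le> c" for f :: "'a list \<Rightarrow> real" and c p
    by (rule measure_pmf.integrable_const_bound[of _ c]) (use that in auto)
  have drop: "measure_pmf.expectation ?p (\<lambda>w. f (drop N w)) = measure_pmf.expectation ?q f" for f :: "'a list \<Rightarrow> real"
    unfolding map_drop_word_pmf[OF xp, symmetric] by (simp add: integral_map_pmf)
  have d2C: "\<bar>u (filt x w) - g (drop N w)\<bar> \<le> 2 * C" for w
    using fC[of w] gC[of "drop N w"] by linarith
  have pt: "\<bar>u (filt x w) - g (drop N w)\<bar> \<le> B (drop N w)" if "w \<in> set_pmf ?p" for w
  proof -
    define v w' where "v = take N w" and "w' = drop N w"
    have w: "w = v @ w'" by (simp add: v_def w'_def)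
    have pos: "0 < weight x (v @ w')" using that unfolding set_word_pmf[OF xp] w by simp
    note wf = weight_filt[OF x pos]
    have eq: "filt x w = filt (filt x v) w'" unfolding w by (rule filt_append[OF x pos, symmetric])
    show ?thesis
      unfolding eq g_def w'_def[symmetric]
    proof (rule osc)
      show "filt (filt x v) w' \<in> density_probs lam"
        by (intro filt_in_density_probs x)
      show "tv_dist (filt (filt x v) w') (filt mu w') \<le> 2 * forget w'" if "0 < weight mu w'"
        by (rule tv_dist_filt_le[OF filt_in_density_probs[OF x] wf(2) mu_in_density_probs that])
    qed
  qed
  have "\<bar>measure_pmf.expectation ?p (\<lambda>w. u (filt x w)) - measure_pmf.expectation ?q g\<bar> =
      \<bar>measure_pmf.expectation ?p (\<lambda>w. u (filt x w) - g (drop N w))\<bar>"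
    unfolding drop[symmetric]
    by (subst Bochner_Integration.integral_diff) (auto intro!: int[of _ C] fC gC)
  also have "\<dots> \<le> measure_pmf.expectation ?p (\<lambda>w. B (drop N w))"
    by (rule order_trans[OF integral_abs_bound integral_mono_AE])
       (auto intro!: int[of _ "2 * C"] BC d2C simp: AE_measure_pmf_iff pt)
  also have "\<dots> = measure_pmf.expectation ?q B" by (rule drop)
  also have "\<dots> \<le> measure_pmf.expectation (mu_words j) B + 2 * (2 * C) * tv_dist (push N x) mu"
    using expectation_word_pmf_diff_le[OF px mup, of "2 * C" B j] C(1) BC by simp
  finally have 1: "\<bar>measure_pmf.expectation ?p (\<lambda>w. u (filt x w)) - measure_pmf.expectation ?q g\<bar> \<le>
    measure_pmf.expectation (mu_words j) B + 2 * (2 * C) * tv_dist (push N x) mu" .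
  have 2: "\<bar>measure_pmf.expectation ?q g - measure_pmf.expectation (mu_words j) g\<bar> \<le> 2 * C * tv_dist (push N x) mu"
    using expectation_word_pmf_diff_le[OF px mup C(1) gC, of j] expectation_word_pmf_diff_le[OF mup px C(1) gC, of j]
      tv_dist_commute[of mu "push N x"] by (simp add: abs_le_iff)
  have "(\<integral> z. u z \<partial>filter_pow j mu) = measure_pmf.expectation (mu_words j) g"
    unfolding g_def by (rule integral_filter_pow[OF mu_in_density_probs u])
  then show ?thesis
    using 1 2 unfolding integral_filter_pow[OF x u] by (simp add: abs_le_iff)
qed

lemma expectation_forget_tendsto_0:
  "(\<lambda>j. measure_pmf.expectation (mu_words j) forget) \<longlonglongrightarrow> 0"
proof -
  have "memory j mu = ennreal (measure_pmf.expectation (mu_words j) forget)" for j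
  proof -
    have int: "integrable (measure_pmf p) forget" for p
      by (rule measure_pmf.integrable_const_bound[of _ 1]) (use forget_bounds in auto)
    show ?thesis
      unfolding memory_def nn_integral_word_pmf[OF mu_finite_borel prob_space_mu, symmetric]
      by (rule nn_integral_eq_integral[OF int]) (simp add: forget_nonneg)
  qed
  then show ?thesis
    using memory_mu_tendsto_0 by (subst tendsto_ennreal_iff[symmetric])
      (auto intro!: always_eventually integral_nonneg_AE simp: forget_nonneg)
qed

lemma prob_space_filter_pow:
  assumes "x \<in> density_probs lam"
  shows "prob_space (filter_pow n x)"
  unfolding filter_pow_eq_distr[OF assms]
  by (rule measure_pmf.prob_space_distr[OF filt_word_pmf_measurable[OF assms]])

lemma Lip1_integral_filter_pow_near_mu:
  assumes u: "u \<in> Lip1 (density_probs_metric lam)" and x: "x \<in> density_probs lam"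
  shows "\<bar>(\<integral> z. u z \<partial>filter_pow (N + j) x) - (\<integral> z. u z \<partial>filter_pow j mu)\<bar> \<le>
    2 * measure_pmf.expectation (mu_words j) forget + 12 * tv_dist (push N x) mu"
proof -
  \<comment> \<open>Only differences of \<open>u\<close> matter; subtracting \<open>u mu\<close> bounds it by the diameter 2 of the space.\<close>
  define u0 where "u0 y = u y - u mu" for y
  define B where "B w = (if 0 < weight mu w then 2 * forget w else 4)" for w
  note mu = mu_in_density_probs
  have um: "u \<in> borel_measurable (density_borel lam)" by (rule Lip1_measurable[OF u])
  have bnd: "\<bar>u0 y\<bar> \<le> 2" if "y \<in> density_probs lam" for y
    using Lip1_densityD[OF u that mu] tv_dist_density_probs_le_2[OF that mu] by (simp add: u0_def)
  have "\<bar>(\<integral> z. u0 z \<partial>filter_pow (N + j) x) - (\<integral> z. u0 z \<partial>filter_pow j mu)\<bar> \<le>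
      measure_pmf.expectation (mu_words j) B + 6 * 2 * tv_dist (push N x) mu"
  proof (rule integral_filter_pow_near_mu[OF x _ _ bnd])
    show "u0 \<in> borel_measurable (density_borel lam)" unfolding u0_def using um by simp
    show "0 \<le> B w" "B w \<le> 2 * 2" for w using forget_bounds[of w] by (auto simp: B_def)
    show "\<bar>u0 y - u0 (filt mu w)\<bar> \<le> B w" if y: "y \<in> density_probs lam"
      and d: "0 < weight mu w \<Longrightarrow> tv_dist y (filt mu w) \<le> 2 * forget w" for w y
    proof (cases "0 < weight mu w")
      case True
      then show ?thesis
        using Lip1_densityD[OF u y filt_in_density_probs[OF mu], of w] d by (simp add: u0_def B_def)
    next
      case False
      then show ?thesis
        using bnd[OF y] bnd[OF filt_in_density_probs[OF mu, of w]] by (simp add: B_def)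
    qed
  qed simp
  moreover have "measure_pmf.expectation (mu_words j) B = 2 * measure_pmf.expectation (mu_words j) forget"
  proof -
    have "measure_pmf.expectation (mu_words j) B = measure_pmf.expectation (mu_words j) (\<lambda>w. 2 * forget w)"
      by (rule integral_cong_AE)
         (auto simp: AE_measure_pmf_iff set_word_pmf[OF mu_finite_borel prob_space_mu] B_def)
    then show ?thesis by simp
  qed
  moreover have "(\<integral> z. u0 z \<partial>filter_pow n y) = (\<integral> z. u z \<partial>filter_pow n y) - u mu"
    if y: "y \<in> density_probs lam" for n y
  proof -
    interpret p: prob_space "filter_pow n y" by (rule prob_space_filter_pow[OF y])
    have "u (filt y w) = u0 (filt y w) + u mu" for w by (simp add: u0_def)
    moreover have "integrable (measure_pmf (word_pmf y n)) (\<lambda>w. u0 (filt y w))"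
      by (rule measure_pmf.integrable_const_bound[of _ 2])
         (use bnd filt_in_density_probs[OF y] in auto)
    moreover have "u0 \<in> borel_measurable (density_borel lam)" unfolding u0_def using um by simp
    ultimately show ?thesis
      by (simp add: integral_filter_pow[OF y] um Bochner_Integration.integral_add)
  qed
  ultimately show ?thesis using x mu by simp
qed

text \<open>The bound \<open>Lip1_integral_filter_pow_near_mu\<close> does not depend on \<open>u\<close>: a large \<open>j\<close> makes the
  expectation of \<open>forget\<close> small, and then a large \<open>N\<close> makes the two total variation distances small.\<close>

theorem filter_kernel_weakly_contracting:
  "weakly_contracting (density_probs_metric lam) (filter_kernel lam tau m)"
  unfolding weakly_contracting_def mspace_density_probs_metric
proof (intro ballI)
  fix x y assume x: "x \<in> density_probs lam" and y: "y \<in> density_probs lam"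
  let ?L = "Lip1 (density_probs_metric lam)"
  let ?s = "\<lambda>n. SUP u \<in> ?L. ereal ((\<integral>z. u z \<partial>filter_pow n x) - (\<integral>z. u z \<partial>filter_pow n y))"
  define T where "T z N = tv_dist (push N z) mu" for z N
  have "eventually (\<lambda>n. ?s n \<le> ereal e) sequentially" if e: "0 < e" for e
  proof -
    obtain j where j: "\<bar>measure_pmf.expectation (mu_words j) forget\<bar> < e / 8"
      using LIMSEQ_D[OF expectation_forget_tendsto_0, of "e / 8"] e by auto
    have "eventually (\<lambda>N. T x N < e / 48) sequentially" "eventually (\<lambda>N. T y N < e / 48) sequentially"
      using order_tendstoD(2)[OF tv_dist_push_mu[OF density_probsD(1,2)[OF x]], of "e / 48"]
        order_tendstoD(2)[OF tv_dist_push_mu[OF density_probsD(1,2)[OF y]], of "e / 48"] e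
      by (auto simp: T_def)
    then have "eventually (\<lambda>N. ?s (N + j) \<le> ereal e) sequentially"
    proof eventually_elim
      case (elim N)
      show ?case
      proof (rule SUP_least)
        fix u assume u: "u \<in> ?L"
        show "ereal ((\<integral>z. u z \<partial>filter_pow (N + j) x) - (\<integral>z. u z \<partial>filter_pow (N + j) y)) \<le> ereal e"
          using Lip1_integral_filter_pow_near_mu[OF u x, of N j]
            Lip1_integral_filter_pow_near_mu[OF u y, of N j] j elim
          unfolding T_def ereal_less_eq by linarith
      qed
    qed
    then show ?thesis
      using eventually_sequentially_seg[of "\<lambda>n. ?s n \<le> ereal e" j] by simp
  qed
  moreover have "0 \<le> ?s n" for n
  proof -
    have "(\<lambda>_. 0) \<in> ?L"
      using mdist_nonneg[of "density_probs_metric lam"] by (auto simp: Lip1_def image_constant_conv)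
    then show ?thesis by (rule SUP_upper2) simp
  qed
  ultimately show "?s \<longlonglongrightarrow> 0"
  proof (intro order_tendstoI)
    fix a :: ereal assume "a < 0"
    then show "eventually (\<lambda>n. a < ?s n) sequentially"
      using \<open>\<And>n. 0 \<le> ?s n\<close> by (intro always_eventually allI) (rule less_le_trans)
  next
    fix a :: ereal assume "0 < a"
    then obtain e where e: "0 < ereal e" "ereal e < a" using ereal_dense2 by blast
    then have "eventually (\<lambda>n. ?s n \<le> ereal e) sequentially"
      using \<open>\<And>e. 0 < e \<Longrightarrow> eventually (\<lambda>n. ?s n \<le> ereal e) sequentially\<close> by simp
    then show "eventually (\<lambda>n. ?s n < a) sequentially"
      by eventually_elim (rule le_less_trans[OF _ e(2)])
  qed
qed

end

section \<open>The infinite past\<close>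

text \<open>The sequence \<open>om\<close> lists observations backwards in time, whereas words are in temporal order. So the
  last \<open>n\<close> observations are the reversed initial segment, and a longer past extends the word on the left.\<close>

definition past :: "(nat \<Rightarrow> 'a) \<Rightarrow> nat \<Rightarrow> 'a list" where
  "past om n = rev (map om [0..<n])"

lemma past_Suc: "past om (Suc n) = om n # past om n"
  by (simp add: past_def)

lemma past_add: "\<exists>v. past om (k + n) = v @ past om n"
  by (induction k) (auto simp: past_Suc)

text \<open>Kolmogorov's extension theorem for words that are extended on the left. Its finite-dimensional laws
  are the images of \<open>q n\<close> under reading off the letters at the positions \<open>J\<close>, counted from the right,
  for any \<open>n\<close> beyond \<open>J\<close>.\<close>

lemma ex_past_measure:
  fixes q :: "nat \<Rightarrow> 'a::polish_space list pmf"
  assumes countable: "countable (UNIV :: 'a set)"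
    and len: "\<And>n w. w \<in> set_pmf (q n) \<Longrightarrow> length w = n"
    and consistent: "\<And>k n. map_pmf (drop k) (q (k + n)) = q n"
  shows "\<exists>L :: (nat \<Rightarrow> 'a) measure. prob_space L \<and>
    (\<forall>n. (\<lambda>om. past om n) \<in> L \<rightarrow>\<^sub>M count_space UNIV \<and>
      distr L (count_space UNIV) (\<lambda>om. past om n) = measure_pmf (q n))"
proof -
  let ?M = "\<lambda>J :: nat set. PiM J (\<lambda>_. borel :: 'a measure)"
  define coord where "coord J w = (\<lambda>i \<in> J. rev w ! i)" for J and w :: "'a list"
  define bound where "bound J = (if J = {} then 0 else Suc (Max J))" for J :: "nat set"
  define P where "P J = distr (measure_pmf (q (bound J))) (?M J) (coord J)" for J
  have coord_meas [measurable]: "coord J \<in> measure_pmf p \<rightarrow>\<^sub>M ?M J" for J p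
    by (auto simp: coord_def measurable_def space_PiM)
  have P_eq: "P J = distr (measure_pmf (q n)) (?M J) (coord J)" if "finite J" and J: "\<And>i. i \<in> J \<Longrightarrow> i < n" for J n
  proof -
    have "bound J \<le> n" using that by (auto simp: bound_def Suc_le_eq)
    then obtain k where n: "n = k + bound J" by (metis le_add_diff_inverse2)
    have "P J = distr (distr (measure_pmf (q n)) (count_space UNIV) (drop k)) (?M J) (coord J)"
      unfolding P_def n consistent[of k "bound J", symmetric] by (simp add: map_pmf_rep_eq)
    also have "\<dots> = distr (measure_pmf (q n)) (?M J) (coord J \<circ> drop k)"
      by (rule distr_distr) (auto simp: coord_def measurable_def space_PiM)
    also have "\<dots> = distr (measure_pmf (q n)) (?M J) (coord J)"
    proof (rule distr_cong_AE[OF refl refl])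
      show "AE w in measure_pmf (q n). (coord J \<circ> drop k) w = coord J w"
      proof (unfold AE_measure_pmf_iff, intro ballI)
        fix w assume w: "w \<in> set_pmf (q n)"
        have "i < bound J" if "i \<in> J" for i
          using that \<open>finite J\<close> by (auto simp: bound_def less_Suc_eq_le)
        then show "(coord J \<circ> drop k) w = coord J w"
          using len[OF w] n by (auto simp: coord_def rev_drop restrict_def fun_eq_iff)
      qed
    qed (auto simp: coord_def measurable_def space_PiM)
    finally show ?thesis .
  qed
  have bnd: "i < bound J" if "finite J" "i \<in> J" for i J
    using that by (auto simp: bound_def less_Suc_eq_le)
  interpret polish_projective UNIV P
  proof (intro polish_projective.intro projective_family.intro)
    fix J H :: "nat set" assume JH: "J \<subseteq> H" "finite H"
    have "distr (P H) (?M J) (\<lambda>f. restrict f J) =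
        distr (measure_pmf (q (bound H))) (?M J) ((\<lambda>f. restrict f J) \<circ> coord H)"
      unfolding P_def by (rule distr_distr[OF measurable_restrict_subset[OF JH(1)] coord_meas])
    also have "(\<lambda>f. restrict f J) \<circ> coord H = coord J"
      using JH by (auto simp: coord_def restrict_def fun_eq_iff)
    also have "distr (measure_pmf (q (bound H))) (?M J) (coord J) = P J"
      by (rule P_eq[symmetric]) (use JH bnd in \<open>auto intro: finite_subset\<close>)
    finally show "P J = distr (P H) (?M J) (\<lambda>f. restrict f J)" by (rule sym)
  next
    fix J :: "nat set"
    show "prob_space (P J)"
      unfolding P_def by (rule measure_pmf.prob_space_distr) measurable
  qed
  have "(\<lambda>om. past om n) \<in> lim \<rightarrow>\<^sub>M count_space UNIV \<and>
      distr lim (count_space UNIV) (\<lambda>om. past om n) = measure_pmf (q n)" for n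
  proof -
    let ?J = "{..<n}"
    have decode: "(\<lambda>f. past f n) \<in> ?M ?J \<rightarrow>\<^sub>M count_space UNIV"
    proof -
      have "countable (UNIV :: 'a list set)"
        using countable_lists[OF countable] by simp
      note measurable_count_space_eq_countable[OF this]
      moreover have "(\<lambda>f. past f n) -` {w} \<inter> space (?M ?J) \<in> sets (?M ?J)" for w
      proof -
        have "past f n = w \<longleftrightarrow> length w = n \<and> (\<forall>i \<in> {..<n}. f i = rev w ! i)" for f
        proof -
          have "past f n = w \<longleftrightarrow> map f [0..<n] = rev w" unfolding past_def by (metis rev_rev_ident)
          then show ?thesis by (auto simp: list_eq_iff_nth_eq)
        qed
        then have eq: "(\<lambda>f. past f n) -` {w} \<inter> space (?M ?J) =
            {f \<in> space (?M ?J). length w = n \<and> (\<forall>i \<in> {..<n}. f i = rev w ! i)}"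
          by auto
        have [measurable]: "(\<lambda>f. f i) \<in> ?M ?J \<rightarrow>\<^sub>M borel" if "i \<in> {..<n}" for i
          using that by (rule measurable_component_singleton)
        show ?thesis unfolding eq by measurable
      qed
      ultimately show ?thesis by auto
    qed
    have restr: "(\<lambda>om. restrict om ?J) \<in> lim \<rightarrow>\<^sub>M ?M ?J"
      using measurable_restrict_subset[of ?J UNIV "\<lambda>_. borel :: 'a measure"]
      by (simp add: measurable_cong_sets[OF sets_lim refl])
    have eq: "past (restrict om ?J) n = past om n" for om
      by (auto simp: past_def intro!: map_cong)
    have "(\<lambda>om. past (restrict om ?J) n) \<in> lim \<rightarrow>\<^sub>M count_space UNIV"
      by (rule measurable_compose[OF restr decode])
    then have meas: "(\<lambda>om. past om n) \<in> lim \<rightarrow>\<^sub>M count_space UNIV" unfolding eq .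
    have "distr lim (?M ?J) (\<lambda>om. restrict om ?J) = P ?J"
    proof (rule measure_eqI)
      fix B assume "B \<in> sets (distr lim (?M ?J) (\<lambda>om. restrict om ?J))"
      then have B: "B \<in> sets (?M ?J)" by simp
      have "emeasure (distr lim (?M ?J) (\<lambda>om. restrict om ?J)) B = emeasure lim (emb UNIV ?J B)"
        using emeasure_distr[OF restr B] by (simp add: prod_emb_def space_PiM)
      also have "\<dots> = emeasure (P ?J) B"
        by (rule emeasure_lim_emb) (use B in auto)
      finally show "emeasure (distr lim (?M ?J) (\<lambda>om. restrict om ?J)) B = emeasure (P ?J) B" .
    qed (simp add: P_def)
    then have "distr lim (count_space UNIV) (\<lambda>om. past om n) =
        distr (P ?J) (count_space UNIV) (\<lambda>f. past f n)"
      using distr_distr[OF decode restr] by (simp add: comp_def eq)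
    also have "\<dots> = distr (measure_pmf (q n)) (count_space UNIV) ((\<lambda>f. past f n) \<circ> coord ?J)"
      unfolding P_eq[of ?J n, simplified] by (rule distr_distr[OF decode coord_meas])
    also have "\<dots> = distr (measure_pmf (q n)) (count_space UNIV) (\<lambda>w. w)"
    proof (rule distr_cong_AE[OF refl refl])
      show "AE w in measure_pmf (q n). ((\<lambda>f. past f n) \<circ> coord ?J) w = w"
      proof (unfold AE_measure_pmf_iff, intro ballI)
        fix w assume "w \<in> set_pmf (q n)"
        then have "length w = n" by (rule len)
        then have "map (coord ?J w) [0..<n] = rev w"
          by (auto simp: list_eq_iff_nth_eq coord_def)
        then show "((\<lambda>f. past f n) \<circ> coord ?J) w = w" by (simp add: past_def)
      qed
    qed auto
    also have "\<dots> = measure_pmf (q n)"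
      by (rule distr_id2) simp
    finally show ?thesis using meas by blast
  qed
  then show ?thesis using P.prob_space_axioms by blast
qed

section \<open>The stationary law of the filter\<close>

context ergodic_partition_hmm
begin

text \<open>By \<open>tv_dist_filt_le\<close>, the filter that sees the last \<open>n\<close> observations is within
  \<open>2 * forget (past om n)\<close> of every filter that sees more of the past, so the sequence is Cauchy.\<close>

lemma past_filter_limit:
  assumes pos: "\<And>n. 0 < weight mu (past om n)" and f0: "(\<lambda>n. forget (past om n)) \<longlonglongrightarrow> 0"
  shows "\<exists>y \<in> density_probs lam. (\<lambda>n. tv_dist (filt mu (past om n)) y) \<longlonglongrightarrow> 0"
proof (rule density_probs_Cauchy_limit[OF sigma_finite_lam sets_lam filt_in_density_probs[OF mu_in_density_probs]])
  note mu = mu_in_density_probs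
  have step: "tv_dist (filt mu (past om (k + n))) (filt mu (past om n)) \<le> 2 * forget (past om n)" for k n
  proof -
    obtain v where v: "past om (k + n) = v @ past om n" using past_add by blast
    have p: "0 < weight mu (v @ past om n)" using pos[of "k + n"] v by simp
    show ?thesis
      unfolding v filt_append[OF mu p, symmetric]
      by (rule tv_dist_filt_le[OF filt_in_density_probs[OF mu] weight_filt(2)[OF mu p] mu pos])
  qed
  fix e :: real assume "0 < e"
  then obtain N where N: "\<forall>n \<ge> N. norm (forget (past om n) - 0) < e / 4"
    using LIMSEQ_D[OF f0, of "e / 4"] by auto
  have "tv_dist (filt mu (past om i)) (filt mu (past om N)) \<le> e / 2" if "i \<ge> N" for i
    using step[of "i - N" N] that N by (auto simp: abs_of_nonneg[OF forget_nonneg])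
  moreover have "tv_dist (filt mu (past om i)) (filt mu (past om j)) \<le>
      tv_dist (filt mu (past om i)) (filt mu (past om N)) + tv_dist (filt mu (past om j)) (filt mu (past om N))" for i j
    unfolding tv_dist_commute[of "filt mu (past om j)" "filt mu (past om N)"]
    by (intro tv_dist_triangle density_probsD(1)[OF filt_in_density_probs[OF mu]])
  ultimately have "tv_dist (filt mu (past om i)) (filt mu (past om j)) \<le> e" if "i \<ge> N" "j \<ge> N" for i j
    using that by (smt (verit) field_sum_of_halves)
  then show "\<exists>N. \<forall>i \<ge> N. \<forall>j \<ge> N. tv_dist (filt mu (past om i)) (filt mu (past om j)) \<le> e" by blast
qed

text \<open>A set that contains all values which the filter, started anywhere, can have after observing \<open>w\<close>;
  see \<open>tv_dist_filt_le\<close>.\<close>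

definition reach :: "'a list \<Rightarrow> 's measure set" where
  "reach w = {y \<in> density_probs lam. 0 < weight mu w \<longrightarrow> tv_dist y (filt mu w) \<le> 2 * forget w}"

definition osc :: "('s measure \<Rightarrow> real) \<Rightarrow> 'a list \<Rightarrow> real" where
  "osc u w = (SUP y \<in> reach w. \<bar>u y - u (filt mu w)\<bar>)"

lemma filt_mu_in_density_probs: "filt mu w \<in> density_probs lam"
  by (rule filt_in_density_probs[OF mu_in_density_probs])

lemma filt_mu_in_reach: "filt mu w \<in> reach w"
proof -
  have "tv_dist (filt mu w) (filt mu w) = 0"
    by (simp add: tv_dist_eq_0_iff density_probsD(1)[OF filt_mu_in_density_probs])
  then show ?thesis using filt_mu_in_density_probs forget_nonneg[of w] by (simp add: reach_def)
qed

context
  fixes u :: "'s measure \<Rightarrow> real" and C :: real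
  assumes u_bounded: "\<And>y. y \<in> density_probs lam \<Longrightarrow> \<bar>u y\<bar> \<le> C"
begin

lemma diff_le_2C:
  assumes "y \<in> reach w"
  shows "\<bar>u y - u (filt mu w)\<bar> \<le> 2 * C"
proof -
  have "\<bar>u y\<bar> \<le> C" using assms by (intro u_bounded) (simp add: reach_def)
  then show ?thesis using u_bounded[OF filt_mu_in_density_probs[of w]] by linarith
qed

lemma diff_le_osc:
  assumes "y \<in> reach w"
  shows "\<bar>u y - u (filt mu w)\<bar> \<le> osc u w"
  unfolding osc_def by (rule cSUP_upper[OF assms]) (auto intro: bdd_aboveI2 diff_le_2C)

lemma osc_nonneg: "0 \<le> osc u w"
  using diff_le_osc[OF filt_mu_in_reach, of w] by simp

lemma osc_le_2C: "osc u w \<le> 2 * C"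
  unfolding osc_def using filt_mu_in_reach diff_le_2C by (intro cSUP_least) auto

end

text \<open>The sets \<open>reach (w n)\<close> shrink to the point \<open>z\<close>, where \<open>u\<close> is continuous.\<close>

lemma osc_tendsto_0:
  assumes u: "\<And>y. y \<in> density_probs lam \<Longrightarrow> \<bar>u y\<bar> \<le> C"
    and cont: "\<And>e :: real. 0 < e \<Longrightarrow> \<exists>r > 0. \<forall>y \<in> density_probs lam. tv_dist z y < r \<longrightarrow> \<bar>u y - u z\<bar> < e"
    and z: "z \<in> density_probs lam" "(\<lambda>n. tv_dist (filt mu (w n)) z) \<longlonglongrightarrow> 0"
    and w: "\<And>n. 0 < weight mu (w n)" "(\<lambda>n. forget (w n)) \<longlonglongrightarrow> 0"
  shows "(\<lambda>n. osc u (w n)) \<longlonglongrightarrow> 0" "(\<lambda>n. u (filt mu (w n))) \<longlonglongrightarrow> u z"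
proof -
  have ev: "eventually (\<lambda>n. \<forall>y \<in> reach (w n). \<bar>u y - u z\<bar> < e) sequentially" if e: "0 < e" for e
  proof -
    obtain r where r: "r > 0" "\<forall>y \<in> density_probs lam. tv_dist z y < r \<longrightarrow> \<bar>u y - u z\<bar> < e"
      using cont[OF e] by blast
    have "eventually (\<lambda>n. tv_dist (filt mu (w n)) z < r / 2) sequentially"
      "eventually (\<lambda>n. forget (w n) < r / 4) sequentially"
      using order_tendstoD(2)[OF z(2), of "r / 2"] order_tendstoD(2)[OF w(2), of "r / 4"] r by auto
    then show ?thesis
    proof eventually_elim
      case (elim n)
      show ?case
      proof
        fix y assume y: "y \<in> reach (w n)"
        then have yK: "y \<in> density_probs lam" and d: "tv_dist y (filt mu (w n)) \<le> 2 * forget (w n)"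
          using w(1) by (auto simp: reach_def)
        have "tv_dist z y \<le> tv_dist z (filt mu (w n)) + tv_dist (filt mu (w n)) y"
          by (intro tv_dist_triangle density_probsD(1)[OF z(1)] density_probsD(1)[OF yK]
              density_probsD(1)[OF filt_mu_in_density_probs])
        then have "tv_dist z y < r"
          using elim d tv_dist_commute[of z "filt mu (w n)"] tv_dist_commute[of y "filt mu (w n)"]
          by linarith
        then show "\<bar>u y - u z\<bar> < e" using r(2) yK by blast
      qed
    qed
  qed
  show "(\<lambda>n. u (filt mu (w n))) \<longlonglongrightarrow> u z"
  proof (rule tendstoI)
    fix e :: real assume "0 < e"
    from ev[OF this] show "eventually (\<lambda>n. dist (u (filt mu (w n))) (u z) < e) sequentially"
      by eventually_elim (auto simp: dist_real_def filt_mu_in_reach)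
  qed
  show "(\<lambda>n. osc u (w n)) \<longlonglongrightarrow> 0"
  proof (rule tendstoI)
    fix e :: real assume "0 < e"
    then have "0 < e / 3" by simp
    from ev[OF this] show "eventually (\<lambda>n. dist (osc u (w n)) 0 < e) sequentially"
    proof eventually_elim
      case (elim n)
      have "osc u (w n) \<le> 2 * (e / 3)"
        unfolding osc_def
      proof (rule cSUP_least)
        show "reach (w n) \<noteq> {}" using filt_mu_in_reach by auto
        fix y assume "y \<in> reach (w n)"
        then have "\<bar>u y - u z\<bar> < e / 3" "\<bar>u (filt mu (w n)) - u z\<bar> < e / 3"
          using elim filt_mu_in_reach by auto
        then show "\<bar>u y - u (filt mu (w n))\<bar> \<le> 2 * (e / 3)" by linarith
      qed
      then show ?case using osc_nonneg[OF u, where w = "w n"] \<open>0 < e\<close> by (simp add: dist_real_def)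
    qed
  qed
qed

lemma ex_stationary_past:
  "\<exists>L :: (nat \<Rightarrow> 'a) measure. prob_space L \<and>
    (\<forall>n. (\<lambda>om. past om n) \<in> L \<rightarrow>\<^sub>M count_space UNIV \<and>
      distr L (count_space UNIV) (\<lambda>om. past om n) = measure_pmf (mu_words n))"
proof (rule ex_past_measure[OF countable_obs])
  show "length w = n" if "w \<in> set_pmf (mu_words n)" for w n
    using that set_word_pmf[OF mu_finite_borel prob_space_mu] by simp
  show "map_pmf (drop k) (mu_words (k + n)) = mu_words n" for k n
    using map_drop_word_pmf[OF mu_finite_borel prob_space_mu, of k n] by simp
qed

text \<open>The pasts along which the filter converges. The infimum of \<open>forget (past om n)\<close> is its limit, and in
  this form the set is visibly measurable.\<close>

definition typical :: "(nat \<Rightarrow> 'a) measure \<Rightarrow> (nat \<Rightarrow> 'a) set" where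
  "typical L = {om \<in> space L. (\<forall>n. 0 < weight mu (past om n)) \<and> (INF n. ennreal (forget (past om n))) = 0}"

lemma forget_typical:
  assumes "om \<in> typical L"
  shows "(\<lambda>n. forget (past om n)) \<longlonglongrightarrow> 0"
proof -
  have "decseq (\<lambda>n. ennreal (forget (past om n)))"
    using forget_append_le_right[of "[om n]" "past om n" for n]
    by (intro decseq_SucI ennreal_leI) (simp add: past_Suc)
  from LIMSEQ_INF[OF this] have "(\<lambda>n. ennreal (forget (past om n))) \<longlonglongrightarrow> ennreal 0"
    using assms by (simp add: typical_def)
  then show ?thesis by (subst (asm) tendsto_ennreal_iff) (auto simp: forget_nonneg)
qed

context
  fixes L :: "(nat \<Rightarrow> 'a) measure"
  assumes prob_space_L: "prob_space L"
    and past [measurable]: "\<And>n. (\<lambda>om. past om n) \<in> L \<rightarrow>\<^sub>M count_space UNIV"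
    and distr_past: "\<And>n. distr L (count_space UNIV) (\<lambda>om. past om n) = measure_pmf (mu_words n)"
begin

lemma expectation_past:
  "measure_pmf.expectation (mu_words n) f = (\<integral> om. f (past om n) \<partial>L)" for f :: "'a list \<Rightarrow> real"
  unfolding distr_past[symmetric] by (rule integral_distr[OF past]) simp

lemma measurable_past_compose: "(\<lambda>om. f (past om n)) \<in> borel_measurable L"
  by (rule measurable_compose[OF past]) simp

lemma typical_sets [measurable]: "typical L \<in> sets L"
proof -
  define g where "g n om = weight mu (past om n)" for n om
  define h where "h om = (INF n. ennreal (forget (past om n)))" for om
  have [measurable]: "g n \<in> borel_measurable L" for n
    unfolding g_def by (rule measurable_compose[OF past]) simp
  have [measurable]: "h \<in> borel_measurable L"
    unfolding h_def by (intro borel_measurable_INF measurable_compose[OF past]) auto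
  show ?thesis unfolding typical_def g_def[symmetric] h_def[symmetric] by measurable
qed

text \<open>The infimum is dominated by \<open>forget (past om n)\<close> for every \<open>n\<close>, whose integral \<open>memory n mu\<close> tends
  to zero.\<close>

lemma AE_typical: "AE om in L. om \<in> typical L"
proof -
  have "AE om in L. 0 < weight mu (past om n)" for n
  proof -
    have "AE w in distr L (count_space UNIV) (\<lambda>om. past om n). 0 < weight mu w"
      unfolding distr_past AE_measure_pmf_iff
      by (simp add: set_word_pmf[OF mu_finite_borel prob_space_mu])
    then show ?thesis by (subst (asm) AE_distr_iff) auto
  qed
  then have 1: "AE om in L. \<forall>n. 0 < weight mu (past om n)" by (simp add: AE_all_countable)
  have "(\<integral>\<^sup>+ om. (INF n. ennreal (forget (past om n))) \<partial>L) \<le> memory n mu" for n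
  proof -
    have "(\<integral>\<^sup>+ om. (INF n. ennreal (forget (past om n))) \<partial>L) \<le> (\<integral>\<^sup>+ om. ennreal (forget (past om n)) \<partial>L)"
      by (intro nn_integral_mono INF_lower) simp
    also have "\<dots> = memory n mu"
      unfolding memory_def nn_integral_word_pmf[OF mu_finite_borel prob_space_mu, symmetric]
          distr_past[symmetric] by (rule nn_integral_distr[OF past, symmetric]) simp
    finally show ?thesis .
  qed
  then have "(\<integral>\<^sup>+ om. (INF n. ennreal (forget (past om n))) \<partial>L) \<le> 0"
    by (intro LIMSEQ_le_const[OF memory_mu_tendsto_0]) auto
  then have "AE om in L. (INF n. ennreal (forget (past om n))) = 0"
    by (subst (asm) le_zero_eq, subst (asm) nn_integral_0_iff_AE)
       (auto intro!: borel_measurable_INF measurable_compose[OF past])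
  with 1 AE_space show ?thesis by eventually_elim (auto simp: typical_def)
qed

text \<open>The approximating filters depend on finitely many letters, so every event about one of them is
  measurable. The limit lies in an open set \<open>U\<close> iff for some radius the balls around almost all
  approximations are contained in \<open>U\<close>.\<close>

lemma measurable_past_filter_limit:
  assumes f: "\<And>om. f om \<in> density_probs lam"
    "\<And>om. om \<in> typical L \<Longrightarrow> (\<lambda>n. tv_dist (filt mu (past om n)) (f om)) \<longlonglongrightarrow> 0"
    "\<And>om. om \<notin> typical L \<Longrightarrow> f om = mu"
  shows "f \<in> L \<rightarrow>\<^sub>M density_borel lam"
proof (rule measurable_sigma_sets[OF sets_borel_of_metric])
  note ff = density_probsD(1)[OF f(1)] and fz = density_probsD(1)[OF filt_mu_in_density_probs]
  show "{U. openin (mtopology_of (density_probs_metric lam)) U} \<subseteq> Pow (mspace (density_probs_metric lam))"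
    by (auto dest!: openin_subset)
  show "f \<in> space L \<rightarrow> mspace (density_probs_metric lam)" using f(1) by simp
  fix U assume "U \<in> {U. openin (mtopology_of (density_probs_metric lam)) U}"
  then have U: "U \<subseteq> density_probs lam"
    "\<And>x. x \<in> U \<Longrightarrow> \<exists>r > 0. \<forall>y \<in> density_probs lam. tv_dist x y < r \<longrightarrow> y \<in> U"
    by (simp_all add: openin_density_probs_iff)
  define inner where "inner k w \<longleftrightarrow>
    (\<forall>y \<in> density_probs lam. tv_dist (filt mu w) y < inverse (real (Suc k)) \<longrightarrow> y \<in> U)" for k w
  have iff: "f om \<in> U \<longleftrightarrow> (\<exists>k N. \<forall>n \<ge> N. inner k (past om n))" if om: "om \<in> typical L" for om
  proof
    assume "f om \<in> U"
    then obtain r where r: "r > 0" "\<forall>y \<in> density_probs lam. tv_dist (f om) y < r \<longrightarrow> y \<in> U"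
      using U(2) by blast
    obtain k where k: "inverse (real (Suc k)) < r / 2" using reals_Archimedean[of "r / 2"] r by auto
    obtain N where N: "\<forall>n \<ge> N. norm (tv_dist (filt mu (past om n)) (f om) - 0) < r / 2"
      using LIMSEQ_D[OF f(2)[OF om], of "r / 2"] r by auto
    have "inner k (past om n)" if "n \<ge> N" for n
      unfolding inner_def
    proof (intro ballI impI)
      fix y assume y: "y \<in> density_probs lam" "tv_dist (filt mu (past om n)) y < inverse (real (Suc k))"
      have "tv_dist (f om) (filt mu (past om n)) < r / 2"
        using N[rule_format, OF that] tv_dist_nonneg[OF fz ff]
        by (simp add: tv_dist_commute[of "f om"])
      then have "tv_dist (f om) y < r"
        using tv_dist_triangle[OF ff fz density_probsD(1)[OF y(1)], of om "past om n"] y(2) k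
        by linarith
      then show "y \<in> U" using r(2) y(1) by blast
    qed
    then show "\<exists>k N. \<forall>n \<ge> N. inner k (past om n)" by blast
  next
    assume "\<exists>k N. \<forall>n \<ge> N. inner k (past om n)"
    then obtain k N where kN: "\<forall>n \<ge> N. inner k (past om n)" by blast
    obtain M where M: "\<forall>n \<ge> M. norm (tv_dist (filt mu (past om n)) (f om) - 0) < inverse (real (Suc k))"
      using LIMSEQ_D[OF f(2)[OF om], of "inverse (real (Suc k))"] by auto
    have "inner k (past om (max N M))" using kN by simp
    moreover have "tv_dist (filt mu (past om (max N M))) (f om) < inverse (real (Suc k))"
      using M[rule_format, of "max N M"] tv_dist_nonneg[OF fz ff] by simp
    ultimately show "f om \<in> U" using f(1) by (simp add: inner_def)
  qed
  define V where "V k n = (\<lambda>om. past om n) -` {w. inner k w} \<inter> space L" for k n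
  have [measurable]: "V k n \<in> sets L" for k n
    unfolding V_def by (rule measurable_sets[OF past]) simp
  have "f -` U \<inter> space L =
      typical L \<inter> (\<Union>k. \<Union>N. \<Inter>n. V k (N + n)) \<union> (if mu \<in> U then space L - typical L else {})"
  proof -
    have "om \<in> space L" if "om \<in> typical L" for om using that by (simp add: typical_def)
    moreover have "(\<exists>k N. \<forall>n \<ge> N. inner k (past om n)) \<longleftrightarrow> (\<exists>k N. \<forall>n. inner k (past om (N + n)))" for om
      by (metis le_add1 le_Suc_ex)
    ultimately have "om \<in> f -` U \<inter> space L \<longleftrightarrow>
        om \<in> typical L \<inter> (\<Union>k. \<Union>N. \<Inter>n. V k (N + n)) \<union> (if mu \<in> U then space L - typical L else {})" for om
      by (cases "om \<in> typical L") (simp_all add: iff f(3) V_def)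
    then show ?thesis by (rule set_eqI)
  qed
  also have "\<dots> \<in> sets L"
  proof -
    have "(\<Inter>n. V k (N + n)) \<in> sets L" for k N
      by (rule sets.countable_INT) auto
    then have "(\<Union>N. \<Inter>n. V k (N + n)) \<in> sets L" for k
      by (intro sets.countable_UN) auto
    then have "(\<Union>k. \<Union>N. \<Inter>n. V k (N + n)) \<in> sets L"
      by (intro sets.countable_UN) auto
    then show ?thesis using typical_sets by auto
  qed
  finally show "f -` U \<inter> space L \<in> sets L" .
qed
end

text \<open>The limit measure is the law of the filter that has seen an infinite stationary past. Along such a
  past, \<open>u (filt mu (past om j))\<close> converges to the value of \<open>u\<close> at the limit filter and the oscillation
  of \<open>u\<close> on \<open>reach (past om j)\<close> tends to zero. Dominated convergence turns both into statements on
  expectations, and \<open>integral_filter_pow_near_mu\<close> carries them over to an arbitrary initial law.\<close>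

theorem filter_kernel_weakly_ergodic:
  "weakly_ergodic (density_probs_metric lam) (filter_kernel lam tau m)"
proof -
  obtain L :: "(nat \<Rightarrow> 'a) measure" where L_prob: "prob_space L"
    and past: "\<And>n. (\<lambda>om. past om n) \<in> L \<rightarrow>\<^sub>M count_space UNIV"
    and distr_past: "\<And>n. distr L (count_space UNIV) (\<lambda>om. past om n) = measure_pmf (mu_words n)"
    using ex_stationary_past by blast
  note L = L_prob past distr_past
  interpret L: prob_space L by (rule L_prob)
  have "\<forall>om. \<exists>y. y \<in> density_probs lam \<and>
      (om \<in> typical L \<longrightarrow> (\<lambda>n. tv_dist (filt mu (past om n)) y) \<longlonglongrightarrow> 0) \<and> (om \<notin> typical L \<longrightarrow> y = mu)"
    using past_filter_limit forget_typical mu_in_density_probs unfolding typical_def by blast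
  then obtain f where f: "\<And>om. f om \<in> density_probs lam"
    "\<And>om. om \<in> typical L \<Longrightarrow> (\<lambda>n. tv_dist (filt mu (past om n)) (f om)) \<longlonglongrightarrow> 0"
    "\<And>om. om \<notin> typical L \<Longrightarrow> f om = mu"
    by metis
  have f_meas: "f \<in> L \<rightarrow>\<^sub>M density_borel lam"
    by (rule measurable_past_filter_limit[OF L f])
  define nu where "nu = distr L (density_borel lam) f"
  have "(\<lambda>n. \<integral> z. u z \<partial>filter_pow n x) \<longlonglongrightarrow> (\<integral> z. u z \<partial>nu)"
    if u: "u \<in> bounded_cont (density_probs_metric lam)" and x: "x \<in> density_probs lam" for u x
  proof -
    have ucont: "\<exists>r > 0. \<forall>y \<in> density_probs lam. tv_dist x y < r \<longrightarrow> \<bar>u y - u x\<bar> < e"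
      if "x \<in> density_probs lam" "0 < e" for x e
      using u that by (intro continuous_map_density_probsD) (auto simp: bounded_cont_def)
    have um: "u \<in> borel_measurable (density_borel lam)"
      by (rule borel_measurable_density_borelI[OF ucont])
    have "bounded (u ` density_probs lam)" using u by (simp add: bounded_cont_def)
    then obtain C where C: "0 < C" "\<And>y. y \<in> density_probs lam \<Longrightarrow> \<bar>u y\<bar> \<le> C"
      unfolding bounded_pos by auto
    have limits: "(\<lambda>n. osc u (past om n)) \<longlonglongrightarrow> 0" "(\<lambda>n. u (filt mu (past om n))) \<longlonglongrightarrow> u (f om)"
      if om: "om \<in> typical L" for om
    proof -
      have "0 < weight mu (past om n)" for n using om by (simp add: typical_def)
      note osc_tendsto_0[OF C(2) ucont[OF f(1)] f(1) f(2)[OF om] this forget_typical[OF om]]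
      then show "(\<lambda>n. osc u (past om n)) \<longlonglongrightarrow> 0" "(\<lambda>n. u (filt mu (past om n))) \<longlonglongrightarrow> u (f om)"
        by blast+
    qed
    have E_osc: "(\<lambda>j. measure_pmf.expectation (mu_words j) (osc u)) \<longlonglongrightarrow> 0"
    proof -
      have "(\<lambda>j. \<integral> om. osc u (past om j) \<partial>L) \<longlonglongrightarrow> (\<integral> om. 0 \<partial>L)"
      proof (rule integral_dominated_convergence[where w = "\<lambda>_. 2 * C"])
        show "AE om in L. (\<lambda>j. osc u (past om j)) \<longlonglongrightarrow> 0"
          using AE_typical[OF L] by eventually_elim (rule limits(1))
        show "AE om in L. norm (osc u (past om j)) \<le> 2 * C" for j
          using osc_nonneg[OF C(2)] osc_le_2C[OF C(2)] by simp
        show "(\<lambda>om. osc u (past om j)) \<in> borel_measurable L" for j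
          by (rule measurable_past_compose[OF L])
      qed simp_all
      then show ?thesis by (simp add: expectation_past[OF L])
    qed
    have E_u: "(\<lambda>j. \<integral> z. u z \<partial>filter_pow j mu) \<longlonglongrightarrow> (\<integral> z. u z \<partial>nu)"
    proof -
      have "(\<lambda>j. \<integral> om. u (filt mu (past om j)) \<partial>L) \<longlonglongrightarrow> (\<integral> om. u (f om) \<partial>L)"
      proof (rule integral_dominated_convergence[where w = "\<lambda>_. C"])
        show "AE om in L. (\<lambda>j. u (filt mu (past om j))) \<longlonglongrightarrow> u (f om)"
          using AE_typical[OF L] by eventually_elim (rule limits(2))
        show "AE om in L. norm (u (filt mu (past om j))) \<le> C" for j
          using C(2)[OF filt_mu_in_density_probs] by simp
        show "(\<lambda>om. u (f om)) \<in> borel_measurable L" by (rule measurable_compose[OF f_meas um])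
        show "(\<lambda>om. u (filt mu (past om j))) \<in> borel_measurable L" for j
          by (rule measurable_past_compose[OF L])
      qed simp
      moreover have "(\<integral> z. u z \<partial>nu) = (\<integral> om. u (f om) \<partial>L)"
        unfolding nu_def by (rule integral_distr[OF f_meas um])
      ultimately show ?thesis
        by (simp add: integral_filter_pow[OF mu_in_density_probs um] expectation_past[OF L])
    qed
    show ?thesis
    proof (rule tendstoI)
      fix e :: real assume e: "0 < e"
      have "eventually (\<lambda>j. measure_pmf.expectation (mu_words j) (osc u) < e / 3 \<and>
          dist (\<integral> z. u z \<partial>filter_pow j mu) (\<integral> z. u z \<partial>nu) < e / 3) sequentially"
        using order_tendstoD(2)[OF E_osc, of "e / 3"] tendstoD[OF E_u, of "e / 3"] e
        by (simp add: eventually_conj)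
      then obtain j where j: "measure_pmf.expectation (mu_words j) (osc u) < e / 3"
        "dist (\<integral> z. u z \<partial>filter_pow j mu) (\<integral> z. u z \<partial>nu) < e / 3"
        by (auto dest: eventually_happens'[OF sequentially_bot])
      have "eventually (\<lambda>N. tv_dist (push N x) mu < e / (18 * C)) sequentially"
        using order_tendstoD(2)[OF tv_dist_push_mu[OF density_probsD(1,2)[OF x]], of "e / (18 * C)"] e C(1)
        by simp
      then have "eventually (\<lambda>N. dist (\<integral> z. u z \<partial>filter_pow (N + j) x) (\<integral> z. u z \<partial>nu) < e) sequentially"
      proof eventually_elim
        case (elim N)
        have "6 * C * tv_dist (push N x) mu < e / 3"
          using elim C(1) by (simp add: field_simps)
        moreover have "\<bar>(\<integral> z. u z \<partial>filter_pow (N + j) x) - (\<integral> z. u z \<partial>filter_pow j mu)\<bar> \<le>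
            measure_pmf.expectation (mu_words j) (osc u) + 6 * C * tv_dist (push N x) mu"
          by (rule integral_filter_pow_near_mu[OF x um C osc_nonneg[OF C(2)] osc_le_2C[OF C(2)]])
             (auto intro!: diff_le_osc[OF C(2)] simp: reach_def)
        ultimately show ?case using j unfolding dist_real_def by linarith
      qed
      then show "eventually (\<lambda>n. dist (\<integral> z. u z \<partial>filter_pow n x) (\<integral> z. u z \<partial>nu) < e) sequentially"
        using eventually_sequentially_seg[of "\<lambda>n. dist (\<integral> z. u z \<partial>filter_pow n x) (\<integral> z. u z \<partial>nu) < e" j]
        by simp
    qed
  qed
  moreover have "prob_space nu" unfolding nu_def by (rule L.prob_space_distr[OF f_meas])
  moreover have "sets nu = sets (density_borel lam)" by (simp add: nu_def)
  ultimately show ?thesis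
    using filter_kernel_weakly_contracting unfolding weakly_ergodic_def by auto
qed

end

theorem theorem13p1:
  fixes lam :: "'s::polish_space measure"
    and tau :: "'a::polish_space measure"
    and m :: "'s \<Rightarrow> 's \<Rightarrow> 'a \<Rightarrow> real"
    and S :: "'a \<Rightarrow> 's set"
    and mu :: "'s measure"
    and a\<^sub>0 :: 'a
    and d\<^sub>0 D\<^sub>0 :: real
  assumes "regular_hmm lam tau m"
    and "countable (UNIV :: 'a set)"
    and "\<And>a. S a \<in> sets borel"
    and "disjoint_family S"
    and "(\<Union>a. S a) = UNIV"
    and "\<And>a. emeasure lam (S a) > 0"
    and "\<And>s t a. ennreal (m s t a) = trans_density tau m s t * indicator (S a) t"
    and "strongly_ergodic (hidden_kernel lam tau m) mu"
    and "emeasure mu (S a\<^sub>0) > 0"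
    and "0 < d\<^sub>0" and "d\<^sub>0 \<le> D\<^sub>0"
    and "\<And>s t. s \<in> S a\<^sub>0 \<Longrightarrow> t \<in> S a\<^sub>0 \<Longrightarrow>
           ennreal d\<^sub>0 \<le> trans_density tau m s t \<and> trans_density tau m s t \<le> ennreal D\<^sub>0"
  shows "weakly_ergodic (density_probs_metric lam) (filter_kernel lam tau m)"
proof -
  interpret hmm lam tau m using assms(1) by (rule regular_hmm.axioms)
  interpret ergodic_partition_hmm lam tau m S a\<^sub>0 d\<^sub>0 D\<^sub>0 mu
    by unfold_locales (fact assms)+
  show ?thesis by (rule filter_kernel_weakly_ergodic)
qed

end
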